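(* Let $j$ be a positive integer. Then, as an identity of polynomials in complex variables $d,e$, \[ \operatorname{Ch}_{2j}\big( (e-d) \times (e+d) \big) = (-1)^{j-1} \binom{2j-1}{j} \sum_{k=0}^{j} g_k(j)\, 2d\left( \prod_{r=1}^{k} \big( d^2-(r-\tfrac{1}{2})^2 \big ) \right) \left( \prod_{r=k+1}^{j} \big( e^2-(r-\tfrac{1}{2})^2 \big )\right), \] where $g_0(j)=1$ and $g_k(j)= (-1)^{k} \frac{j^{\downarrow k} \, (2j+1)^{\uparrow \uparrow k}}{k! \, (2k+1)!!}$ for $1 \le k \le j$.
   Context: For a partition $\pi$ of $k$ and a partition $\lambda$ of $n$, $\operatorname{Ch}_\pi(\lambda)= n^{\downarrow k}\, \chi^\lambda_{\pi\cup(1^{n-k})}/f^\lambda$ if $n\ge k$ and $0$ otherwise ($\chi^\lambda_\mu$ the irreducible character of $\mathfrak{S}_n$ at cycle type $\mu$, $f^\lambda$ its dimension, $n^{\downarrow k}=n(n-1)\cdots(n-k+1)$); $\operatorname{Ch}_k:=\operatorname{Ch}_{(k)}$. $p\times q$ is the rectangular Young diagram with $p$ rows of length $q$. For fixed $\pi$ there is a unique polynomial in $\mathbb{Q}[p,q]$ agreeing with $\operatorname{Ch}_\pi(p\times q)$ at all positive integers $p,q$ (namely $(-1)^k\sum_{\sigma_1\sigma_2=w_\pi}(-q)^{\kappa(\sigma_1)}p^{\kappa(\sigma_2)}$ over $\sigma_1,\sigma_2\in\mathfrak{S}_k$, $w_\pi$ of cycle type $\pi$, $\kappa$ = number of cycles);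 for complex $p,q$, $\operatorname{Ch}_\pi(p\times q)$ means this polynomial's value. $a^{\uparrow\uparrow k}=\prod_{r=0}^{k-1}(a+2r)$, $a^{\uparrow\uparrow0}=1$. *)

theory Defs
  imports
    Complex_Main
    "HOL-Library.Function_Algebras"
    "HOL-Library.Multiset"
    "HOL-Combinatorics.Orbits"
    "HOL-Computational_Algebra.Polynomial"
begin

text \<open>
  Integer partitions are weakly decreasing lists of positive integers, and the symmetric group
  of degree \<open>n\<close> consists of the permutations of \<open>{..<n}\<close>.
\<close>

section \<open>The complex group algebra of the symmetric group\<close>

text \<open>
  An element of the group algebra is its coefficient function, which vanishes outside the group.
\<close>

type_synonym galg = "(nat \<Rightarrow> nat) \<Rightarrow> complex"

definition galg_scale :: "complex \<Rightarrow> galg \<Rightarrow> galg" where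
  "galg_scale c f = (\<lambda>x. c * f x)"

global_interpretation galg: vector_space galg_scale
  by unfold_locales (auto simp: galg_scale_def fun_eq_iff algebra_simps)

definition group_algebra :: "nat \<Rightarrow> galg set" where
  "group_algebra n = {f. \<forall>x. \<not> x permutes {..<n} \<longrightarrow> f x = 0}"

definition galg_mult :: "nat \<Rightarrow> galg \<Rightarrow> galg \<Rightarrow> galg" where
  "galg_mult n f h = (\<lambda>x. if x permutes {..<n}
     then (\<Sum>s | s permutes {..<n}. f s * h (inv s \<circ> x)) else 0)"

definition galg_of :: "(nat \<Rightarrow> nat) \<Rightarrow> galg" where
  "galg_of w = (\<lambda>x. if x = w then 1 else 0)"

text \<open>
  Trace of a linear endomorphism of a finite-dimensional subspace, computed in any basis.
\<close>

definition galg_trace :: "galg set \<Rightarrow> (galg \<Rightarrow> galg) \<Rightarrow> complex" where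
  "galg_trace V L =
     (let B = (SOME B. B \<subseteq> V \<and> galg.independent B \<and> V \<subseteq> galg.span B)
      in \<Sum>b\<in>B. galg.representation B (L b) b)"

section \<open>Irreducible characters of the symmetric group\<close>

text \<open>
  Row and column (counted from 0) of the entry \<open>m\<close> in the tableau of shape \<open>la\<close> that is filled
  with \<open>0, 1, 2, \<dots>\<close> row by row.
\<close>

definition tab_row :: "nat list \<Rightarrow> nat \<Rightarrow> nat" where
  "tab_row la m = (LEAST i. m < sum_list (take (Suc i) la))"

definition tab_col :: "nat list \<Rightarrow> nat \<Rightarrow> nat" where
  "tab_col la m = m - sum_list (take (tab_row la m) la)"

definition row_group :: "nat list \<Rightarrow> (nat \<Rightarrow> nat) set" where
  "row_group la = {s. s permutes {..<sum_list la} \<and>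
     (\<forall>m<sum_list la. tab_row la (s m) = tab_row la m)}"

definition col_group :: "nat list \<Rightarrow> (nat \<Rightarrow> nat) set" where
  "col_group la = {s. s permutes {..<sum_list la} \<and>
     (\<forall>m<sum_list la. tab_col la (s m) = tab_col la m)}"

definition young_symmetrizer :: "nat list \<Rightarrow> galg" where
  "young_symmetrizer la =
     (\<Sum>s\<in>row_group la. \<Sum>t\<in>col_group la. galg_scale (of_int (sign t)) (galg_of (s \<circ> t)))"

text \<open>
  The irreducible module indexed by \<open>la\<close> is the left ideal generated by the Young symmetrizer.
\<close>

definition specht_module :: "nat list \<Rightarrow> galg set" where
  "specht_module la =
     (\<lambda>f. galg_mult (sum_list la) f (young_symmetrizer la)) ` group_algebra (sum_list la)"

definition specht_dim :: "nat list \<Rightarrow> nat" where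
  "specht_dim la = galg.dim (specht_module la)"

definition specht_char :: "nat list \<Rightarrow> (nat \<Rightarrow> nat) \<Rightarrow> complex" where
  "specht_char la w = galg_trace (specht_module la) (galg_mult (sum_list la) (galg_of w))"

definition cycle_type :: "nat \<Rightarrow> (nat \<Rightarrow> nat) \<Rightarrow> nat multiset" where
  "cycle_type n w = image_mset card (mset_set (orbit w ` {..<n}))"

definition irr_char :: "nat list \<Rightarrow> nat multiset \<Rightarrow> complex" where
  "irr_char la mu =
     specht_char la (SOME w. w permutes {..<sum_list la} \<and> cycle_type (sum_list la) w = mu)"

section \<open>Normalized characters\<close>

definition falling :: "'a::comm_ring_1 \<Rightarrow> nat \<Rightarrow> 'a" where
  "falling a k = (\<Prod>i<k. a - of_nat i)"

definition rising2 :: "'a::comm_semiring_1 \<Rightarrow> nat \<Rightarrow> 'a" where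
  "rising2 a k = (\<Prod>r<k. a + 2 * of_nat r)"

fun double_fact :: "nat \<Rightarrow> nat" where
  "double_fact 0 = 1"
| "double_fact (Suc 0) = 1"
| "double_fact (Suc (Suc n)) = Suc (Suc n) * double_fact n"

definition Ch :: "nat list \<Rightarrow> nat list \<Rightarrow> complex" where
  "Ch ps la = (let k = sum_list ps; n = sum_list la in
     if k \<le> n
     then falling (of_nat n) k * irr_char la (mset ps + replicate_mset (n - k) 1)
          / of_nat (specht_dim la)
     else 0)"

text \<open>
  A polynomial in \<open>\<rat>[p,q]\<close> is represented as a polynomial in \<open>q\<close> with coefficients in \<open>\<rat>[p]\<close>.
\<close>

definition eval_pq :: "rat poly poly \<Rightarrow> complex \<Rightarrow> complex \<Rightarrow> complex" where
  "eval_pq P p q = poly (map_poly (\<lambda>a. poly (map_poly of_rat a) p) P) q"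

text \<open>
  The list \<open>replicate p q\<close> is the rectangular diagram with \<open>p\<close> rows of length \<open>q\<close>.
\<close>

definition Ch_rect_poly :: "nat list \<Rightarrow> rat poly poly" where
  "Ch_rect_poly ps = (THE P. \<forall>p>0. \<forall>q>0.
     eval_pq P (of_nat p) (of_nat q) = Ch ps (replicate p q))"

definition Ch_rect :: "nat list \<Rightarrow> complex \<Rightarrow> complex \<Rightarrow> complex" where
  "Ch_rect ps p q = eval_pq (Ch_rect_poly ps) p q"

definition g_coeff :: "nat \<Rightarrow> nat \<Rightarrow> complex" where
  "g_coeff k j = (if k = 0 then 1 else
     (-1) ^ k * (falling (of_nat j) k * rising2 (2 * of_nat j + 1) k)
       / (fact k * of_nat (double_fact (2 * k + 1))))"

end

theory Submission
  imports Defs "HOL-Combinatorics.Cycles"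
begin

text \<open>
  Since the Young symmetrizer \<open>Y\<close> is a quasi-idempotent, a normalized character value is an average of
  the coefficients of \<open>Y\<close> over a conjugacy class. For a \<open>k\<close>-cycle this average is a sum over injective
  labellings of \<open>{..<k}\<close> by cells; the non-injective labellings cancel in pairs, so for a rectangle one
  obtains Stanley's formula: the coefficient at a full cycle of the product of the class functions
  \<open>\<sigma> \<mapsto> p ^ \<kappa>(\<sigma>)\<close> and \<open>\<sigma> \<mapsto> sgn(\<sigma>) q ^ \<kappa>(\<sigma>)\<close> on the symmetric group of degree \<open>k\<close>. These act on
  the symmetrizers of hooks by explicit scalars, and an alternating sum over hooks isolates the full
  cycles, which gives
  \<open>k! Ch\<^sub>k(p \<times> q) = \<Sum>r<k. (-1) ^ r (k-1 choose r) (\<Prod>i<k. p-r+i) (\<Prod>i<k. q+r-i)\<close>.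
  For \<open>k = 2j\<close>, \<open>p = e-d\<close>, \<open>q = e+d\<close> the right-hand side is a central difference in \<open>d\<close> of order \<open>2j-1\<close>;
  it is evaluated by expanding its argument in central factorials of \<open>d\<close> (Pfaff--Saalschuetz).
\<close>

section \<open>Permutations and the group algebra\<close>

text \<open>The obstacle is that \<open>Ch\<close> is defined by traces on concrete left ideals,
  while the formula needs a sum over pairs of permutations. One fact bridges them: an element that
  is row invariant on the left and column alternating on the right is a multiple of
  \<open>Y\<close>. For Y Y this gives the trace formula; for z Y with z central it says that class
  functions act by scalars. One locale serves both the rectangle, whose character is wanted, and the
  hooks, which evaluate the resulting convolution. Powers p ^ \<kappa>(\<sigma>) occur as numbers of
  invariant maps: labellings by cells produce them in this form, and inserting one point at a time
  turns them into products of p + c and q - c over the contents c of a hook. Hooks are indexed by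
  the set of leg cells, not by its size, so that a cycle can be moved bodily between leg and arm. In
  the final sum, D = d + r - (2j-1)/2 makes r enter through D^2 alone. A difference of order 2j-1
  sends central factorials of degree 2n to degree 2(n-j)+1 and kills those with n < j; hence the j+1
  terms and the common factor d.\<close>

lemma finite_perms [simp]: "finite {s. s permutes {..<n::nat}}"
  by (simp add: finite_permutations)

lemma permutes_inv_comp:
  assumes "a permutes S" "b permutes S"
  shows "inv (a \<circ> b) = inv b \<circ> inv a"
  using assms by (simp add: o_inv_distrib permutes_bij)

lemma permutes_comp_left_cancel:
  assumes "a permutes S"
  shows "a \<circ> (inv a \<circ> x) = x" "inv a \<circ> (a \<circ> x) = x"
  using permutes_inv_o[OF assms] by (simp_all flip: comp_assoc)

lemma sign_permutes_comp:
  assumes "a permutes S" "b permutes S" "finite S"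
  shows "sign (a \<circ> b) = sign a * sign b"
  using assms by (intro sign_compose) (auto intro: permutes_imp_permutation)

lemma sign_permutes_inv:
  assumes "a permutes S" "finite S"
  shows "sign (inv a) = sign a"
  using assms by (intro sign_inverse) (auto intro: permutes_imp_permutation)

lemma group_algebra_outside: "f \<in> group_algebra n \<Longrightarrow> \<not> x permutes {..<n} \<Longrightarrow> f x = 0"
  by (simp add: group_algebra_def)

lemma galg_mult_apply:
  "x permutes {..<n} \<Longrightarrow> galg_mult n f h x = (\<Sum>s | s permutes {..<n}. f s * h (inv s \<circ> x))"
  by (simp add: galg_mult_def)

lemma galg_mult_closed: "galg_mult n f h \<in> group_algebra n"
  by (simp add: galg_mult_def group_algebra_def)

lemma galg_of_closed: "w permutes {..<n} \<Longrightarrow> galg_of w \<in> group_algebra n"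
  by (auto simp: galg_of_def group_algebra_def)

lemma group_algebra_eqI:
  assumes "f \<in> group_algebra n" "h \<in> group_algebra n"
    "\<And>x. x permutes {..<n} \<Longrightarrow> f x = h x"
  shows "f = h"
  using assms by (metis ext group_algebra_outside)

lemma galg_mult_of_left:
  assumes "w permutes {..<n}" "x permutes {..<n}"
  shows "galg_mult n (galg_of w) h x = h (inv w \<circ> x)"
proof -
  have "galg_mult n (galg_of w) h x
      = (\<Sum>s | s permutes {..<n}. if s = w then h (inv s \<circ> x) else 0)"
    using assms by (simp add: galg_mult_apply galg_of_def if_distrib[of "\<lambda>u. u * _"] cong: if_cong)
  also have "\<dots> = h (inv w \<circ> x)"
    using assms by (simp add: sum.delta')
  finally show ?thesis .
qed

lemma galg_mult_assoc:
  "galg_mult n (galg_mult n f g) h = galg_mult n f (galg_mult n g h)"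
proof (rule group_algebra_eqI[OF galg_mult_closed galg_mult_closed])
  fix x assume x: "x permutes {..<n}"
  let ?G = "{s. s permutes {..<n}}"
  have "galg_mult n (galg_mult n f g) h x
      = (\<Sum>s\<in>?G. \<Sum>t\<in>?G. f t * g (inv t \<circ> s) * h (inv s \<circ> x))"
    using x by (simp add: galg_mult_apply sum_distrib_right)
  also have "\<dots> = (\<Sum>t\<in>?G. \<Sum>s\<in>?G. f t * g (inv t \<circ> s) * h (inv s \<circ> x))"
    by (rule sum.swap)
  also have "\<dots> = (\<Sum>t\<in>?G. \<Sum>s\<in>?G. f t * (g s * h (inv s \<circ> (inv t \<circ> x))))"
  proof (rule sum.cong[OF refl])
    fix t assume "t \<in> ?G"
    hence t: "t permutes {..<n}" by simp
    have "(\<Sum>s\<in>?G. f t * g (inv t \<circ> s) * h (inv s \<circ> x))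
        = (\<Sum>s\<in>?G. f t * g (inv t \<circ> (t \<circ> s)) * h (inv (t \<circ> s) \<circ> x))"
      by (rule setum_permutations_compose_left[OF t])
    also have "\<dots> = (\<Sum>s\<in>?G. f t * (g s * h (inv s \<circ> (inv t \<circ> x))))"
      by (intro sum.cong refl)
        (simp add: permutes_comp_left_cancel[OF t] permutes_inv_comp[OF t] comp_assoc)
    finally show "(\<Sum>s\<in>?G. f t * g (inv t \<circ> s) * h (inv s \<circ> x))
        = (\<Sum>s\<in>?G. f t * (g s * h (inv s \<circ> (inv t \<circ> x))))" .
  qed
  also have "\<dots> = galg_mult n f (galg_mult n g h) x"
    using x by (simp add: galg_mult_apply sum_distrib_left permutes_compose permutes_inv)
  finally show "galg_mult n (galg_mult n f g) h x = galg_mult n f (galg_mult n g h) x" .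
qed

lemma galg_mult_scale_left: "galg_mult n (galg_scale c f) h = galg_scale c (galg_mult n f h)"
  by (simp add: galg_mult_def galg_scale_def fun_eq_iff sum_distrib_left mult.assoc)

lemma galg_mult_scale_right: "galg_mult n f (galg_scale c h) = galg_scale c (galg_mult n f h)"
  by (simp add: galg_mult_def galg_scale_def fun_eq_iff sum_distrib_left mult.left_commute)

lemma sum_fun_apply: "(\<Sum>i\<in>I. F i) x = (\<Sum>i\<in>I. F i x)"
  by (induction I rule: infinite_finite_induct) auto

lemma galg_mult_sum_left: "galg_mult n (\<Sum>i\<in>I. F i) h = (\<Sum>i\<in>I. galg_mult n (F i) h)"
proof (rule group_algebra_eqI[OF galg_mult_closed])
  show "(\<Sum>i\<in>I. galg_mult n (F i) h) \<in> group_algebra n"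
    by (simp add: group_algebra_def sum_fun_apply galg_mult_def)
  show "galg_mult n (\<Sum>i\<in>I. F i) h x = (\<Sum>i\<in>I. galg_mult n (F i) h) x"
    if "x permutes {..<n}" for x
    using that by (simp add: galg_mult_apply sum_fun_apply sum_distrib_right) (rule sum.swap)
qed

lemma galg_mult_sum_right: "galg_mult n f (\<Sum>i\<in>I. F i) = (\<Sum>i\<in>I. galg_mult n f (F i))"
proof (rule group_algebra_eqI[OF galg_mult_closed])
  show "(\<Sum>i\<in>I. galg_mult n f (F i)) \<in> group_algebra n"
    by (simp add: group_algebra_def sum_fun_apply galg_mult_def)
  show "galg_mult n f (\<Sum>i\<in>I. F i) x = (\<Sum>i\<in>I. galg_mult n f (F i)) x"
    if "x permutes {..<n}" for x
    using that by (simp add: galg_mult_apply sum_fun_apply sum_distrib_left) (rule sum.swap)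
qed

lemma galg_expand:
  assumes "f \<in> group_algebra n"
  shows "f = (\<Sum>x | x permutes {..<n}. galg_scale (f x) (galg_of x))"
proof
  fix y
  have "(\<Sum>x | x permutes {..<n}. galg_scale (f x) (galg_of x)) y
      = (\<Sum>x | x permutes {..<n}. if x = y then f x else 0)"
    unfolding sum_fun_apply by (intro sum.cong refl) (simp add: galg_scale_def galg_of_def)
  also have "\<dots> = f y"
    using assms by (simp add: sum.delta' group_algebra_outside)
  finally show "f y = (\<Sum>x | x permutes {..<n}. galg_scale (f x) (galg_of x)) y" by simp
qed

section \<open>Traces on a left ideal\<close>

text \<open>\<open>galg_trace\<close> uses an unspecified basis, so its existence and finiteness
  must be known before any computation; the finitely many \<open>galg_of x\<close> span the whole
  algebra.\<close>

lemma galg_basis: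
  assumes "V \<subseteq> group_algebra n"
  defines "B \<equiv> SOME B. B \<subseteq> V \<and> galg.independent B \<and> V \<subseteq> galg.span B"
  shows "B \<subseteq> V" "galg.independent B" "V \<subseteq> galg.span B" "finite B"
proof -
  have "\<exists>B. B \<subseteq> V \<and> galg.independent B \<and> V \<subseteq> galg.span B"
    by (rule galg.basis_exists[of V]) blast
  hence *: "B \<subseteq> V \<and> galg.independent B \<and> V \<subseteq> galg.span B"
    unfolding B_def by (rule someI_ex)
  thus B: "B \<subseteq> V" "galg.independent B" "V \<subseteq> galg.span B" by auto
  have "f \<in> galg.span (galg_of ` {s. s permutes {..<n}})" if "f \<in> group_algebra n" for f
    by (subst galg_expand[OF that])
      (rule galg.span_sum, rule galg.span_scale, rule galg.span_base, simp)
  hence "B \<subseteq> galg.span (galg_of ` {s. s permutes {..<n}})"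
    using B(1) assms(1) by blast
  thus "finite B"
    using galg.independent_span_bound[OF _ B(2)] by (metis finite_imageI finite_perms)
qed

text \<open>
  The right-hand side is the trace of \<open>f \<mapsto> w f Y\<close> on the whole group algebra.
\<close>

lemma trace_left_ideal:
  fixes n :: nat and Y :: galg
  defines "V \<equiv> (\<lambda>f. galg_mult n f Y) ` group_algebra n"
  assumes scalar: "\<And>v. v \<in> V \<Longrightarrow> galg_mult n v Y = galg_scale \<alpha> v"
    and w: "w permutes {..<n}"
  shows "\<alpha> * galg_trace V (galg_mult n (galg_of w))
           = (\<Sum>x | x permutes {..<n}. Y (inv x \<circ> inv w \<circ> x))"
proof -
  let ?G = "{s. s permutes {..<n}}"
  let ?L = "galg_mult n (galg_of w)"
  define B where "B = (SOME B. B \<subseteq> V \<and> galg.independent B \<and> V \<subseteq> galg.span B)"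
  have VA: "V \<subseteq> group_algebra n"
    by (auto simp: V_def galg_mult_closed)
  note B = galg_basis[OF VA, folded B_def]
  let ?rep = "galg.representation B"
  have LV: "?L v \<in> V" if "v \<in> V" for v
    using that by (auto simp: V_def galg_mult_closed simp flip: galg_mult_assoc)
  have YV: "galg_mult n (galg_of x) Y \<in> V" if "x permutes {..<n}" for x
    using that by (auto simp: V_def galg_of_closed)
  \<comment> \<open>Diagonal entries in the basis of group elements; next, each product of
    \<open>galg_of x\<close> with \<open>Y\<close> is expanded in the basis \<open>B\<close> of the
    ideal.\<close>
  have "(\<Sum>x\<in>?G. Y (inv x \<circ> inv w \<circ> x)) = (\<Sum>x\<in>?G. ?L (galg_mult n (galg_of x) Y) x)"
    using w by (intro sum.cong refl)
      (simp add: galg_mult_of_left permutes_compose permutes_inv comp_assoc)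
  also have "\<dots> = (\<Sum>x\<in>?G. \<Sum>b\<in>B. ?rep (galg_mult n (galg_of x) Y) b * ?L b x)"
  proof (intro sum.cong refl)
    fix x assume "x \<in> ?G"
    hence "galg_mult n (galg_of x) Y
        = (\<Sum>b\<in>B. galg_scale (?rep (galg_mult n (galg_of x) Y) b) b)"
      using galg.sum_representation_eq[OF B(2) _ B(4) order.refl, symmetric] YV B(3) by blast
    hence "?L (galg_mult n (galg_of x) Y) x
        = ?L (\<Sum>b\<in>B. galg_scale (?rep (galg_mult n (galg_of x) Y) b) b) x"
      by simp
    also have "\<dots> = (\<Sum>b\<in>B. ?rep (galg_mult n (galg_of x) Y) b * ?L b x)"
      by (simp add: galg_mult_sum_right galg_mult_scale_right sum_fun_apply)
        (simp add: galg_scale_def)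
    finally show "?L (galg_mult n (galg_of x) Y) x
        = (\<Sum>b\<in>B. ?rep (galg_mult n (galg_of x) Y) b * ?L b x)" .
  qed
  also have "\<dots> = (\<Sum>b\<in>B. \<Sum>x\<in>?G. ?L b x * ?rep (galg_mult n (galg_of x) Y) b)"
    by (subst sum.swap) (simp add: mult.commute)
  \<comment> \<open>Summed over \<open>x\<close> with weights \<open>?L b x\<close>, the products
    with \<open>Y\<close> reassemble to \<open>?L b\<close> times \<open>Y\<close>, on which the
    scalar hypothesis applies.\<close>
  also have "\<dots> = (\<Sum>b\<in>B. \<alpha> * ?rep (?L b) b)"
  proof (intro sum.cong refl)
    fix b assume b: "b \<in> B"
    hence Lb: "?L b \<in> V" using B(1) LV by auto
    have span: "galg_mult n (galg_of x) Y \<in> galg.span B" if "x \<in> ?G" for x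
      using that YV B(3) by auto
    have "(\<Sum>x\<in>?G. ?L b x * ?rep (galg_mult n (galg_of x) Y) b)
        = (\<Sum>x\<in>?G. ?rep (galg_scale (?L b x) (galg_mult n (galg_of x) Y)) b)"
      using span by (intro sum.cong refl) (simp add: galg.representation_scale[OF B(2)])
    also have "\<dots> = ?rep (\<Sum>x\<in>?G. galg_scale (?L b x) (galg_mult n (galg_of x) Y)) b"
      using span by (subst galg.representation_sum[OF B(2)])
        (auto intro!: galg.span_scale)
    also have "(\<Sum>x\<in>?G. galg_scale (?L b x) (galg_mult n (galg_of x) Y))
        = galg_mult n (\<Sum>x\<in>?G. galg_scale (?L b x) (galg_of x)) Y"
      by (simp add: galg_mult_sum_left galg_mult_scale_left)
    also have "\<dots> = galg_scale \<alpha> (?L b)"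
      using galg_expand[OF galg_mult_closed[of n "galg_of w" b]] scalar[OF Lb] by simp
    also have "?rep \<dots> b = \<alpha> * ?rep (?L b) b"
      using Lb B(3) by (subst galg.representation_scale[OF B(2)]) auto
    finally show "(\<Sum>x\<in>?G. ?L b x * ?rep (galg_mult n (galg_of x) Y) b) = \<alpha> * ?rep (?L b) b" .
  qed
  also have "\<dots> = \<alpha> * galg_trace V ?L"
    unfolding galg_trace_def Let_def B_def[symmetric] by (simp add: sum_distrib_left)
  finally show ?thesis by simp
qed

lemma trace_id_left_ideal:
  assumes "V \<subseteq> group_algebra n"
  shows "galg_trace V (galg_mult n (galg_of id)) = of_nat (galg.dim V)"
proof -
  define B where "B = (SOME B. B \<subseteq> V \<and> galg.independent B \<and> V \<subseteq> galg.span B)"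
  note B = galg_basis[OF assms, folded B_def]
  have id: "galg_mult n (galg_of id) b = b" if "b \<in> B" for b
    by (rule group_algebra_eqI[OF galg_mult_closed, where h = b])
      (use that B(1) assms in \<open>auto simp: galg_mult_of_left\<close>)
  have "galg_trace V (galg_mult n (galg_of id)) = (\<Sum>b\<in>B. 1)"
    unfolding galg_trace_def Let_def B_def[symmetric]
    by (intro sum.cong refl) (simp add: id galg.representation_basis[OF B(2)])
  also have "\<dots> = of_nat (galg.dim V)"
    using galg.basis_card_eq_dim[OF B(1,3,2)] by simp
  finally show ?thesis .
qed

section \<open>Young symmetrizers\<close>

text \<open>The level function is arbitrary, so that rectangles (\<open>div\<close> and
  \<open>mod\<close>) and hooks with varying legs fall under the same theory.\<close>

definition level_group :: "nat \<Rightarrow> (nat \<Rightarrow> nat) \<Rightarrow> (nat \<Rightarrow> nat) set" where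
  "level_group n h = {s. s permutes {..<n} \<and> (\<forall>m<n. h (s m) = h m)}"

definition symmetrizer :: "nat \<Rightarrow> (nat \<Rightarrow> nat) \<Rightarrow> (nat \<Rightarrow> nat) \<Rightarrow> galg" where
  "symmetrizer n row col = (\<lambda>x. \<Sum>s\<in>level_group n row. \<Sum>t\<in>level_group n col.
     if x = s \<circ> t then of_int (sign t) else 0)"

lemma young_symmetrizer_eq:
  "young_symmetrizer la = symmetrizer (sum_list la) (tab_row la) (tab_col la)"
  by (auto simp: young_symmetrizer_def symmetrizer_def row_group_def col_group_def level_group_def
      sum_fun_apply galg_scale_def galg_of_def fun_eq_iff intro!: sum.cong)

lemma level_group_permutes: "s \<in> level_group n h \<Longrightarrow> s permutes {..<n}"
  by (simp add: level_group_def)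

lemma level_group_level: "s \<in> level_group n h \<Longrightarrow> m < n \<Longrightarrow> h (s m) = h m"
  by (simp add: level_group_def)

lemma finite_level_group [simp]: "finite (level_group n h)"
  by (rule finite_subset[of _ "{s. s permutes {..<n}}"]) (auto simp: level_group_def)

lemma id_level_group: "id \<in> level_group n h"
  by (simp add: level_group_def)

lemma permutes_lessThan_less: "s permutes {..<n::nat} \<Longrightarrow> s m < n \<longleftrightarrow> m < n"
  using permutes_in_image[of s "{..<n}" m] by simp

lemma level_group_comp:
  "s \<in> level_group n h \<Longrightarrow> t \<in> level_group n h \<Longrightarrow> s \<circ> t \<in> level_group n h"
  by (auto simp: level_group_def permutes_compose permutes_lessThan_less)

lemma level_group_inv:
  assumes "s \<in> level_group n h"
  shows "inv s \<in> level_group n h"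
proof -
  have s: "s permutes {..<n}" using assms by (rule level_group_permutes)
  have "h (inv s m) = h m" if "m < n" for m
    using level_group_level[OF assms, of "inv s m"] that
    by (simp add: permutes_lessThan_less[OF permutes_inv[OF s]] permutes_inverses[OF s])
  thus ?thesis using s by (simp add: level_group_def permutes_inv)
qed

lemma sum_level_group_left:
  assumes "a \<in> level_group n h"
  shows "(\<Sum>s\<in>level_group n h. F s) = (\<Sum>s\<in>level_group n h. F (a \<circ> s))"
  by (rule sum.reindex_bij_witness[where i = "\<lambda>s. a \<circ> s" and j = "\<lambda>s. inv a \<circ> s"])
    (use assms in \<open>auto simp: permutes_comp_left_cancel[OF level_group_permutes[OF assms]]
        level_group_comp level_group_inv\<close>)

lemma sum_level_group_right:
  assumes "a \<in> level_group n h"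
  shows "(\<Sum>s\<in>level_group n h. F s) = (\<Sum>s\<in>level_group n h. F (s \<circ> a))"
  by (rule sum.reindex_bij_witness[where i = "\<lambda>s. s \<circ> a" and j = "\<lambda>s. s \<circ> inv a"])
    (use assms in \<open>auto simp: comp_assoc permutes_inv_o[OF level_group_permutes[OF assms]]
        level_group_comp level_group_inv\<close>)

lemma symmetrizer_closed: "symmetrizer n row col \<in> group_algebra n"
  unfolding group_algebra_def symmetrizer_def
  by (auto intro!: sum.neutral simp: level_group_permutes permutes_compose)

lemma symmetrizer_left:
  assumes "a \<in> level_group n row"
  shows "symmetrizer n row col (a \<circ> x) = symmetrizer n row col x"
proof -
  have [simp]: "a \<circ> x = a \<circ> y \<longleftrightarrow> x = y" for x y
    using permutes_comp_left_cancel(2)[OF level_group_permutes[OF assms]] by metis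
  show ?thesis
    unfolding symmetrizer_def
    by (subst sum_level_group_left[OF assms]) (simp add: comp_assoc)
qed

lemma sign_level_group_comp:
  assumes "s \<in> level_group n h" "t \<in> level_group n h'"
  shows "sign (s \<circ> t) = sign s * sign t"
  using assms by (auto intro!: sign_permutes_comp level_group_permutes)

lemma symmetrizer_right:
  assumes "a \<in> level_group n col"
  shows "symmetrizer n row col (x \<circ> a) = of_int (sign a) * symmetrizer n row col x"
proof -
  have [simp]: "x \<circ> a = y \<circ> a \<longleftrightarrow> x = y" for x y
    using permutes_inv_o(1)[OF level_group_permutes[OF assms]]
    by (metis comp_assoc comp_id)
  have "symmetrizer n row col (x \<circ> a) = (\<Sum>s\<in>level_group n row. \<Sum>t\<in>level_group n col.
     if x \<circ> a = s \<circ> (t \<circ> a) then of_int (sign (t \<circ> a)) else 0)"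
    unfolding symmetrizer_def
    by (rule sum.cong[OF refl], rule sum_level_group_right[OF assms])
  also have "\<dots> = of_int (sign a) * symmetrizer n row col x"
    unfolding symmetrizer_def sum_distrib_left
    by (intro sum.cong refl) (simp add: sign_level_group_comp[OF _ assms] flip: comp_assoc)
  finally show ?thesis .
qed

text \<open>
  The second assumption is von Neumann's lemma: if \<open>g\<close> separates the cells of every row by columns,
  then \<open>g = t \<circ> s\<close> with \<open>s\<close> preserving rows and \<open>t\<close> preserving columns.
\<close>

locale shape =
  fixes n :: nat and row col :: "nat \<Rightarrow> nat"
  assumes cell_inj: "a < n \<Longrightarrow> b < n \<Longrightarrow> row a = row b \<Longrightarrow> col a = col b \<Longrightarrow> a = b"
    and factor: "g permutes {..<n} \<Longrightarrow>
      (\<And>a b. a < n \<Longrightarrow> b < n \<Longrightarrow> a \<noteq> b \<Longrightarrow> row a = row b \<Longrightarrow> col (g a) \<noteq> col (g b)) \<Longrightarrow>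
      \<exists>s\<in>level_group n row. \<forall>m<n. col (g m) = col (s m)"
begin

abbreviation "Y \<equiv> symmetrizer n row col"

lemma row_col_trivial:
  assumes "s \<in> level_group n row" "s \<in> level_group n col"
  shows "s = id"
proof
  fix m
  have s: "s permutes {..<n}" using assms(1) by (rule level_group_permutes)
  show "s m = id m"
  proof (cases "m < n")
    case True
    thus ?thesis
      using cell_inj[of "s m" m] level_group_level[OF assms(1)] level_group_level[OF assms(2)]
      by (simp add: permutes_lessThan_less[OF s])
  next
    case False
    thus ?thesis using permutes_not_in[OF s] by simp
  qed
qed

text \<open>Only \<open>id\<close> preserves both rows and columns, so \<open>id\<close> factors in
  one way. This makes the scalar of any multiple of \<open>Y\<close> readable at
  \<open>id\<close>.\<close>

lemma Y_id: "Y id = 1"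
proof -
  have eq: "s = id \<and> t = id" if "s \<in> level_group n row" "t \<in> level_group n col" "id = s \<circ> t" for s t
  proof -
    have s: "s permutes {..<n}" using that(1) by (rule level_group_permutes)
    have "t = inv s"
      using permutes_comp_left_cancel(2)[OF s, of t] that(3) by (metis comp_id)
    hence "t \<in> level_group n row" using that(1) level_group_inv by simp
    hence "t = id" using row_col_trivial that(2) by blast
    thus ?thesis using that(3) by simp
  qed
  have "Y id = (\<Sum>s\<in>level_group n row. \<Sum>t\<in>level_group n col.
      if s = id then if t = id then 1 else 0 else 0)"
    unfolding symmetrizer_def
  proof (intro sum.cong refl)
    fix s t assume "s \<in> level_group n row" "t \<in> level_group n col"
    thus "(if id = s \<circ> t then of_int (sign t) else 0)
        = (if s = id then if t = id then 1 else 0 else (0::complex))"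
      using eq[of s t] by auto
  qed
  also have "\<dots> = (\<Sum>s\<in>level_group n row. if s = id then 1 else 0)"
    by (intro sum.cong refl) (simp add: id_level_group sum.delta)
  also have "\<dots> = 1"
    by (simp add: id_level_group sum.delta)
  finally show ?thesis .
qed

text \<open>Apply \<open>factor\<close> to \<open>inv x\<close>: the row permutation
  \<open>s\<close> imitates \<open>inv x\<close> on columns, so \<open>s \<circ> x\<close> preserves
  columns, and \<open>inv s\<close> is the required row factor.\<close>

lemma factor_perm:
  assumes x: "x permutes {..<n}"
    and sep: "\<And>a b. a < n \<Longrightarrow> b < n \<Longrightarrow> a \<noteq> b \<Longrightarrow> row a = row b \<Longrightarrow>
      col (inv x a) \<noteq> col (inv x b)"
  shows "\<exists>s\<in>level_group n row. \<exists>t\<in>level_group n col. x = s \<circ> t"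
proof -
  from factor[OF permutes_inv[OF x]] sep
  obtain s where s: "s \<in> level_group n row" and c: "\<forall>m<n. col (inv x m) = col (s m)"
    by blast
  have sp: "s permutes {..<n}" using s by (rule level_group_permutes)
  have "col ((s \<circ> x) m) = col m" if "m < n" for m
    using c[rule_format, of "x m"] that permutes_lessThan_less[OF x, of m]
    by (simp add: permutes_inverses[OF x])
  hence "s \<circ> x \<in> level_group n col"
    using sp x by (simp add: level_group_def permutes_compose)
  moreover have "x = inv s \<circ> (s \<circ> x)"
    by (simp add: permutes_comp_left_cancel[OF sp])
  ultimately show ?thesis using level_group_inv[OF s] by blast
qed

text \<open>At a product \<open>s \<circ> t\<close> the value is forced by the value at
  \<open>id\<close>. Any other \<open>x\<close> carries two cells of one column into one row; the
  transposition of these cells, applied on the left or on the right, gives the same permutation, yet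
  the first keeps the value and the second negates it.\<close>

lemma multiple_of_Y:
  assumes f: "f \<in> group_algebra n"
    and left: "\<And>s x. s \<in> level_group n row \<Longrightarrow> x permutes {..<n} \<Longrightarrow> f (s \<circ> x) = f x"
    and right: "\<And>t x. t \<in> level_group n col \<Longrightarrow> x permutes {..<n} \<Longrightarrow>
      f (x \<circ> t) = of_int (sign t) * f x"
  shows "f = galg_scale (f id) Y"
proof (rule group_algebra_eqI[OF f])
  show "galg_scale (f id) Y \<in> group_algebra n"
    using symmetrizer_closed[of n row col] by (simp add: group_algebra_def galg_scale_def)
next
  have main: "f x = f id * Y x" if x: "x permutes {..<n}"
    and left: "\<And>s x. s \<in> level_group n row \<Longrightarrow> x permutes {..<n} \<Longrightarrow> f (s \<circ> x) = f x"
    and right: "\<And>t x. t \<in> level_group n col \<Longrightarrow> x permutes {..<n} \<Longrightarrow>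
      f (x \<circ> t) = of_int (sign t) * f x"
    and prod: "\<exists>s\<in>level_group n row. \<exists>t\<in>level_group n col. x = s \<circ> t" for x and f :: galg
  proof -
    from prod obtain s t where st: "s \<in> level_group n row" "t \<in> level_group n col" "x = s \<circ> t"
      by blast
    have "f x = of_int (sign t) * f id"
      using left[OF st(1), of t] right[OF st(2), of id] st level_group_permutes by auto
    moreover have "Y x = of_int (sign t)"
      using symmetrizer_left[OF st(1), of col t] symmetrizer_right[OF st(2), of row id] st Y_id
      by simp
    ultimately show ?thesis by simp
  qed
  \<comment> \<open>Kept general in \<open>f\<close>, because it is applied to \<open>Y\<close> as
    well.\<close>
  have zero: "f x = 0" if x: "x permutes {..<n}"
    and left: "\<And>s x. s \<in> level_group n row \<Longrightarrow> x permutes {..<n} \<Longrightarrow> f (s \<circ> x) = f x"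
    and right: "\<And>t x. t \<in> level_group n col \<Longrightarrow> x permutes {..<n} \<Longrightarrow>
      f (x \<circ> t) = of_int (sign t) * f x"
    and ab: "a < n" "b < n" "a \<noteq> b" "row a = row b" "col (inv x a) = col (inv x b)"
    for x a b and f :: galg
  proof -
    let ?s = "transpose a b" and ?t = "transpose (inv x a) (inv x b)"
    have ix: "inv x permutes {..<n}" using x by (rule permutes_inv)
    have s: "?s \<in> level_group n row"
      using ab by (auto simp: level_group_def permutes_swap_id transpose_def)
    have t: "?t \<in> level_group n col"
      using ab permutes_lessThan_less[OF ix]
      by (auto simp: level_group_def permutes_swap_id transpose_def)
    have "?s \<circ> x = x \<circ> ?t"
      using permutes_inverses[OF x] by (auto simp: fun_eq_iff transpose_def)
    hence "f x = of_int (sign ?t) * f x"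
      using left[OF s x] right[OF t x] by simp
    moreover have "sign ?t = -1"
      using ab(3) permutes_inverses(1)[OF x] by (simp add: sign_swap_id) metis
    ultimately show "f x = 0" by simp
  qed
  fix x assume x: "x permutes {..<n}"
  show "f x = galg_scale (f id) Y x"
  proof (cases "\<exists>s\<in>level_group n row. \<exists>t\<in>level_group n col. x = s \<circ> t")
    case True
    have "f x = f id * Y x" by (rule main[OF x left right True])
    thus ?thesis by (simp add: galg_scale_def)
  next
    case False
    with factor_perm[OF x] obtain a b where
      ab: "a < n" "b < n" "a \<noteq> b" "row a = row b" "col (inv x a) = col (inv x b)" by blast
    have "f x = 0" by (rule zero[OF x left right ab])
    moreover have "Y x = 0"
      by (rule zero[OF x _ _ ab]) (erule symmetrizer_left symmetrizer_right)+
    ultimately show ?thesis by (simp add: galg_scale_def)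
  qed
qed

lemma galg_mult_Y_right:
  assumes "t \<in> level_group n col" "x permutes {..<n}"
  shows "galg_mult n f Y (x \<circ> t) = of_int (sign t) * galg_mult n f Y x"
  using assms level_group_permutes[OF assms(1)]
  by (simp add: galg_mult_apply permutes_compose sum_distrib_left symmetrizer_right
      mult.left_commute flip: comp_assoc)

lemma galg_mult_Y_left:
  assumes "s \<in> level_group n row" "x permutes {..<n}"
  shows "galg_mult n Y f (s \<circ> x) = galg_mult n Y f x"
proof -
  have s: "s permutes {..<n}" using assms(1) by (rule level_group_permutes)
  have "galg_mult n Y f (s \<circ> x) = (\<Sum>r | r permutes {..<n}. Y r * f (inv r \<circ> (s \<circ> x)))"
    using s assms(2) by (simp add: galg_mult_apply permutes_compose)
  also have "\<dots> = (\<Sum>r | r permutes {..<n}. Y (s \<circ> r) * f (inv (s \<circ> r) \<circ> (s \<circ> x)))"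
    by (rule setum_permutations_compose_left[OF s])
  also have "\<dots> = (\<Sum>r | r permutes {..<n}. Y r * f (inv r \<circ> x))"
    by (intro sum.cong refl) (simp add: symmetrizer_left[OF assms(1)] permutes_inv_comp[OF s]
        comp_assoc permutes_comp_left_cancel[OF s])
  also have "\<dots> = galg_mult n Y f x"
    using assms(2) by (simp add: galg_mult_apply)
  finally show ?thesis .
qed

lemma Y_square: "galg_mult n Y Y = galg_scale (galg_mult n Y Y id) Y"
  by (rule multiple_of_Y[OF galg_mult_closed galg_mult_Y_left galg_mult_Y_right])

text \<open>Conjugating the summation variable by \<open>s\<close> moves \<open>s\<close> past
  \<open>z\<close>, so the product inherits the row invariance of \<open>Y\<close>. This is the
  concrete form of Schur's lemma: a class function acts on \<open>Y\<close> by a scalar.\<close>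

lemma central_Y:
  assumes central: "\<And>a x. a permutes {..<n} \<Longrightarrow> x permutes {..<n} \<Longrightarrow> z (a \<circ> x \<circ> inv a) = z x"
  shows "galg_mult n z Y = galg_scale (galg_mult n z Y id) Y"
proof (rule multiple_of_Y[OF galg_mult_closed _ galg_mult_Y_right])
  fix s x assume s: "s \<in> level_group n row" and x: "x permutes {..<n}"
  have sp: "s permutes {..<n}" using s by (rule level_group_permutes)
  let ?G = "{r. r permutes {..<n}}"
  have "galg_mult n z Y (s \<circ> x) = (\<Sum>r\<in>?G. z r * Y (inv r \<circ> (s \<circ> x)))"
    using sp x by (simp add: galg_mult_apply permutes_compose)
  also have "\<dots> = (\<Sum>r\<in>?G. z (r \<circ> inv s) * Y (inv (r \<circ> inv s) \<circ> (s \<circ> x)))"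
    by (rule sum_permutations_compose_right[OF permutes_inv[OF sp]])
  also have "\<dots> = (\<Sum>r\<in>?G. z (s \<circ> r \<circ> inv s) * Y (inv (s \<circ> r \<circ> inv s) \<circ> (s \<circ> x)))"
    by (rule setum_permutations_compose_left[OF sp])
  also have "\<dots> = (\<Sum>r\<in>?G. z r * Y (inv r \<circ> x))"
  proof (rule sum.cong[OF refl])
    fix r assume "r \<in> ?G"
    hence r: "r permutes {..<n}" by simp
    have "inv (s \<circ> r \<circ> inv s) \<circ> (s \<circ> x) = s \<circ> (inv r \<circ> x)"
      using permutes_inv_comp[OF permutes_compose[OF r sp] permutes_inv[OF sp]]
        permutes_inv_comp[OF sp r]
      by (simp add: permutes_inv_inv[OF sp] comp_assoc permutes_comp_left_cancel[OF sp])
    thus "z (s \<circ> r \<circ> inv s) * Y (inv (s \<circ> r \<circ> inv s) \<circ> (s \<circ> x)) = z r * Y (inv r \<circ> x)"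
      using central[OF sp r] symmetrizer_left[OF s] by simp
  qed
  also have "\<dots> = galg_mult n z Y x"
    using x by (simp add: galg_mult_apply)
  finally show "galg_mult n z Y (s \<circ> x) = galg_mult n z Y x" .
qed

text \<open>The trace formula holds for \<open>w\<close> and for \<open>id\<close> with the same
  unknown factor \<open>\<alpha>\<close>, which cancels in the quotient. The case of
  \<open>id\<close> also shows that \<open>\<alpha>\<close> and the dimension are nonzero, as their
  product is \<open>fact n\<close>.\<close>

theorem character_ratio:
  defines "V \<equiv> (\<lambda>f. galg_mult n f Y) ` group_algebra n"
  assumes w: "w permutes {..<n}"
  shows "galg_trace V (galg_mult n (galg_of w)) / of_nat (galg.dim V)
    = (\<Sum>x | x permutes {..<n}. Y (inv x \<circ> inv w \<circ> x)) / fact n"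
proof -
  define \<alpha> where "\<alpha> = galg_mult n Y Y id"
  have scalar: "galg_mult n v Y = galg_scale \<alpha> v" if "v \<in> V" for v
  proof -
    from that obtain f where "v = galg_mult n f Y" by (auto simp: V_def)
    hence "galg_mult n v Y = galg_mult n f (galg_scale \<alpha> Y)"
      using Y_square by (simp add: galg_mult_assoc \<alpha>_def)
    also have "\<dots> = galg_scale \<alpha> v"
      by (simp add: galg_mult_scale_right \<open>v = galg_mult n f Y\<close>)
    finally show ?thesis .
  qed
  have VA: "V \<subseteq> group_algebra n" by (auto simp: V_def galg_mult_closed)
  have "\<alpha> * of_nat (galg.dim V) = (\<Sum>x | x permutes {..<n}. Y (inv x \<circ> inv id \<circ> x))"
    using trace_left_ideal[of n Y \<alpha> id, folded V_def] scalar trace_id_left_ideal[OF VA] by simp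
  also have "\<dots> = (\<Sum>x | x permutes {..<n}. 1)"
    by (intro sum.cong refl) (simp add: permutes_inv_o Y_id)
  also have "\<dots> = fact n"
    using card_permutations[of "{..<n}" n] by simp
  finally have dim: "\<alpha> * of_nat (galg.dim V) = fact n" .
  hence "\<alpha> \<noteq> 0" "(of_nat (galg.dim V) :: complex) \<noteq> 0"
    by (metis fact_nonzero mult_zero_left, metis fact_nonzero mult_zero_right)
  moreover have "\<alpha> * galg_trace V (galg_mult n (galg_of w))
      = (\<Sum>x | x permutes {..<n}. Y (inv x \<circ> inv w \<circ> x))"
    using trace_left_ideal[of n Y \<alpha> w, folded V_def] scalar w by simp
  ultimately show ?thesis
    by (simp add: dim[symmetric] field_simps)
qed

end

section \<open>Maps invariant under a permutation\<close>

text \<open>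
  The number of \<open>\<sigma>\<close>-invariant maps \<open>X \<rightarrow> {..<m}\<close> is \<open>m\<close> to the number of cycles of \<open>\<sigma>\<close> on \<open>X\<close>.
\<close>

definition inv_maps :: "nat \<Rightarrow> 'a set \<Rightarrow> ('a \<Rightarrow> 'a) \<Rightarrow> ('a \<Rightarrow> nat) set" where
  "inv_maps m X \<sigma> = {f \<in> X \<rightarrow>\<^sub>E {..<m}. \<forall>x\<in>X. f (\<sigma> x) = f x}"

definition inv_count :: "nat \<Rightarrow> 'a set \<Rightarrow> ('a \<Rightarrow> 'a) \<Rightarrow> nat" where
  "inv_count m X \<sigma> = card (inv_maps m X \<sigma>)"

lemma inv_count_empty: "inv_count m {} \<sigma> = 1"
  by (simp add: inv_count_def inv_maps_def)

lemma inv_count_one: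
  assumes "\<sigma> permutes X"
  shows "inv_count 1 X \<sigma> = 1"
proof -
  have "inv_maps 1 X \<sigma> = {\<lambda>x\<in>X. 0}"
  proof (intro equalityI subsetI)
    fix f assume "f \<in> inv_maps 1 X \<sigma>"
    hence f: "f \<in> X \<rightarrow>\<^sub>E {..<1}" by (simp add: inv_maps_def)
    have "f x = restrict (\<lambda>_. 0) X x" for x
      using PiE_mem[OF f, of x] PiE_arb[OF f, of x] by (cases "x \<in> X") auto
    thus "f \<in> {\<lambda>x\<in>X. 0}" by auto
  qed (use permutes_in_image[OF assms] in \<open>auto simp: inv_maps_def\<close>)
  thus ?thesis by (simp add: inv_count_def)
qed

text \<open>The new point is a cycle of its own, and its value is free.\<close>

lemma inv_count_insert_fixed:
  assumes "b \<notin> X" "\<sigma> permutes X"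
  shows "inv_count m (insert b X) \<sigma> = m * inv_count m X \<sigma>"
proof -
  have \<sigma>: "\<sigma> b = b" "\<And>x. x \<in> X \<Longrightarrow> \<sigma> x \<in> X" "\<And>x. x \<in> X \<Longrightarrow> \<sigma> x \<noteq> b"
    using assms by (auto simp: permutes_not_in permutes_in_image)
  have "bij_betw (\<lambda>(c, f). f(b := c)) ({..<m} \<times> inv_maps m X \<sigma>) (inv_maps m (insert b X) \<sigma>)"
    by (rule bij_betw_byWitness[where f' = "\<lambda>g. (g b, restrict g X)"])
      (use assms \<sigma> in \<open>auto simp: inv_maps_def PiE_def Pi_def extensional_def fun_eq_iff\<close>)
  from bij_betw_same_card[OF this] show ?thesis
    by (simp add: inv_count_def card_cartesian_product)
qed

text \<open>The transposition threads \<open>b\<close> into the cycle of \<open>a\<close>, so the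
  number of cycles is unchanged and the value at \<open>b\<close> is dictated by that at
  \<open>a\<close>.\<close>

lemma inv_count_insert:
  assumes "b \<notin> X" "\<sigma> permutes X" "a \<in> X"
  shows "inv_count m (insert b X) (transpose b a \<circ> \<sigma>) = inv_count m X \<sigma>"
proof -
  have \<sigma>: "\<sigma> b = b" "\<And>x. x \<in> X \<Longrightarrow> \<sigma> x \<in> X" "\<And>x. x \<in> X \<Longrightarrow> \<sigma> x \<noteq> b"
    using assms by (auto simp: permutes_not_in permutes_in_image)
  have ab: "a \<noteq> b" using assms by auto
  have tr: "g (transpose b a y) = g y" if "g a = g b" for g :: "'a \<Rightarrow> nat" and y
    using that by (auto simp: transpose_def)
  have inv: "g a = g b" if "g \<in> inv_maps m (insert b X) (transpose b a \<circ> \<sigma>)" for g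
    using that \<sigma>(1) by (auto simp: inv_maps_def)
  have "bij_betw (\<lambda>f. f(b := f a)) (inv_maps m X \<sigma>)
      (inv_maps m (insert b X) (transpose b a \<circ> \<sigma>))"
  proof (rule bij_betw_byWitness[where f' = "\<lambda>g. restrict g X"])
    show "\<forall>f\<in>inv_maps m X \<sigma>. restrict (f(b := f a)) X = f"
      using assms by (auto simp: inv_maps_def PiE_def extensional_def fun_eq_iff)
    show "\<forall>g\<in>inv_maps m (insert b X) (transpose b a \<circ> \<sigma>).
        (restrict g X)(b := restrict g X a) = g"
    proof
      fix g assume g: "g \<in> inv_maps m (insert b X) (transpose b a \<circ> \<sigma>)"
      show "(restrict g X)(b := restrict g X a) = g"
        using inv[OF g] g assms(3)
        by (auto simp: inv_maps_def PiE_def extensional_def fun_eq_iff)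
    qed
    show "(\<lambda>f. f(b := f a)) ` inv_maps m X \<sigma> \<subseteq> inv_maps m (insert b X) (transpose b a \<circ> \<sigma>)"
    proof (rule image_subsetI)
      fix f assume f: "f \<in> inv_maps m X \<sigma>"
      have "(f(b := f a)) a = (f(b := f a)) b" using ab by simp
      from tr[OF this] have "(f(b := f a)) ((transpose b a \<circ> \<sigma>) x) = (f(b := f a)) x"
        if "x \<in> insert b X" for x
        using that f \<sigma> by (auto simp: inv_maps_def)
      thus "f(b := f a) \<in> inv_maps m (insert b X) (transpose b a \<circ> \<sigma>)"
        using f assms(3) by (auto simp: inv_maps_def PiE_def extensional_def Pi_def)
    qed
    show "(\<lambda>g. restrict g X) ` inv_maps m (insert b X) (transpose b a \<circ> \<sigma>) \<subseteq> inv_maps m X \<sigma>"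
    proof (rule image_subsetI)
      fix g assume g: "g \<in> inv_maps m (insert b X) (transpose b a \<circ> \<sigma>)"
      have "g (\<sigma> x) = g x" if "x \<in> X" for x
        using tr[OF inv[OF g], of "\<sigma> x"] g that by (auto simp: inv_maps_def)
      thus "restrict g X \<in> inv_maps m X \<sigma>"
        using g \<sigma>(2) by (auto simp: inv_maps_def PiE_def Pi_def)
    qed
  qed
  from bij_betw_same_card[OF this] show ?thesis by (simp add: inv_count_def)
qed

lemma inv_count_inv:
  assumes "\<sigma> permutes X"
  shows "inv_count m X (inv \<sigma>) = inv_count m X \<sigma>"
proof -
  have "(\<forall>x\<in>X. f (inv \<sigma> x) = f x) \<longleftrightarrow> (\<forall>x\<in>X. f (\<sigma> x) = f x)" for f :: "'a \<Rightarrow> nat"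
  proof (intro iffI ballI)
    fix x assume "x \<in> X" and *: "\<forall>x\<in>X. f (inv \<sigma> x) = f x"
    hence "f (inv \<sigma> (\<sigma> x)) = f (\<sigma> x)" using permutes_in_image[OF assms] by blast
    thus "f (\<sigma> x) = f x" by (simp add: permutes_inverses[OF assms])
  next
    fix x assume "x \<in> X" and *: "\<forall>x\<in>X. f (\<sigma> x) = f x"
    hence "f (\<sigma> (inv \<sigma> x)) = f (inv \<sigma> x)"
      using permutes_in_image[OF permutes_inv[OF assms]] by blast
    thus "f (inv \<sigma> x) = f x" by (simp add: permutes_inverses[OF assms])
  qed
  thus ?thesis by (simp add: inv_count_def inv_maps_def)
qed

lemma inv_count_conj:
  assumes "\<sigma> permutes X" "a permutes X"
  shows "inv_count m X (a \<circ> \<sigma> \<circ> inv a) = inv_count m X \<sigma>"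
proof -
  note in_a = permutes_in_image[OF assms(2)] and in_ia = permutes_in_image[OF permutes_inv[OF assms(2)]]
    and inva = permutes_inverses[OF assms(2)] and in_s = permutes_in_image[OF assms(1)]
  have "bij_betw (\<lambda>f. restrict (f \<circ> a) X) (inv_maps m X (a \<circ> \<sigma> \<circ> inv a)) (inv_maps m X \<sigma>)"
  proof (rule bij_betw_byWitness[where f' = "\<lambda>f. restrict (f \<circ> inv a) X"])
    show "(\<lambda>f. restrict (f \<circ> a) X) ` inv_maps m X (a \<circ> \<sigma> \<circ> inv a) \<subseteq> inv_maps m X \<sigma>"
    proof (rule image_subsetI)
      fix f assume f: "f \<in> inv_maps m X (a \<circ> \<sigma> \<circ> inv a)"
      have "f (a (\<sigma> x)) = f (a x)" if "x \<in> X" for x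
        using f that in_a[of x] inva(2)[of x] by (force simp: inv_maps_def)
      thus "restrict (f \<circ> a) X \<in> inv_maps m X \<sigma>"
        using f in_a in_s by (auto simp: inv_maps_def PiE_def Pi_def)
    qed
    show "(\<lambda>f. restrict (f \<circ> inv a) X) ` inv_maps m X \<sigma> \<subseteq> inv_maps m X (a \<circ> \<sigma> \<circ> inv a)"
      using in_a in_ia in_s inva by (auto simp: inv_maps_def PiE_def Pi_def)
    show "\<forall>f\<in>inv_maps m X (a \<circ> \<sigma> \<circ> inv a). restrict (restrict (f \<circ> a) X \<circ> inv a) X = f"
      using in_ia inva by (auto simp: inv_maps_def PiE_def extensional_def fun_eq_iff)
    show "\<forall>f\<in>inv_maps m X \<sigma>. restrict (restrict (f \<circ> inv a) X \<circ> a) X = f"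
      using in_a inva by (auto simp: inv_maps_def PiE_def extensional_def fun_eq_iff)
  qed
  from bij_betw_same_card[OF this] show ?thesis by (simp add: inv_count_def)
qed

text \<open>
  The trivial character for \<open>\<eta> = 1\<close> and the sign for \<open>\<eta> = -1\<close>.
\<close>

definition twist :: "complex \<Rightarrow> ('a \<Rightarrow> 'a) \<Rightarrow> complex" where
  "twist \<eta> s = (if evenperm s then 1 else \<eta>)"

lemma twist_one [simp]: "twist 1 s = 1"
  and twist_sign: "twist (-1) s = of_int (sign s)"
  and twist_id [simp]: "twist \<eta> id = 1" "twist \<eta> (\<lambda>a. a) = 1"
  and twist_square: "\<eta>\<^sup>2 = 1 \<Longrightarrow> twist \<eta> s * twist \<eta> s = 1"
  by (simp_all add: twist_def sign_def power2_eq_square)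

lemma twist_comp:
  assumes "\<eta>\<^sup>2 = 1" "s permutes X" "t permutes X" "finite X"
  shows "twist \<eta> (s \<circ> t) = twist \<eta> s * twist \<eta> t"
  using assms evenperm_comp[of s t] permutes_imp_permutation[of X]
  by (auto simp: twist_def power2_eq_square)

lemma twist_inv:
  assumes "s permutes X" "finite X"
  shows "twist \<eta> (inv s) = twist \<eta> s"
  using assms evenperm_inv[of s] permutes_imp_permutation[of X] by (auto simp: twist_def)

text \<open>The mechanism of Jucys-Murphy elements: a permutation of \<open>insert b A\<close> is
  uniquely \<open>transpose b a \<circ> s\<close> with \<open>s\<close> permuting \<open>A\<close>.
  For \<open>a = b\<close> there is a new cycle, which gives \<open>m\<close>; each of the
  \<open>card A\<close> other choices keeps the number of cycles and contributes the twist
  \<open>\<eta>\<close> of a transposition.\<close>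

lemma twisted_sum_insert:
  assumes "finite X" "A \<subseteq> X" "b \<notin> X" "t permutes X" "\<eta>\<^sup>2 = 1"
  shows "(\<Sum>s | s permutes insert b A. twist \<eta> s * of_nat (inv_count m (insert b X) (s \<circ> t)))
    = (of_nat m + \<eta> * of_nat (card A))
      * (\<Sum>s | s permutes A. twist \<eta> s * of_nat (inv_count m X (s \<circ> t)))" (is "?L = _ * ?R")
proof -
  have fA: "finite A" using assms by (auto intro: finite_subset)
  have bA: "b \<notin> A" using assms by auto
  have sX: "s permutes X" if "s permutes A" for s
    using that assms(2) by (rule permutes_subset)
  let ?f = "\<lambda>s. twist \<eta> s * of_nat (inv_count m (insert b X) (s \<circ> t)) :: complex"
  have "?L = (\<Sum>a\<in>insert b A. \<Sum>s | s permutes A. ?f (transpose b a \<circ> s))"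
    by (rule sum_over_permutations_insert[OF fA bA])
  also have "\<dots> = (\<Sum>s | s permutes A. ?f s) + (\<Sum>a\<in>A. \<Sum>s | s permutes A. ?f (transpose b a \<circ> s))"
    using fA bA by simp
  also have "(\<Sum>s | s permutes A. ?f s) = of_nat m * ?R"
    unfolding sum_distrib_left
  proof (intro sum.cong refl)
    fix s assume "s \<in> {s. s permutes A}"
    hence "s \<circ> t permutes X" using sX assms(4) by (auto intro: permutes_compose)
    thus "?f s = of_nat m * (twist \<eta> s * of_nat (inv_count m X (s \<circ> t)))"
      using inv_count_insert_fixed[OF assms(3)] by simp
  qed
  also have "(\<Sum>a\<in>A. \<Sum>s | s permutes A. ?f (transpose b a \<circ> s)) = (\<Sum>a\<in>A. \<eta> * ?R)"
    unfolding sum_distrib_left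
  proof (intro sum.cong refl)
    fix a s assume a: "a \<in> A" and "s \<in> {s. s permutes A}"
    hence s: "s permutes X" using sX by auto
    hence st: "s \<circ> t permutes X" using assms(4) by (auto intro: permutes_compose)
    have aX: "a \<in> X" using a assms(2) by auto
    have tw: "twist \<eta> (transpose b a \<circ> s) = twist \<eta> (transpose b a) * twist \<eta> s"
      using aX assms by (intro twist_comp[of _ _ "insert b X"])
        (auto intro: permutes_swap_id permutes_imp_permutes_insert[OF s])
    have tr: "twist \<eta> (transpose b a) = \<eta>"
      using aX assms(3) by (auto simp: twist_def evenperm_swap)
    show "?f (transpose b a \<circ> s) = \<eta> * (twist \<eta> s * of_nat (inv_count m X (s \<circ> t)))"
      unfolding tw tr comp_assoc inv_count_insert[OF assms(3) st aX] by (rule mult.assoc)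
  qed
  finally show ?thesis by (simp add: algebra_simps o_def)
qed

lemma twisted_sum:
  assumes "finite B" "\<theta>\<^sup>2 = 1"
  shows "(\<Sum>t | t permutes B. twist \<theta> t * of_nat (inv_count m B t))
    = (\<Prod>i<card B. of_nat m + \<theta> * of_nat i)"
  using assms(1)
proof (induction B rule: finite_induct)
  case empty
  thus ?case by (simp add: inv_count_empty)
next
  case (insert b B)
  thus ?case
    using twisted_sum_insert[OF insert.hyps(1) order.refl insert.hyps(2) permutes_id assms(2), of m]
    by simp
qed

text \<open>For fixed \<open>t\<close>, the points of \<open>A\<close> are inserted into
  \<open>s\<close> one at a time. The corner \<open>z\<close> is already there, so the i-th
  insertion meets i earlier points and the first product starts at 1. The sum over \<open>t\<close>
  is then \<open>twisted_sum\<close>.\<close>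

lemma twisted_sum_hook:
  assumes "finite A" "finite B" "A \<inter> B = {}" "z \<in> B" "\<eta>\<^sup>2 = 1" "\<theta>\<^sup>2 = 1"
  shows "(\<Sum>s | s permutes insert z A. \<Sum>t | t permutes B.
      twist \<eta> s * twist \<theta> t * of_nat (inv_count m (A \<union> B) (s \<circ> t)))
    = (\<Prod>i=1..card A. of_nat m + \<eta> * of_nat i) * (\<Prod>i<card B. of_nat m + \<theta> * of_nat i)"
proof -
  have *: "(\<Sum>s | s permutes insert z A. twist \<eta> s * of_nat (inv_count m (A \<union> B) (s \<circ> t)))
    = (\<Prod>i=1..card A. of_nat m + \<eta> * of_nat i) * of_nat (inv_count m B t)"
    if t: "t permutes B" for t
    using assms(1,3)
  proof (induction A rule: finite_induct)
    case empty
    thus ?case by simp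
  next
    case (insert b A)
    have "(\<Sum>s | s permutes insert b (insert z A).
        twist \<eta> s * of_nat (inv_count m (insert b (A \<union> B)) (s \<circ> t)))
      = (of_nat m + \<eta> * of_nat (card (insert z A)))
        * (\<Sum>s | s permutes insert z A. twist \<eta> s * of_nat (inv_count m (A \<union> B) (s \<circ> t)))"
      by (rule twisted_sum_insert)
        (use insert assms t in \<open>auto intro: permutes_subset\<close>)
    also have "card (insert z A) = Suc (card A)"
      using insert assms by (subst card_insert_disjoint) auto
    finally show ?case
      using insert by (simp add: insert_commute mult_ac)
  qed
  have "(\<Sum>s | s permutes insert z A. \<Sum>t | t permutes B.
      twist \<eta> s * twist \<theta> t * of_nat (inv_count m (A \<union> B) (s \<circ> t)))
    = (\<Sum>t | t permutes B. twist \<theta> t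
        * (\<Sum>s | s permutes insert z A. twist \<eta> s * of_nat (inv_count m (A \<union> B) (s \<circ> t))))"
    by (subst sum.swap) (simp add: sum_distrib_left mult_ac)
  also have "\<dots> = (\<Prod>i=1..card A. of_nat m + \<eta> * of_nat i)
      * (\<Sum>t | t permutes B. twist \<theta> t * of_nat (inv_count m B t))"
    by (simp add: * sum_distrib_left mult_ac)
  finally show ?thesis by (simp add: twisted_sum[OF assms(2,6)])
qed

section \<open>Cycles\<close>

definition cyc :: "nat \<Rightarrow> nat \<Rightarrow> nat" where
  "cyc k i = (if i < k then Suc i mod k else i)"

lemma cyc_permutes: "cyc k permutes {..<k}"
proof (rule inj_imp_permutes)
  show "inj_on (cyc k) {..<k}"
    by (auto simp: inj_on_def cyc_def mod_Suc split: if_splits)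
qed (auto simp: cyc_def)

lemma extend_injection:
  fixes h :: "nat \<Rightarrow> nat"
  assumes inj: "inj_on h {..<k}" and img: "h ` {..<k} \<subseteq> {..<n}"
  obtains y where "y permutes {..<n}" "\<And>i. i < k \<Longrightarrow> y i = h i"
proof -
  have kn: "k \<le> n"
    using card_mono[OF _ img] card_image[OF inj] by simp
  have "card {k..<n} = card ({..<n} - h ` {..<k})"
    using img inj by (simp add: card_Diff_subset card_image)
  then obtain g where g: "bij_betw g {k..<n} ({..<n} - h ` {..<k})"
    using finite_same_card_bij[of "{k..<n}"] by auto
  define y where "y i = (if i < k then h i else if i < n then g i else i)" for i
  have "bij_betw y {..<k} (h ` {..<k})"
    using inj by (auto simp: bij_betw_def y_def inj_on_def)
  moreover have "bij_betw y {k..<n} ({..<n} - h ` {..<k})"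
    using g by (rule bij_betw_cong[THEN iffD1, rotated]) (simp add: y_def)
  ultimately have "bij_betw y ({..<k} \<union> {k..<n}) (h ` {..<k} \<union> ({..<n} - h ` {..<k}))"
    by (rule bij_betw_combine) auto
  moreover have "{..<k} \<union> {k..<n} = {..<n}" using kn by auto
  moreover have "h ` {..<k} \<union> ({..<n} - h ` {..<k}) = {..<n}" using img by auto
  ultimately have "bij_betw y {..<n} {..<n}" by simp
  hence "y permutes {..<n}"
    by (rule bij_imp_permutes) (use kn in \<open>auto simp: y_def\<close>)
  thus ?thesis by (rule that) (simp add: y_def)
qed

text \<open>Iterating \<open>w\<close> from \<open>x\<close> enumerates the orbit; any extension of
  this enumeration to a permutation carries \<open>cyc k\<close> to \<open>w\<close>, both being
  trivial elsewhere.\<close>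

lemma single_cycle_conjugate:
  assumes w: "w permutes {..<n::nat}" and x: "x < n" and card: "card (orbit w x) = k"
    and fixed: "\<And>y. y < n \<Longrightarrow> y \<notin> orbit w x \<Longrightarrow> w y = y"
  obtains y where "y permutes {..<n}" "w = y \<circ> cyc k \<circ> inv y"
proof -
  have "permutation w" using w by (auto intro: permutes_imp_permutation)
  hence self: "x \<in> orbit w x" by (rule permutation_self_in_orbit)
  define h where "h i = (w ^^ i) x" for i
  have inj0: "inj_on h {0..<funpow_dist1 w x x}"
    unfolding h_def by (rule inj_on_funpow_dist1[OF self])
  have orb0: "orbit w x = h ` {0..<funpow_dist1 w x x}"
    unfolding h_def by (rule orbit_conv_funpow_dist1[OF self])
  have k: "funpow_dist1 w x x = k"
    using card card_image[OF inj0] unfolding orb0[symmetric] by simp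
  have kpos: "k > 0" unfolding k[symmetric] by simp
  have hk: "h k = x"
    unfolding h_def k[symmetric] by (rule funpow_dist1_prop[OF self])
  have inj: "inj_on h {..<k}" and orb: "orbit w x = h ` {..<k}"
    using inj0 orb0 unfolding k by (simp_all add: atLeast0LessThan)
  have "h ` {..<k} \<subseteq> {..<n}"
    using permutes_orbit_subset[OF w, of x] x unfolding orb by simp
  from extend_injection[OF inj this] obtain y
    where y: "y permutes {..<n}" and yh: "\<And>i. i < k \<Longrightarrow> y i = h i" by blast
  have "w (y i) = y (cyc k i)" for i
  proof (cases "i < k")
    case True
    have "w (y i) = h (Suc i)" using True by (simp add: yh h_def)
    also have "\<dots> = y (cyc k i)"
    proof (cases "Suc i = k")
      case True
      thus ?thesis using hk kpos by (simp add: cyc_def yh) (simp add: h_def)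
    next
      case False
      thus ?thesis using \<open>i < k\<close> by (simp add: cyc_def yh)
    qed
    finally show ?thesis .
  next
    case False
    have "y i \<notin> orbit w x"
    proof
      assume "y i \<in> orbit w x"
      then obtain i' where "i' < k" "y i = y i'" unfolding orb using yh by auto
      thus False using False permutes_inj[OF y] by (auto dest: injD)
    qed
    hence "w (y i) = y i"
      using fixed[of "y i"] permutes_not_in[OF w, of "y i"] by (cases "y i < n") auto
    thus ?thesis using False by (simp add: cyc_def)
  qed
  hence "w \<circ> y = y \<circ> cyc k" by auto
  hence "w = y \<circ> cyc k \<circ> inv y"
    using permutes_inv_o(1)[OF y] by (metis comp_assoc comp_id)
  with y show ?thesis by (rule that)
qed

lemma sign_cycle_of_list:
  assumes "distinct cs"
  shows "sign (cycle_of_list cs) = (-1) ^ (length cs - 1)"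
  using assms
proof (induction cs rule: cycle_of_list.induct)
  case (1 i j cs)
  have "sign (cycle_of_list (i # j # cs)) = sign (transpose i j) * sign (cycle_of_list (j # cs))"
    using sign_compose[OF permutation_swap_id[of i j] permutation_of_cycle[of "j # cs"]]
    by (simp add: o_def)
  also have "\<dots> = (-1) ^ (length (i # j # cs) - 1)"
    using 1 by (simp add: sign_swap_id)
  finally show ?case .
qed simp_all

lemma perm_restrict_orbit:
  assumes "permutation p"
  shows "perm_restrict p (orbit p a) permutes orbit p a"
    and "sign (perm_restrict p (orbit p a)) = (-1) ^ (card (orbit p a) - 1)"
proof -
  have set: "set (support p a) = orbit p a"
    using support_set[OF assms, of a] orbit_altdef_permutation[OF assms, of a] by auto
  have cyc: "perm_restrict p (orbit p a) = cycle_of_list (support p a)"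
  proof
    fix x
    show "perm_restrict p (orbit p a) x = cycle_of_list (support p a) x"
      using cycle_restrict[OF assms, of x a] id_outside_supp[of x "support p a"]
      unfolding set perm_restrict_def by auto
  qed
  have dist: "distinct (support p a)"
    using cycle_of_permutation[OF assms] .
  show "perm_restrict p (orbit p a) permutes orbit p a"
    unfolding cyc using cycle_permutes[of "support p a"] unfolding set .
  show "sign (perm_restrict p (orbit p a)) = (-1) ^ (card (orbit p a) - 1)"
    unfolding cyc sign_cycle_of_list[OF dist] using distinct_card[OF dist] unfolding set by simp
qed

section \<open>Hooks\<close>

text \<open>
  The hook with corner \<open>0\<close>, leg \<open>S\<close> and arm \<open>{1..<k} - S\<close>.
\<close>

definition hook_row :: "nat set \<Rightarrow> nat \<Rightarrow> nat" where
  "hook_row S m = (if m \<in> S then m else 0)"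

text \<open>For a leg without \<open>0\<close>, the corner gets label 0 in both coordinates, and
  cells not sharing the line are separated by using their own numbers as labels.\<close>

definition hook_col :: "nat set \<Rightarrow> nat \<Rightarrow> nat" where
  "hook_col S m = (if m \<in> S then 0 else m)"

abbreviation "hook_Y k S \<equiv> symmetrizer k (hook_row S) (hook_col S)"

lemma level_group_hook_row:
  assumes "S \<subseteq> {1..<k}"
  shows "level_group k (hook_row S) = {s. s permutes {..<k} - S}"
proof (intro equalityI subsetI)
  fix s assume s: "s \<in> level_group k (hook_row S)"
  have "s m = m" if "m \<in> {..<k} - ({..<k} - S)" for m
    using level_group_level[OF s, of m] that assms by (auto simp: hook_row_def split: if_splits)
  thus "s \<in> {s. s permutes {..<k} - S}"
    using permutes_superset[OF level_group_permutes[OF s]] by blast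
next
  fix s assume "s \<in> {s. s permutes {..<k} - S}"
  hence s: "s permutes {..<k} - S" by simp
  have "hook_row S (s m) = hook_row S m" if "m < k" for m
    using permutes_in_image[OF s, of m] permutes_not_in[OF s, of m] that
    by (cases "m \<in> S") (auto simp: hook_row_def)
  thus "s \<in> level_group k (hook_row S)"
    using permutes_subset[OF s, of "{..<k}"] by (auto simp: level_group_def)
qed

lemma level_group_hook_col:
  assumes "S \<subseteq> {1..<k}" "k > 0"
  shows "level_group k (hook_col S) = {t. t permutes insert 0 S}"
proof (intro equalityI subsetI)
  fix t assume t: "t \<in> level_group k (hook_col S)"
  have "t m = m" if "m \<in> {..<k} - insert 0 S" for m
    using level_group_level[OF t, of m] that assms by (auto simp: hook_col_def split: if_splits)
  thus "t \<in> {t. t permutes insert 0 S}"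
    using permutes_superset[OF level_group_permutes[OF t]] by blast
next
  fix t assume "t \<in> {t. t permutes insert 0 S}"
  hence t: "t permutes insert 0 S" by simp
  have "hook_col S (t m) = hook_col S m" if "m < k" for m
    using permutes_in_image[OF t, of m] permutes_not_in[OF t, of m]
    by (cases "m \<in> insert 0 S") (auto simp: hook_col_def)
  thus "t \<in> level_group k (hook_col S)"
    using permutes_subset[OF t, of "{..<k}"] assms by (force simp: level_group_def)
qed

lemma shape_hook:
  assumes S: "S \<subseteq> {1..<k}" and k: "k > 0"
  shows "shape k (hook_row S) (hook_col S)"
proof
  fix a b assume "hook_row S a = hook_row S b" "hook_col S a = hook_col S b"
  thus "a = b" using S by (auto simp: hook_row_def hook_col_def split: if_splits)
next
  fix g assume g: "g permutes {..<k}"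
    and sep: "\<And>a b. a < k \<Longrightarrow> b < k \<Longrightarrow> a \<noteq> b \<Longrightarrow> hook_row S a = hook_row S b \<Longrightarrow>
      hook_col S (g a) \<noteq> hook_col S (g b)"
  let ?A = "{..<k} - S"
  \<comment> \<open>Column labels are themselves cells of the long row \<open>?A\<close>, so
    \<open>s\<close> can send a cell of that row to the label of its image under \<open>g\<close>;
    separation makes this injective.\<close>
  define s where "s m = (if m \<in> ?A then hook_col S (g m) else m)" for m
  have col_A: "hook_col S m \<in> ?A" if "m < k" for m
    using that S k by (auto simp: hook_col_def)
  have col_col: "hook_col S (hook_col S m) = hook_col S m" if "m < k" for m
    using col_A[OF that] by (auto simp: hook_col_def)
  have s: "s permutes ?A"
  proof (rule inj_imp_permutes)
    show "inj_on s ?A"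
    proof (rule inj_onI)
      fix a b assume ab: "a \<in> ?A" "b \<in> ?A" "s a = s b"
      hence "hook_row S a = hook_row S b" "hook_col S (g a) = hook_col S (g b)"
        by (simp_all add: hook_row_def s_def)
      thus "a = b" using sep[of a b] ab by auto
    qed
    show "s x \<in> ?A" if "x \<in> ?A" for x
      using that col_A[of "g x"] permutes_lessThan_less[OF g] by (auto simp: s_def)
  qed (auto simp: s_def)
  have "hook_col S (g m) = hook_col S (s m)" if m: "m < k" for m
  proof (cases "m \<in> S")
    case False
    thus ?thesis using m col_col[of "g m"] permutes_lessThan_less[OF g] by (simp add: s_def)
  next
    case True
    \<comment> \<open>The cells of \<open>?A\<close> already reach every column once, so a leg cell
      sent to an arm cell would share its image with some cell of \<open>?A\<close>.\<close>
    have "hook_col S (g m) = 0"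
    proof (rule ccontr)
      assume nz: "hook_col S (g m) \<noteq> 0"
      hence gm: "g m \<notin> S" "g m \<noteq> 0" by (auto simp: hook_col_def split: if_splits)
      have "g m \<in> ?A" using gm m permutes_lessThan_less[OF g] by simp
      then obtain m' where m': "m' \<in> ?A" "s m' = g m"
        using permutes_image[OF s] by (metis imageE)
      hence "g m' = g m" using gm by (auto simp: s_def hook_col_def split: if_splits)
      hence "m' = m" using permutes_inj[OF g] by (auto dest: injD)
      thus False using m' True by simp
    qed
    thus ?thesis using True by (simp add: s_def hook_col_def)
  qed
  moreover have "s \<in> level_group k (hook_row S)"
    using s level_group_hook_row[OF S] by simp
  ultimately show "\<exists>s\<in>level_group k (hook_row S). \<forall>m<k. hook_col S (g m) = hook_col S (s m)"
    by blast
qed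

text \<open>
  The alternating sum of the hook symmetrizers is supported on the full cycles: a cycle avoiding the
  corner lies entirely in the leg or entirely off it, and moving it across changes the sign.
\<close>

lemma hook_sum_vanishes:
  assumes \<sigma>: "\<sigma> permutes {..<k}" and k: "k > 0" and orbit: "orbit \<sigma> 0 \<noteq> {..<k}"
  shows "(\<Sum>S\<in>Pow {1..<k}. (-1) ^ card S * hook_Y k S \<sigma>) = 0"
proof -
  have perm: "permutation \<sigma>" using \<sigma> by (auto intro: permutes_imp_permutation)
  from orbit permutes_orbit_subset[OF \<sigma>, of 0] k
  obtain y where y: "y < k" "y \<notin> orbit \<sigma> 0" by auto
  \<comment> \<open>The cycle that will be moved between leg and arm; \<open>\<rho>\<close> is the
    action of \<open>\<sigma>\<close> on it.\<close>
  define Q where "Q = orbit \<sigma> y"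
  define \<rho> where "\<rho> = perm_restrict \<sigma> Q"
  have zero: "0 \<notin> Q"
    using y(2) orbit_swap[OF permutation_self_in_orbit[OF perm], of 0 y] by (auto simp: Q_def)
  have Q: "Q \<subseteq> {1..<k}"
  proof
    fix u assume "u \<in> Q"
    moreover from this have "u \<noteq> 0" using zero by metis
    ultimately show "u \<in> {1..<k}"
      using permutes_orbit_subset[OF \<sigma>, of y] y(1) by (auto simp: Q_def)
  qed
  have \<rho>: "\<rho> permutes Q" and sign: "sign \<rho> = (-1) ^ (card Q - 1)"
    using perm_restrict_orbit[OF perm, of y] by (simp_all add: \<rho>_def Q_def)
  have \<rho>\<sigma>: "\<rho> u = \<sigma> u" if "u \<in> Q" for u using that by (simp add: \<rho>_def perm_restrict_def)
  have finQ: "finite Q" using Q finite_subset by blast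
  have cardQ: "card Q > 0"
    using finQ permutation_self_in_orbit[OF perm, of y] by (auto simp: Q_def card_gt_0_iff)
  have \<rho>i: "inv \<rho> permutes Q" using \<rho> by (rule permutes_inv)
  define T where "T = {(S, s, t). S \<subseteq> {1..<k} \<and> s permutes {..<k} - S
    \<and> t permutes insert 0 S \<and> \<sigma> = s \<circ> t}"
  define W :: "nat set \<times> (nat \<Rightarrow> nat) \<times> (nat \<Rightarrow> nat) \<Rightarrow> complex"
    where "W = (\<lambda>(S, s, t). (-1) ^ card S * of_int (sign t))"
  let ?R = "\<lambda>S. {s. s permutes {..<k} - S}" and ?C = "\<lambda>S. {t. t permutes insert 0 S}"
  have finRC: "finite (?R S \<times> ?C S)" if "S \<subseteq> {1..<k}" for S
    using finite_subset[OF that]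
    by (intro finite_cartesian_product finite_permutations) auto
  have finSigma: "finite (Sigma (Pow {1..<k}) (\<lambda>S. ?R S \<times> ?C S))"
    by (rule finite_SigmaI) (auto intro!: finRC simp del: finite_cartesian_product_iff)
  have "(\<Sum>S\<in>Pow {1..<k}. (-1) ^ card S * hook_Y k S \<sigma>)
      = (\<Sum>S\<in>Pow {1..<k}. \<Sum>(s, t)\<in>?R S \<times> ?C S. if \<sigma> = s \<circ> t then W (S, s, t) else 0)"
    by (intro sum.cong refl)
      (auto simp: symmetrizer_def level_group_hook_row level_group_hook_col k sum_distrib_left W_def
        sum.cartesian_product intro!: sum.cong)
  also have "\<dots> = (\<Sum>(S, s, t)\<in>Sigma (Pow {1..<k}) (\<lambda>S. ?R S \<times> ?C S).
      if \<sigma> = s \<circ> t then W (S, s, t) else 0)"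
    using finRC by (subst sum.Sigma) (simp_all add: case_prod_unfold)
  also have "\<dots> = (\<Sum>(S, s, t)\<in>T. W (S, s, t))"
  proof (rule sum.mono_neutral_cong_right)
    show "finite (Sigma (Pow {1..<k}) (\<lambda>S. ?R S \<times> ?C S))"
      by (rule finSigma)
  qed (auto simp: T_def split: if_splits)
  finally have main: "(\<Sum>S\<in>Pow {1..<k}. (-1) ^ card S * hook_Y k S \<sigma>) = (\<Sum>x\<in>T. W x)"
    by (simp add: case_prod_unfold)
  have finT: "finite T"
    by (rule finite_subset[OF _ finSigma]) (auto simp: T_def)
  define T1 where "T1 = {(S, s, t)\<in>T. Q \<subseteq> S}"
  define T2 where "T2 = {(S, s, t)\<in>T. Q \<inter> S = {}}"
  \<comment> \<open>On points of \<open>Q\<close> off the leg, \<open>t\<close> is trivial and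
    \<open>s\<close> never enters the leg, so \<open>Q - S\<close> is stable under
    \<open>\<sigma>\<close>. As \<open>Q\<close> is a single orbit, it cannot be split by
    \<open>S\<close>.\<close>
  have dich: "Q \<subseteq> S" if T: "(S, s, t) \<in> T" and u: "u \<in> Q" "u \<in> S" for S s t u
  proof (rule ccontr)
    assume "\<not> Q \<subseteq> S"
    then obtain v where v: "v \<in> Q" "v \<notin> S" by blast
    have s: "s permutes {..<k} - S" and t: "t permutes insert 0 S" and \<sigma>st: "\<sigma> = s \<circ> t"
      using T by (auto simp: T_def)
    have closed: "\<sigma> x \<in> Q - S" if "x \<in> Q - S" for x
    proof -
      have "x \<noteq> 0" "x < k" using that zero Q by (auto intro: ccontr)
      hence "\<sigma> x = s x" using that permutes_not_in[OF t, of x] \<sigma>st by auto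
      moreover have "s x \<notin> S"
        using permutes_in_image[OF s, of x] that \<open>x < k\<close> by auto
      moreover have "\<sigma> x \<in> Q"
        using that by (auto simp: Q_def intro: orbit.step)
      ultimately show ?thesis by auto
    qed
    have "x \<in> Q - S" if "x \<in> orbit \<sigma> v" for x
      using that by induction (use closed v in auto)
    moreover have "u \<in> orbit \<sigma> v"
      using u(1) v(1) cyclic_on_orbit'[OF perm, of y] unfolding cyclic_on_alldef Q_def by auto
    ultimately show False using u(2) by blast
  qed
  have Qne: "Q \<noteq> {}" using cardQ by auto
  have "x \<in> T1 \<union> T2" if "x \<in> T" for x
  proof -
    obtain S s t where x: "x = (S, s, t)" by (metis prod.exhaust)
    show ?thesis using dich[of S s t] that x by (cases "Q \<inter> S = {}") (auto simp: T1_def T2_def)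
  qed
  moreover have "T1 \<union> T2 \<subseteq> T" by (auto simp: T1_def T2_def)
  ultimately have T12: "T = T1 \<union> T2" by blast
  have disj: "T1 \<inter> T2 = {}"
    using Qne by (auto simp: T1_def T2_def Int_absorb2)
  \<comment> \<open>The factor \<open>\<rho>\<close> is transferred from \<open>t\<close> to
    \<open>s\<close>. This changes \<open>sign t\<close> by the sign of a cycle of length
    \<open>card Q\<close> and the other sign by \<open>card Q\<close> factors -1, so one factor -1
    is left over.\<close>
  have "(\<Sum>x\<in>T1. W x) = (\<Sum>x\<in>T2. - W x)"
  proof (rule sum.reindex_bij_witness[where j = "\<lambda>(S, s, t). (S - Q, s \<circ> \<rho>, inv \<rho> \<circ> t)"
        and i = "\<lambda>(S, s, t). (S \<union> Q, s \<circ> inv \<rho>, \<rho> \<circ> t)"])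
    fix a assume "a \<in> T1"
    then obtain S s t where a: "a = (S, s, t)" and S: "S \<subseteq> {1..<k}" and QS: "Q \<subseteq> S"
      and s: "s permutes {..<k} - S" and t: "t permutes insert 0 S" and \<sigma>st: "\<sigma> = s \<circ> t"
      by (auto simp: T1_def T_def)
    have finS: "finite S" using S finite_subset by blast
    \<comment> \<open>With \<open>Q\<close> inside the leg, \<open>s\<close> fixes everything there,
      and \<open>t\<close> alone performs the cycle.\<close>
    have tQ: "t u = \<rho> u" if "u \<in> Q" for u
    proof -
      have "\<sigma> u \<in> Q" using that by (auto simp: Q_def intro: orbit.step)
      hence "s (t u) \<in> S" using QS \<sigma>st by auto
      hence "t u \<in> S" using permutes_in_image[OF s, of "t u"] permutes_in_image[OF t, of u] that QS S k
        by auto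
      hence "s (t u) = t u" using permutes_not_in[OF s] by auto
      thus ?thesis using \<rho>\<sigma>[OF that] \<sigma>st by simp
    qed
    have it: "inv \<rho> \<circ> t permutes insert 0 S"
      using t permutes_subset[OF \<rho>i, of "insert 0 S"] QS by (auto intro: permutes_compose)
    have "inv \<rho> \<circ> t permutes insert 0 (S - Q)"
      by (rule permutes_superset[OF it])
        (use tQ zero permutes_inverses[OF \<rho>] in auto)
    moreover have "s \<circ> \<rho> permutes {..<k} - (S - Q)"
      using permutes_subset[OF s, of "{..<k} - (S - Q)"] permutes_subset[OF \<rho>, of "{..<k} - (S - Q)"] Q
      by (intro permutes_compose) (auto simp: atLeastLessThan_def)
    moreover have "s \<circ> \<rho> \<circ> (inv \<rho> \<circ> t) = s \<circ> t"
      by (simp add: comp_assoc permutes_comp_left_cancel[OF \<rho>])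
    ultimately show "(case a of (S, s, t) \<Rightarrow> (S - Q, s \<circ> \<rho>, inv \<rho> \<circ> t)) \<in> T2"
      using a S \<sigma>st by (auto simp: T2_def T_def)
    show "(case case a of (S, s, t) \<Rightarrow> (S - Q, s \<circ> \<rho>, inv \<rho> \<circ> t) of
        (S, s, t) \<Rightarrow> (S \<union> Q, s \<circ> inv \<rho>, \<rho> \<circ> t)) = a"
      using a QS by (simp add: comp_assoc permutes_comp_left_cancel[OF \<rho>] permutes_inv_o[OF \<rho>]
          Un_absorb2)
    have cS: "card S = card (S - Q) + card Q"
      using QS finS finQ by (simp add: card_Diff_subset card_mono)
    have sgn: "sign (inv \<rho> \<circ> t) = (-1) ^ (card Q - 1) * sign t"
      using sign_permutes_comp[OF permutes_subset[OF \<rho>i] t] QS finS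
        sign_permutes_inv[OF \<rho> finQ] sign by auto
    show "- W (case a of (S, s, t) \<Rightarrow> (S - Q, s \<circ> \<rho>, inv \<rho> \<circ> t)) = W a"
    proof -
      have "(-1) ^ card Q = (- ((-1) ^ (card Q - 1)) :: complex)"
        using cardQ by (cases "card Q") auto
      thus ?thesis
        unfolding a W_def prod.case sgn cS power_add by simp
    qed
  next
    fix b assume "b \<in> T2"
    then obtain S s t where b: "b = (S, s, t)" and S: "S \<subseteq> {1..<k}" and QS: "Q \<inter> S = {}"
      and s: "s permutes {..<k} - S" and t: "t permutes insert 0 S" and \<sigma>st: "\<sigma> = s \<circ> t"
      by (auto simp: T2_def T_def)
    have si: "s \<circ> inv \<rho> permutes {..<k} - S"
    proof (rule permutes_compose[OF permutes_subset[OF \<rho>i] s])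
      show "Q \<subseteq> {..<k} - S" using QS Q by auto
    qed
    have "s \<circ> inv \<rho> permutes {..<k} - (S \<union> Q)"
    proof (rule permutes_superset[OF si])
      fix x assume "x \<in> {..<k} - S - ({..<k} - (S \<union> Q))"
      hence x: "x \<in> Q" by auto
      let ?u = "inv \<rho> x"
      have u: "?u \<in> Q" using x permutes_in_image[OF \<rho>i] by simp
      hence "?u \<notin> insert 0 S" using zero QS by (metis IntI empty_iff insertE)
      hence "t ?u = ?u" by (rule permutes_not_in[OF t])
      hence "s ?u = \<rho> ?u" using \<rho>\<sigma>[OF u] \<sigma>st by simp
      thus "(s \<circ> inv \<rho>) x = x" by (simp add: permutes_inverses[OF \<rho>])
    qed
    moreover have "\<rho> \<circ> t permutes insert 0 (S \<union> Q)"
      using permutes_subset[OF t, of "insert 0 (S \<union> Q)"] permutes_subset[OF \<rho>, of "insert 0 (S \<union> Q)"]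
      by (intro permutes_compose) auto
    moreover have "s \<circ> inv \<rho> \<circ> (\<rho> \<circ> t) = s \<circ> t"
      by (simp add: comp_assoc permutes_comp_left_cancel[OF \<rho>])
    ultimately show "(case b of (S, s, t) \<Rightarrow> (S \<union> Q, s \<circ> inv \<rho>, \<rho> \<circ> t)) \<in> T1"
      using b S Q \<sigma>st by (auto simp: T1_def T_def)
    show "(case case b of (S, s, t) \<Rightarrow> (S \<union> Q, s \<circ> inv \<rho>, \<rho> \<circ> t) of
        (S, s, t) \<Rightarrow> (S - Q, s \<circ> \<rho>, inv \<rho> \<circ> t)) = b"
      using b QS by (auto simp: comp_assoc permutes_comp_left_cancel[OF \<rho>] permutes_inv_o[OF \<rho>])
  qed
  hence "(\<Sum>x\<in>T. W x) = 0"
    using finT disj unfolding T12 by (subst sum.union_disjoint) (auto simp: sum_negf)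
  thus ?thesis using main by simp
qed

section \<open>Class functions and hooks\<close>

definition class_fun :: "nat \<Rightarrow> galg \<Rightarrow> bool" where
  "class_fun k z \<longleftrightarrow>
     (\<forall>a x. a permutes {..<k} \<longrightarrow> x permutes {..<k} \<longrightarrow> z (a \<circ> x \<circ> inv a) = z x)"

lemma class_funD:
  "class_fun k z \<Longrightarrow> a permutes {..<k} \<Longrightarrow> x permutes {..<k} \<Longrightarrow> z (a \<circ> x \<circ> inv a) = z x"
  by (simp add: class_fun_def)

lemma inv_conj:
  assumes "a permutes S" "x permutes S"
  shows "inv (a \<circ> x \<circ> inv a) = a \<circ> inv x \<circ> inv a"
  using assms by (simp add: permutes_inv_comp[of _ S] permutes_compose permutes_inv
      permutes_inv_inv[OF assms(1)] comp_assoc)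

lemma sum_permutations_conj:
  assumes "a permutes S"
  shows "(\<Sum>s | s permutes S. F s) = (\<Sum>s | s permutes S. F (a \<circ> s \<circ> inv a))"
proof -
  have "(\<Sum>s | s permutes S. F s) = (\<Sum>s | s permutes S. F (s \<circ> inv a))"
    by (rule sum_permutations_compose_right[OF permutes_inv[OF assms]])
  also have "\<dots> = (\<Sum>s | s permutes S. F (a \<circ> s \<circ> inv a))"
    by (rule setum_permutations_compose_left[OF assms])
  finally show ?thesis .
qed

lemma class_fun_mult:
  assumes "class_fun k f" "class_fun k h"
  shows "class_fun k (galg_mult k f h)"
  unfolding class_fun_def
proof (intro allI impI)
  fix a x assume a: "a permutes {..<k}" and x: "x permutes {..<k}"
  let ?G = "{s. s permutes {..<k}}"
  have "galg_mult k f h (a \<circ> x \<circ> inv a) = (\<Sum>s\<in>?G. f s * h (inv s \<circ> (a \<circ> x \<circ> inv a)))"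
    using a x by (simp add: galg_mult_apply permutes_compose permutes_inv)
  also have "\<dots> = (\<Sum>s\<in>?G. f (a \<circ> s \<circ> inv a) * h (inv (a \<circ> s \<circ> inv a) \<circ> (a \<circ> x \<circ> inv a)))"
    by (rule sum_permutations_conj[OF a])
  also have "\<dots> = (\<Sum>s\<in>?G. f s * h (inv s \<circ> x))"
  proof (rule sum.cong[OF refl])
    fix s assume "s \<in> ?G"
    hence s: "s permutes {..<k}" by simp
    have "inv (a \<circ> s \<circ> inv a) \<circ> (a \<circ> x \<circ> inv a) = a \<circ> (inv s \<circ> x) \<circ> inv a"
      unfolding inv_conj[OF a s] by (simp add: comp_assoc permutes_comp_left_cancel[OF a])
    thus "f (a \<circ> s \<circ> inv a) * h (inv (a \<circ> s \<circ> inv a) \<circ> (a \<circ> x \<circ> inv a)) = f s * h (inv s \<circ> x)"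
      using class_funD[OF assms(1) a s]
        class_funD[OF assms(2) a permutes_compose[OF x permutes_inv[OF s]]] by simp
  qed
  also have "\<dots> = galg_mult k f h x"
    using x by (simp add: galg_mult_apply)
  finally show "galg_mult k f h (a \<circ> x \<circ> inv a) = galg_mult k f h x" .
qed

definition power_fun :: "nat \<Rightarrow> complex \<Rightarrow> nat \<Rightarrow> galg" where
  "power_fun k \<eta> m s = (if s permutes {..<k} then twist \<eta> s * of_nat (inv_count m {..<k} s) else 0)"

lemma twist_conj:
  assumes "\<eta>\<^sup>2 = 1" "a permutes X" "x permutes X" "finite X"
  shows "twist \<eta> (a \<circ> x \<circ> inv a) = twist \<eta> x"
proof -
  have "twist \<eta> (a \<circ> x \<circ> inv a) = twist \<eta> a * twist \<eta> x * twist \<eta> a"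
    using assms twist_comp[of \<eta> "a \<circ> x" X "inv a"] twist_comp[of \<eta> a X x] twist_inv[of a X \<eta>]
    by (simp add: permutes_compose permutes_inv)
  also have "\<dots> = (twist \<eta> a * twist \<eta> a) * twist \<eta> x"
    by (simp only: mult_ac)
  finally show ?thesis using assms(1) by (simp add: twist_square)
qed

lemma class_fun_power_fun: "\<eta>\<^sup>2 = 1 \<Longrightarrow> class_fun k (power_fun k \<eta> m)"
  unfolding class_fun_def power_fun_def
  using twist_conj[of \<eta> _ "{..<k}"] inv_count_conj[of _ "{..<k}"]
  by (simp add: permutes_compose permutes_inv)

lemma galg_mult_symmetrizer_id:
  "galg_mult k z (symmetrizer k row col) id
    = (\<Sum>s\<in>level_group k row. \<Sum>t\<in>level_group k col. of_int (sign t) * z (inv (s \<circ> t)))"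
proof -
  let ?G = "{s. s permutes {..<k}}"
  have "galg_mult k z (symmetrizer k row col) id = (\<Sum>h\<in>?G. z h * symmetrizer k row col (inv h))"
    by (simp add: galg_mult_apply)
  also have "\<dots> = (\<Sum>h\<in>?G. z (inv h) * symmetrizer k row col (inv (inv h)))"
    by (rule sum_permutations_inverse)
  also have "\<dots> = (\<Sum>h\<in>?G. \<Sum>s\<in>level_group k row. \<Sum>t\<in>level_group k col.
      if h = s \<circ> t then of_int (sign t) * z (inv (s \<circ> t)) else 0)"
    by (intro sum.cong refl)
      (auto simp: symmetrizer_def permutes_inv_inv sum_distrib_left intro!: sum.cong)
  also have "\<dots> = (\<Sum>s\<in>level_group k row. \<Sum>h\<in>?G. \<Sum>t\<in>level_group k col.
      if h = s \<circ> t then of_int (sign t) * z (inv (s \<circ> t)) else 0)"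
    by (rule sum.swap)
  also have "\<dots> = (\<Sum>s\<in>level_group k row. \<Sum>t\<in>level_group k col. \<Sum>h\<in>?G.
      if h = s \<circ> t then of_int (sign t) * z (inv (s \<circ> t)) else 0)"
    by (intro sum.cong refl sum.swap)
  also have "\<dots> = (\<Sum>s\<in>level_group k row. \<Sum>t\<in>level_group k col. of_int (sign t) * z (inv (s \<circ> t)))"
    by (intro sum.cong refl) (simp add: sum.delta permutes_compose level_group_permutes)
  finally show ?thesis .
qed

text \<open>This is the product of m + \<eta> c over the contents c of the hook, which run from
  \<open>- card S\<close> at the foot of the leg to \<open>k - 1 - card S\<close> at the end of the
  arm. Row insertions supply the positive contents, column insertions the others.\<close>

lemma hook_eigenvalue:
  assumes S: "S \<subseteq> {1..<k}" and k: "k > 0" and \<eta>: "\<eta> = 1 \<or> \<eta> = -1"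
  shows "galg_mult k (power_fun k \<eta> m) (hook_Y k S) id
    = (\<Prod>i<k. of_nat m + \<eta> * (of_nat i - of_nat (card S)))"
proof -
  let ?A = "{1..<k} - S" and ?B = "insert 0 S"
  have finS: "finite S" using S finite_subset by blast
  have R: "level_group k (hook_row S) = {s. s permutes insert 0 ?A}"
  proof -
    have "insert 0 ?A = {..<k} - S" using S k by auto
    thus ?thesis using level_group_hook_row[OF S] by simp
  qed
  have C: "level_group k (hook_col S) = {t. t permutes ?B}"
    by (rule level_group_hook_col[OF S k])
  have AB: "?A \<union> ?B = {..<k}" using S k by auto
  \<comment> \<open>The column sign of the symmetrizer merges with the twist of \<open>t\<close>,
    replacing \<open>\<eta>\<close> by \<open>-\<eta>\<close> on the column group only; hence the
    opposite sign of contents there.\<close>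
  have "galg_mult k (power_fun k \<eta> m) (hook_Y k S) id
      = (\<Sum>s\<in>level_group k (hook_row S). \<Sum>t\<in>level_group k (hook_col S).
          twist \<eta> s * twist (-\<eta>) t * of_nat (inv_count m {..<k} (s \<circ> t)))"
    unfolding galg_mult_symmetrizer_id
  proof (intro sum.cong refl)
    fix s t assume s: "s \<in> level_group k (hook_row S)" and t: "t \<in> level_group k (hook_col S)"
    have sp: "s permutes {..<k}" and tp: "t permutes {..<k}"
      using s t by (auto intro: level_group_permutes)
    have st: "s \<circ> t permutes {..<k}" using sp tp by (auto intro: permutes_compose)
    have f1: "power_fun k \<eta> m (inv (s \<circ> t)) = twist \<eta> (s \<circ> t) * of_nat (inv_count m {..<k} (s \<circ> t))"
      using permutes_inv[OF st] by (simp add: power_fun_def twist_inv[OF st] inv_count_inv[OF st])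
    have f2: "twist \<eta> (s \<circ> t) = twist \<eta> s * twist \<eta> t"
      by (rule twist_comp[OF _ sp tp]) (use \<eta> in auto)
    have f3: "twist (-\<eta>) t = of_int (sign t) * twist \<eta> t"
      using \<eta> by (auto simp: twist_def sign_def)
    show "of_int (sign t) * power_fun k \<eta> m (inv (s \<circ> t))
        = twist \<eta> s * twist (-\<eta>) t * of_nat (inv_count m {..<k} (s \<circ> t))"
      unfolding f1 f2 f3 by (simp only: mult_ac)
  qed
  also have "\<dots> = (\<Prod>i=1..card ?A. of_nat m + \<eta> * of_nat i)
      * (\<Prod>i<card ?B. of_nat m + (-\<eta>) * of_nat i)"
    unfolding R C unfolding AB[symmetric]
    by (rule twisted_sum_hook) (use finS \<eta> S in auto)
  also have "card ?B = Suc (card S)"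
    using finS S by (subst card_insert_disjoint) auto
  also have "card ?A = k - Suc (card S)"
    using S finS by (simp add: card_Diff_subset)
  also have "(\<Prod>i<Suc (card S). of_nat m + (-\<eta>) * of_nat i)
      = (\<Prod>i<Suc (card S). of_nat m + \<eta> * (of_nat i - of_nat (card S)))"
  proof -
    have "(\<Prod>i<Suc (card S). of_nat m + (-\<eta>) * of_nat i)
        = (\<Prod>i<Suc (card S). of_nat m + (-\<eta>) * of_nat (Suc (card S) - Suc i))"
      by (rule prod.nat_diff_reindex[symmetric])
    also have "\<dots> = (\<Prod>i<Suc (card S). of_nat m + \<eta> * (of_nat i - of_nat (card S)))"
      by (intro prod.cong refl) (simp add: of_nat_diff algebra_simps)
    finally show ?thesis .
  qed
  also have "(\<Prod>i=1..k - Suc (card S). of_nat m + \<eta> * of_nat i)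
      = (\<Prod>i=Suc (card S)..<k. of_nat m + \<eta> * (of_nat i - of_nat (card S)))"
    by (rule prod.reindex_bij_witness[where i = "\<lambda>i. i - card S" and j = "\<lambda>i. i + card S"]) auto
  finally have *: "galg_mult k (power_fun k \<eta> m) (hook_Y k S) id
      = (\<Prod>i<Suc (card S). of_nat m + \<eta> * (of_nat i - of_nat (card S)))
        * (\<Prod>i=Suc (card S)..<k. of_nat m + \<eta> * (of_nat i - of_nat (card S)))"
    by (simp only: mult.commute)
  have "Suc (card S) \<le> k"
    using card_mono[of "{1..<k}" S] S k by simp
  thus ?thesis
    unfolding * lessThan_atLeast0 by (intro prod.atLeastLessThan_concat) auto
qed

lemma sum_Pow_card:
  fixes F :: "nat \<Rightarrow> complex"
  assumes "finite A"
  shows "(\<Sum>S\<in>Pow A. F (card S)) = (\<Sum>r\<le>card A. of_nat (card A choose r) * F r)"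
proof -
  have "(\<Sum>S\<in>Pow A. F (card S)) = (\<Sum>r\<le>card A. \<Sum>S | S \<in> Pow A \<and> card S = r. F (card S))"
    by (rule sum.group[symmetric]) (use assms in \<open>auto intro: card_mono\<close>)
  also have "\<dots> = (\<Sum>r\<le>card A. of_nat (card A choose r) * F r)"
    using n_subsets[OF assms] by (intro sum.cong refl) (simp add: Pow_def)
  finally show ?thesis .
qed

text \<open>
  The constant \<open>fact k\<close> below is found by testing the identity on the constant function \<open>1\<close>.
\<close>

lemma hook_expansion_full_cycle:
  assumes k: "k > 0" and z: "class_fun k z"
  shows "(\<Sum>S\<in>Pow {1..<k}. (-1) ^ card S * galg_mult k z (hook_Y k S) id)
    = fact k * z (inv (cyc k))"
proof -
  let ?G = "{s. s permutes {..<k}}"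
  define D where "D \<sigma> = (\<Sum>S\<in>Pow {1..<k}. (-1) ^ card S * hook_Y k S \<sigma>)" for \<sigma>
  define K where "K = (\<Sum>\<sigma>\<in>?G. D \<sigma>)"
  have general: "(\<Sum>S\<in>Pow {1..<k}. (-1) ^ card S * galg_mult k z (hook_Y k S) id)
      = z (inv (cyc k)) * K" if z: "class_fun k z" for z
  proof -
    have "galg_mult k z (hook_Y k S) id = (\<Sum>\<sigma>\<in>?G. z (inv \<sigma>) * hook_Y k S \<sigma>)" for S
    proof -
      have "galg_mult k z (hook_Y k S) id = (\<Sum>\<sigma>\<in>?G. z \<sigma> * hook_Y k S (inv \<sigma>))"
        by (simp add: galg_mult_apply)
      also have "\<dots> = (\<Sum>\<sigma>\<in>?G. z (inv \<sigma>) * hook_Y k S (inv (inv \<sigma>)))"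
        by (rule sum_permutations_inverse)
      also have "\<dots> = (\<Sum>\<sigma>\<in>?G. z (inv \<sigma>) * hook_Y k S \<sigma>)"
        by (intro sum.cong refl) (simp add: permutes_inv_inv[of _ "{..<k}"])
      finally show ?thesis .
    qed
    hence "(\<Sum>S\<in>Pow {1..<k}. (-1) ^ card S * galg_mult k z (hook_Y k S) id)
        = (\<Sum>S\<in>Pow {1..<k}. \<Sum>\<sigma>\<in>?G. z (inv \<sigma>) * ((-1) ^ card S * hook_Y k S \<sigma>))"
      by (simp add: sum_distrib_left mult_ac)
    also have "\<dots> = (\<Sum>\<sigma>\<in>?G. z (inv \<sigma>) * D \<sigma>)"
      by (subst sum.swap) (simp add: D_def sum_distrib_left)
    also have "\<dots> = (\<Sum>\<sigma>\<in>?G. z (inv (cyc k)) * D \<sigma>)"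
    proof (rule sum.cong[OF refl])
      fix \<sigma> assume "\<sigma> \<in> ?G"
      hence \<sigma>: "\<sigma> permutes {..<k}" by simp
      show "z (inv \<sigma>) * D \<sigma> = z (inv (cyc k)) * D \<sigma>"
      proof (cases "orbit \<sigma> 0 = {..<k}")
        case False
        thus ?thesis using hook_sum_vanishes[OF \<sigma> k] by (simp add: D_def)
      next
        case True
        obtain y where y: "y permutes {..<k}" "\<sigma> = y \<circ> cyc k \<circ> inv y"
          by (rule single_cycle_conjugate[OF \<sigma>, of 0 k]) (use True k in auto)
        have "z (inv \<sigma>) = z (inv (cyc k))"
          unfolding y(2) inv_conj[OF y(1) cyc_permutes]
          by (rule class_funD[OF z y(1) permutes_inv[OF cyc_permutes]])
        thus ?thesis by simp
      qed
    qed
    finally show ?thesis by (simp add: K_def sum_distrib_left)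
  qed
  have "K = fact k"
  proof -
    \<comment> \<open>There is exactly one map into a one-element set, so this is the constant
      function 1 on the group.\<close>
    let ?z = "power_fun k 1 1"
    have "?z (inv (cyc k)) = 1"
      using permutes_inv[OF cyc_permutes, of k] inv_count_one[OF permutes_inv[OF cyc_permutes], of k]
      by (simp add: power_fun_def)
    hence "K = (\<Sum>S\<in>Pow {1..<k}. (-1) ^ card S * galg_mult k ?z (hook_Y k S) id)"
      using general[OF class_fun_power_fun[of 1 k 1]] by simp
    also have "\<dots> = (\<Sum>S\<in>Pow {1..<k}. if S = {} then fact k else 0)"
    proof (intro sum.cong refl)
      fix S assume "S \<in> Pow {1..<k}"
      hence S: "S \<subseteq> {1..<k}" and finS: "finite S" using finite_subset by auto
      have "galg_mult k ?z (hook_Y k S) id = (\<Prod>i<k. 1 + (of_nat i - of_nat (card S)))"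
        using hook_eigenvalue[OF S k, of 1 1] by simp
      also have "\<dots> = (if S = {} then fact k else 0)"
      proof (cases "S = {}")
        case True
        thus ?thesis by (simp add: fact_prod_Suc lessThan_atLeast0)
      next
        case False
        \<comment> \<open>A nonempty leg contains a cell of content -1, whose factor
          vanishes.\<close>
        hence pos: "card S > 0" using finS by (simp add: card_gt_0_iff)
        have "card S - 1 < k" using card_mono[of "{1..<k}" S] S k by simp
        moreover have "1 + (of_nat (card S - 1) - of_nat (card S)) = (0 :: complex)"
          using pos by (simp add: of_nat_diff)
        ultimately have "(\<Prod>i<k. 1 + (of_nat i - of_nat (card S))) = (0 :: complex)"
          by (intro prod_zero) auto
        thus ?thesis using False by simp
      qed
      finally show "(-1) ^ card S * galg_mult k ?z (hook_Y k S) id = (if S = {} then fact k else 0)"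
        by simp
    qed
    also have "\<dots> = fact k" by (simp add: sum.delta')
    finally show ?thesis .
  qed
  thus ?thesis using general[OF z] by (simp add: mult.commute)
qed

text \<open>A product of class functions acts on each hook symmetrizer by the product of their
  scalars. These depend on the leg only through its size, so grouping legs by size creates the
  binomial coefficients.\<close>

theorem full_cycle_convolution:
  assumes k: "k > 0"
  shows "fact k * galg_mult k (power_fun k 1 p) (power_fun k (-1) q) (inv (cyc k))
    = (\<Sum>r\<le>k-1. (-1) ^ r * of_nat ((k - 1) choose r)
        * (\<Prod>i<k. of_nat p - of_nat r + of_nat i) * (\<Prod>i<k. of_nat q + of_nat r - of_nat i))"
proof -
  let ?a = "power_fun k 1 p" and ?b = "power_fun k (-1) q"
  have cls: "class_fun k ?a" "class_fun k ?b" by (simp_all add: class_fun_power_fun)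
  have "fact k * galg_mult k ?a ?b (inv (cyc k))
      = (\<Sum>S\<in>Pow {1..<k}. (-1) ^ card S * galg_mult k (galg_mult k ?a ?b) (hook_Y k S) id)"
    by (rule hook_expansion_full_cycle[OF k class_fun_mult[OF cls], symmetric])
  also have "\<dots> = (\<Sum>S\<in>Pow {1..<k}. (-1) ^ card S
      * ((\<Prod>i<k. of_nat p - of_nat (card S) + of_nat i) * (\<Prod>i<k. of_nat q + of_nat (card S) - of_nat i)))"
  proof (rule sum.cong[OF refl])
    fix S assume "S \<in> Pow {1..<k}"
    hence S: "S \<subseteq> {1..<k}" by simp
    interpret shape k "hook_row S" "hook_col S" by (rule shape_hook[OF S k])
    have central: "galg_mult k z Y = galg_scale (galg_mult k z Y id) Y" if "class_fun k z" for z
      by (rule central_Y) (rule class_funD[OF that])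
    have "galg_mult k (galg_mult k ?a ?b) Y = galg_mult k ?a (galg_scale (galg_mult k ?b Y id) Y)"
      using central[OF cls(2)] by (simp add: galg_mult_assoc)
    hence "galg_mult k (galg_mult k ?a ?b) Y id
        = galg_scale (galg_mult k ?b Y id) (galg_mult k ?a Y) id"
      by (simp only: galg_mult_scale_right)
    also have "\<dots> = galg_mult k ?b Y id * galg_mult k ?a Y id"
      by (simp add: galg_scale_def)
    also have "\<dots> = (\<Prod>i<k. of_nat p - of_nat (card S) + of_nat i)
        * (\<Prod>i<k. of_nat q + of_nat (card S) - of_nat i)"
      using hook_eigenvalue[OF S k, of 1 p] hook_eigenvalue[OF S k, of "-1" q]
      by (simp add: algebra_simps)
    finally show "(-1) ^ card S * galg_mult k (galg_mult k ?a ?b) Y id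
        = (-1) ^ card S * ((\<Prod>i<k. of_nat p - of_nat (card S) + of_nat i)
          * (\<Prod>i<k. of_nat q + of_nat (card S) - of_nat i))" by simp
  qed
  also have "\<dots> = (\<Sum>r\<le>card {1..<k}. of_nat (card {1..<k} choose r) * ((-1) ^ r
      * ((\<Prod>i<k. of_nat p - of_nat r + of_nat i) * (\<Prod>i<k. of_nat q + of_nat r - of_nat i))))"
    by (rule sum_Pow_card) simp
  finally show ?thesis by (simp add: mult_ac)
qed

section \<open>A finite difference evaluation\<close>

text \<open>
  The Pfaff--Saalschuetz summation for the parameters \<open>D\<close>, \<open>-D\<close>, cleared of denominators.
\<close>

lemma pfaff_saalschuetz:
  fixes a D :: "'a::comm_ring_1"
  shows "(\<Prod>i<N. (a + of_nat i)\<^sup>2 - D\<^sup>2) =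
    (\<Sum>n\<le>N. of_nat (N choose n) * (\<Prod>r<n. (of_nat r)\<^sup>2 - D\<^sup>2)
       * (\<Prod>i<N-n. a + of_nat i) * (\<Prod>i=n..<N. a + of_nat i))"
proof (induction N)
  case (Suc N)
  define E where "E n = (\<Prod>r<n. (of_nat r)\<^sup>2 - D\<^sup>2)" for n
  define P where "P m n = (\<Prod>i=m..<n. a + of_nat i)" for m n :: nat
  define A where "A M n = of_nat (M choose n) * P 0 (M - n) * P n M" for M n
  \<comment> \<open>Coefficient recursion matching \<open>step\<close> below:
    \<open>E (Suc n)\<close> is fed by \<open>E n\<close> and by itself. With the common factor
    \<open>B\<close> removed it is linear in \<open>a\<close>, and Pascal's rule together with
    absorption settles it.\<close>
  have A_Suc: "A (Suc N) (Suc n)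
      = A N n + A N (Suc n) * ((a + of_nat N)\<^sup>2 - (of_nat (Suc n))\<^sup>2)" if "n < N" for n
  proof -
    have N: "N - n = Suc (N - Suc n)" using that by simp
    define B where "B = P 0 (N - n) * P (Suc n) N"
    have h1: "A N n = of_nat (N choose n) * (B * (a + of_nat n))"
      using that by (simp add: A_def B_def P_def prod.atLeast_Suc_lessThan[of n] mult_ac)
    have of: "of_nat (N - Suc n) = (of_nat N - of_nat (Suc n) :: 'a)"
      using that by (simp add: of_nat_diff)
    have h2: "A N (Suc n) * ((a + of_nat N)\<^sup>2 - (of_nat (Suc n))\<^sup>2)
        = of_nat (N choose Suc n) * (B * (a + of_nat N + of_nat (Suc n)))"
    proof -
      have "(a + of_nat N)\<^sup>2 - (of_nat (Suc n))\<^sup>2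
          = (a + of_nat (N - Suc n)) * (a + of_nat N + of_nat (Suc n))"
        unfolding of by (simp add: algebra_simps power2_eq_square)
      moreover have "B = P 0 (N - Suc n) * (a + of_nat (N - Suc n)) * P (Suc n) N"
        by (simp add: B_def P_def N)
      ultimately show ?thesis by (simp add: A_def mult_ac)
    qed
    have h3: "A (Suc N) (Suc n) = of_nat (Suc N choose Suc n) * (B * (a + of_nat N))"
      using that by (simp add: A_def B_def P_def mult_ac)
    have "(N choose n) * (N - n) = (N choose Suc n) * Suc n"
      using binomial_absorb_comp[of N n] binomial_absorption[of n N] that
      by (simp add: mult.commute)
    hence "of_nat (N choose n) * of_nat (N - n) = (of_nat (N choose Suc n) * of_nat (Suc n) :: 'a)"
      by (metis of_nat_mult)
    hence key: "of_nat (N choose n) * (of_nat N - of_nat n)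
        = (of_nat (N choose Suc n) * of_nat (Suc n) :: 'a)"
      using that by (simp add: of_nat_diff)
    have "of_nat (Suc N choose Suc n) * (a + of_nat N)
        = of_nat (N choose n) * (a + of_nat n) + of_nat (N choose n) * (of_nat N - of_nat n)
          + of_nat (N choose Suc n) * (a + of_nat N)"
      by (simp add: algebra_simps)
    also have "\<dots> = of_nat (N choose n) * (a + of_nat n)
          + of_nat (N choose Suc n) * (a + of_nat N + of_nat (Suc n))"
      unfolding key by (simp add: algebra_simps)
    finally have "of_nat (Suc N choose Suc n) * (a + of_nat N)
        = of_nat (N choose n) * (a + of_nat n)
          + of_nat (N choose Suc n) * (a + of_nat N + of_nat (Suc n))" .
    from arg_cong[OF this, of "\<lambda>u. B * u"] show ?thesis
      unfolding h1 h2 h3 by (simp only: ring_distribs mult_ac)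
  qed
  have A_0: "A (Suc N) 0 = A N 0 * (a + of_nat N)\<^sup>2"
    by (simp add: A_def P_def power2_eq_square mult_ac)
  have A_top: "A (Suc N) (Suc N) = A N N"
    by (simp add: A_def P_def)
  \<comment> \<open>Subtracting and adding the square of \<open>n\<close> splits the new factor into
    the one extending \<open>E n\<close> and one free of \<open>D\<close>.\<close>
  have step: "((a + of_nat N)\<^sup>2 - D\<^sup>2) * E n
      = E (Suc n) + ((a + of_nat N)\<^sup>2 - (of_nat n)\<^sup>2) * E n" for n
    by (simp add: E_def algebra_simps)
  have IH: "(\<Prod>i<N. (a + of_nat i)\<^sup>2 - D\<^sup>2) = (\<Sum>n\<le>N. A N n * E n)"
    unfolding Suc.IH by (intro sum.cong refl)
      (simp add: A_def E_def P_def mult_ac lessThan_atLeast0)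
  have "(\<Prod>i<Suc N. (a + of_nat i)\<^sup>2 - D\<^sup>2)
      = (\<Sum>n\<le>N. A N n * (((a + of_nat N)\<^sup>2 - D\<^sup>2) * E n))"
    by (simp add: IH sum_distrib_right mult_ac)
  also have "\<dots> = (\<Sum>n\<le>N. A N n * E (Suc n))
      + (\<Sum>n\<le>N. A N n * ((a + of_nat N)\<^sup>2 - (of_nat n)\<^sup>2) * E n)"
    unfolding step by (simp add: distrib_left sum.distrib mult.assoc)
  also have "(\<Sum>n\<le>N. A N n * E (Suc n)) = (\<Sum>n<N. A N n * E (Suc n)) + A N N * E (Suc N)"
    by (simp add: lessThan_Suc_atMost[symmetric])
  also have "(\<Sum>n\<le>N. A N n * ((a + of_nat N)\<^sup>2 - (of_nat n)\<^sup>2) * E n)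
      = A N 0 * (a + of_nat N)\<^sup>2 * E 0
        + (\<Sum>n<N. A N (Suc n) * ((a + of_nat N)\<^sup>2 - (of_nat (Suc n))\<^sup>2) * E (Suc n))"
    unfolding lessThan_Suc_atMost[symmetric] sum.lessThan_Suc_shift by simp
  also have "(\<Sum>n<N. A N n * E (Suc n)) + A N N * E (Suc N) + \<dots>
      = A (Suc N) 0 * E 0 + (\<Sum>n<N. A (Suc N) (Suc n) * E (Suc n)) + A (Suc N) (Suc N) * E (Suc N)"
    unfolding A_0 A_top by (simp add: A_Suc distrib_right sum.distrib add_ac)
  also have "\<dots> = (\<Sum>n\<le>Suc N. A (Suc N) n * E n)"
    unfolding lessThan_Suc_atMost[symmetric, of "Suc N"] sum.lessThan_Suc_shift[of _ "Suc N"]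
    by (simp add: add_ac)
  finally show ?case
    by (simp only: A_def E_def P_def mult_ac lessThan_atLeast0)
qed simp

text \<open>
  The central factorial polynomials, on which the central difference operator acts like
  differentiation on powers.
\<close>

fun central_fact :: "nat \<Rightarrow> complex \<Rightarrow> complex" where
  "central_fact 0 x = 1"
| "central_fact (Suc n) x = x * (\<Prod>i=1..n. x + (of_nat n + 1) / 2 - of_nat i)"

text \<open>The zeros are symmetric about the origin; raising the degree by two adds one factor at
  either end of the product.\<close>

lemma central_fact_step:
  "central_fact (Suc (Suc (Suc n))) x = central_fact (Suc n) x * (x\<^sup>2 - ((of_nat n + 1) / 2)\<^sup>2)"
proof -
  let ?h = "(of_nat n + 1) / 2 :: complex"
  have "(\<Prod>i=1..Suc (Suc n). x + (of_nat (Suc (Suc n)) + 1) / 2 - of_nat i)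
      = (x + ?h) * (\<Prod>i=Suc 1..Suc (Suc n). x + (of_nat (Suc (Suc n)) + 1) / 2 - of_nat i)"
    by (subst prod.atLeast_Suc_atMost) (auto simp: field_simps)
  also have "(\<Prod>i=Suc 1..Suc (Suc n). x + (of_nat (Suc (Suc n)) + 1) / 2 - of_nat i)
      = (\<Prod>i=1..Suc n. x + ?h - of_nat i)"
    unfolding prod.atLeast_Suc_atMost_Suc_shift
    by (intro prod.cong refl) (simp add: field_simps)
  also have "\<dots> = (\<Prod>i=1..n. x + ?h - of_nat i) * (x - ?h)"
    by (simp add: field_simps)
  finally have "central_fact (Suc (Suc (Suc n))) x
      = x * ((x + ?h) * ((\<Prod>i=1..n. x + ?h - of_nat i) * (x - ?h)))"
    by (simp only: central_fact.simps)
  also have "\<dots> = central_fact (Suc n) x * ((x + ?h) * (x - ?h))"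
    by (simp only: central_fact.simps mult_ac)
  also have "(x + ?h) * (x - ?h) = x\<^sup>2 - ?h\<^sup>2"
    by (simp add: power2_eq_square algebra_simps)
  finally show ?thesis .
qed

lemma central_fact_even: "central_fact (2 * m) x = (\<Prod>r<m. x\<^sup>2 - (of_nat r)\<^sup>2)"
proof (induction m)
  case (Suc m)
  show ?case
  proof (cases m)
    case 0
    have "central_fact 2 x = x\<^sup>2"
      by (simp add: numeral_2_eq_2 power2_eq_square)
    thus ?thesis using 0 by simp
  next
    case (Suc m')
    have "central_fact (2 * Suc m) x
        = central_fact (Suc (Suc (2 * m'))) x * (x\<^sup>2 - ((of_nat (Suc (2 * m')) + 1) / 2)\<^sup>2)"
      unfolding central_fact_step[symmetric] by (simp add: Suc del: central_fact.simps)
    also have "central_fact (Suc (Suc (2 * m'))) x = (\<Prod>r<m. x\<^sup>2 - (of_nat r)\<^sup>2)"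
      using Suc.IH by (simp add: Suc del: central_fact.simps)
    also have "(of_nat (Suc (2 * m')) + 1) / 2 = (of_nat m :: complex)"
      by (simp add: Suc field_simps)
    finally show ?thesis by simp
  qed
qed simp

text \<open>The source of the half-integer factors in \<open>d\<close>: only odd degrees survive the
  difference of odd order.\<close>

lemma central_fact_odd:
  "central_fact (Suc (2 * m)) x = x * (\<Prod>r=1..m. x\<^sup>2 - (of_nat r - 1/2)\<^sup>2)"
proof (induction m)
  case (Suc m)
  have "central_fact (Suc (2 * Suc m)) x
      = central_fact (Suc (2 * m)) x * (x\<^sup>2 - ((of_nat (2 * m) + 1) / 2)\<^sup>2)"
    unfolding central_fact_step[symmetric] by (simp del: central_fact.simps)
  also have "(of_nat (2 * m) + 1) / 2 = (of_nat (Suc m) - 1 / 2 :: complex)"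
    by (simp add: field_simps)
  finally show ?case
    using Suc.IH by (simp del: central_fact.simps add: mult.assoc)
qed simp

lemma central_fact_diff:
  "central_fact n (x + 1/2) - central_fact n (x - 1/2) = of_nat n * central_fact (n - 1) x"
proof (cases n)
  case (Suc m)
  show ?thesis
  proof (cases m)
    case 0
    thus ?thesis using Suc by simp
  next
    case (Suc l)
    \<comment> \<open>The overlap of the two shifted products; each has just one further factor, at
      opposite ends.\<close>
    define Q where "Q = (\<Prod>i=1..l. x + (of_nat l + 1) / 2 - of_nat i)"
    have "(\<Prod>i=1..Suc l. x + 1/2 + (of_nat (Suc l) + 1) / 2 - of_nat i)
        = (x + 1/2 + (of_nat (Suc l) + 1) / 2 - 1)
          * (\<Prod>i=Suc 1..Suc l. x + 1/2 + (of_nat (Suc l) + 1) / 2 - of_nat i)"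
      by (subst prod.atLeast_Suc_atMost) auto
    also have "(\<Prod>i=Suc 1..Suc l. x + 1/2 + (of_nat (Suc l) + 1) / 2 - of_nat i) = Q"
      unfolding Q_def prod.atLeast_Suc_atMost_Suc_shift
      by (intro prod.cong refl) (simp add: field_simps)
    also have "x + 1/2 + (of_nat (Suc l) + 1) / 2 - 1 = x + (of_nat l + 1) / 2"
      by (simp add: field_simps)
    finally have 1: "(\<Prod>i=1..Suc l. x + 1/2 + (of_nat (Suc l) + 1) / 2 - of_nat i)
        = (x + (of_nat l + 1) / 2) * Q" .
    have "(\<Prod>i=1..Suc l. x - 1/2 + (of_nat (Suc l) + 1) / 2 - of_nat i)
        = (\<Prod>i=1..l. x - 1/2 + (of_nat (Suc l) + 1) / 2 - of_nat i)
          * (x - 1/2 + (of_nat (Suc l) + 1) / 2 - of_nat (Suc l))"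
      by simp
    also have "(\<Prod>i=1..l. x - 1/2 + (of_nat (Suc l) + 1) / 2 - of_nat i) = Q"
      unfolding Q_def by (intro prod.cong refl) (simp add: field_simps)
    also have "x - 1/2 + (of_nat (Suc l) + 1) / 2 - of_nat (Suc l) = x - (of_nat l + 1) / 2"
      by (simp add: field_simps)
    finally have 2: "(\<Prod>i=1..Suc l. x - 1/2 + (of_nat (Suc l) + 1) / 2 - of_nat i)
        = (x - (of_nat l + 1) / 2) * Q"
      by (simp only: mult.commute)
    have "central_fact n (x + 1/2) - central_fact n (x - 1/2)
        = (x + 1/2) * ((x + (of_nat l + 1) / 2) * Q) - (x - 1/2) * ((x - (of_nat l + 1) / 2) * Q)"
      unfolding \<open>n = Suc m\<close> Suc central_fact.simps 1 2 ..
    also have "\<dots> = of_nat n * (x * Q)"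
      unfolding \<open>n = Suc m\<close> Suc by (simp add: field_simps)
    also have "x * Q = central_fact (n - 1) x"
      unfolding \<open>n = Suc m\<close> Suc by (simp add: Q_def)
    finally show ?thesis .
  qed
qed simp

text \<open>Pascal's rule: a difference of order \<open>Suc M\<close> is one of order
  \<open>M\<close> applied to first differences.\<close>

lemma alternating_binomial_sum_Suc:
  fixes h :: "nat \<Rightarrow> complex"
  shows "(\<Sum>r\<le>Suc M. (-1) ^ r * of_nat (Suc M choose r) * h r)
    = (\<Sum>r\<le>M. (-1) ^ r * of_nat (M choose r) * (h r - h (Suc r)))"
proof -
  have "(\<Sum>r\<le>Suc M. (-1) ^ r * of_nat (Suc M choose r) * h r)
      = h 0 + (\<Sum>r\<le>M. (-1) ^ Suc r * of_nat (M choose Suc r) * h (Suc r))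
        + (\<Sum>r\<le>M. (-1) ^ Suc r * of_nat (M choose r) * h (Suc r))"
    unfolding sum.atMost_Suc_shift by (simp add: algebra_simps sum.distrib sum_negf sum_subtractf)
  also have "h 0 + (\<Sum>r\<le>M. (-1) ^ Suc r * of_nat (M choose Suc r) * h (Suc r))
      = (\<Sum>r\<le>Suc M. (-1) ^ r * of_nat (M choose r) * h r)"
    unfolding sum.atMost_Suc_shift by simp
  also have "\<dots> = (\<Sum>r\<le>M. (-1) ^ r * of_nat (M choose r) * h r)"
    by (simp add: binomial_eq_0)
  finally show ?thesis
    by (simp add: right_diff_distrib sum_subtractf sum_negf)
qed

lemma falling_Suc_shift: "falling a (Suc k) = a * falling (a - 1) k"
  unfolding falling_def prod.lessThan_Suc_shift by (simp add: algebra_simps)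

lemma falling_of_nat_eq_0:
  assumes "n < k"
  shows "falling (of_nat n) k = (0 :: 'a::comm_ring_1)"
proof -
  have "falling (of_nat n) k = (of_nat n - of_nat n) * (\<Prod>i\<in>{..<k}-{n}. of_nat n - of_nat i :: 'a)"
    unfolding falling_def using assms by (subst prod.remove[of _ n]) auto
  thus ?thesis by simp
qed

text \<open>Iteration of \<open>central_fact_diff\<close> on a grid centred at \<open>x\<close>.
  Weights alternate starting with + at the leftmost node, whence \<open>(-1) ^ M\<close>. For
  \<open>n < M\<close> the truncated \<open>n - M\<close> is harmless, since the falling factorial
  is 0.\<close>

lemma central_fact_alternating_sum:
  "(\<Sum>r\<le>M. (-1) ^ r * of_nat (M choose r) * central_fact n (x + of_nat r - of_nat M / 2))
    = (-1) ^ M * falling (of_nat n) M * central_fact (n - M) x"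
proof (induction M arbitrary: n)
  case (Suc M)
  have "(\<Sum>r\<le>Suc M. (-1) ^ r * of_nat (Suc M choose r)
        * central_fact n (x + of_nat r - of_nat (Suc M) / 2))
      = (\<Sum>r\<le>M. (-1) ^ r * of_nat (M choose r)
          * (- of_nat n * central_fact (n - 1) (x + of_nat r - of_nat M / 2)))"
  proof (subst alternating_binomial_sum_Suc, rule sum.cong[OF refl])
    fix r
    have "x + of_nat r - of_nat (Suc M) / 2 = x + of_nat r - of_nat M / 2 - 1 / 2"
      "x + of_nat (Suc r) - of_nat (Suc M) / 2 = x + of_nat r - of_nat M / 2 + 1 / 2"
      by (simp_all add: field_simps)
    thus "(-1) ^ r * of_nat (M choose r) * (central_fact n (x + of_nat r - of_nat (Suc M) / 2)
          - central_fact n (x + of_nat (Suc r) - of_nat (Suc M) / 2))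
      = (-1) ^ r * of_nat (M choose r)
          * (- of_nat n * central_fact (n - 1) (x + of_nat r - of_nat M / 2))"
      using central_fact_diff[of n "x + of_nat r - of_nat M / 2"]
      by (metis minus_diff_eq mult_minus_left)
  qed
  also have "\<dots> = - of_nat n * (\<Sum>r\<le>M. (-1) ^ r * of_nat (M choose r)
          * central_fact (n - 1) (x + of_nat r - of_nat M / 2))"
    unfolding sum_distrib_left by (intro sum.cong refl) (simp add: mult_ac)
  also have "\<dots> = - of_nat n * ((-1) ^ M * falling (of_nat (n - 1)) M * central_fact (n - 1 - M) x)"
    unfolding Suc.IH ..
  also have "\<dots> = (-1) ^ Suc M * falling (of_nat n) (Suc M) * central_fact (n - Suc M) x"
  proof (cases n)
    case 0
    thus ?thesis by (simp add: falling_Suc_shift)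
  next
    case (Suc m)
    thus ?thesis by (simp add: falling_Suc_shift algebra_simps)
  qed
  finally show ?case .
qed (simp add: falling_def)


section \<open>Factorial form of the coefficients g_k(j)\<close>

lemma falling_of_nat:
  assumes "k \<le> n"
  shows "falling (of_nat n) k = (fact n / fact (n - k) :: complex)"
  using assms
proof (induction k arbitrary: n)
  case (Suc k)
  then obtain m where n: "n = Suc m" by (cases n) auto
  thus ?case using Suc.IH[of m] Suc.prems by (simp add: falling_Suc_shift)
qed (simp add: falling_def)

text \<open>The missing even factors 2j+2, ..., 2j+2k multiply to 2^k (j+k)!/j! and complete the
  product to a quotient of factorials.\<close>

lemma rising2_odd:
  "rising2 (2 * of_nat j + 1) k * (fact (2 * j) * 2 ^ k * fact (j + k))
    = (fact (2 * j + 2 * k) * fact j :: complex)"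
proof (induction k)
  case (Suc k)
  have "rising2 (2 * of_nat j + 1) (Suc k) * (fact (2 * j) * 2 ^ Suc k * fact (j + Suc k))
      = (rising2 (2 * of_nat j + 1) k * (fact (2 * j) * 2 ^ k * fact (j + k)))
        * ((2 * of_nat j + 1 + 2 * of_nat k) * (2 * (of_nat j + of_nat k + 1)) :: complex)"
    by (simp add: rising2_def algebra_simps)
  also have "\<dots> = fact (2 * j + 2 * Suc k) * fact j"
    unfolding Suc.IH by (simp add: algebra_simps)
  finally show ?case .
qed (simp add: rising2_def)

lemma double_fact_odd: "double_fact (2 * k + 1) * (2 ^ k * fact k) = fact (2 * k + 1)"
proof (induction k)
  case (Suc k)
  have "double_fact (2 * Suc k + 1) * (2 ^ Suc k * fact (Suc k))
      = (2 * k + 3) * (2 * k + 2) * (double_fact (2 * k + 1) * (2 ^ k * fact k))"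
    by (simp add: algebra_simps)
  also have "\<dots> = fact (2 * Suc k + 1)"
    unfolding Suc.IH by (simp add: algebra_simps)
  finally show ?case .
qed simp

text \<open>With factorials only, the comparison of coefficients becomes cancellation. The formula
  for positive \<open>k\<close> also gives 1 at \<open>k = 0\<close>, so both cases merge.\<close>

lemma g_coeff_eq:
  assumes "k \<le> j"
  shows "g_coeff k j = (-1) ^ k * (fact j)\<^sup>2 * fact (2 * j + 2 * k)
    / (fact (j - k) * fact (j + k) * fact (2 * j) * fact (2 * k + 1))"
proof -
  have "g_coeff k j = (-1) ^ k * (falling (of_nat j) k * rising2 (2 * of_nat j + 1) k)
       / (fact k * of_nat (double_fact (2 * k + 1)))"
    by (cases "k = 0") (simp_all add: g_coeff_def falling_def rising2_def)
  also have "rising2 (2 * of_nat j + 1) k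
      = (fact (2 * j + 2 * k) * fact j / (fact (2 * j) * 2 ^ k * fact (j + k)) :: complex)"
    using rising2_odd[of j k] by (simp add: field_simps)
  also have "of_nat (double_fact (2 * k + 1)) = (fact (2 * k + 1) / (2 ^ k * fact k) :: complex)"
  proof -
    have "of_nat (double_fact (2 * k + 1) * (2 ^ k * fact k)) = (fact (2 * k + 1) :: complex)"
      unfolding double_fact_odd by (simp only: of_nat_fact)
    thus ?thesis by (simp add: eq_divide_eq)
  qed
  finally show ?thesis
    using assms by (simp add: falling_of_nat power2_eq_square field_simps del: fact_Suc)
qed

text \<open>The left side is the numerical part of the summand with n = j + k once the difference is
  taken. The final 2 is compensated by the binomial coefficient on the right being half of the
  central one.\<close>

lemma coefficient_match:
  assumes "k \<le> j" "j > 0"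
  shows "(-1) ^ (j + k) * of_nat ((2 * j) choose (j + k))
      * ((-1) ^ (2 * j - 1) * falling (of_nat (2 * (j + k))) (2 * j - 1))
    = fact (2 * j) * ((-1) ^ (j - 1) * of_nat ((2 * j - 1) choose j)) * (g_coeff k j * 2)"
proof -
  obtain i where i: "j = Suc i" using assms(2) by (cases j) auto
  have "2 * ((2 * j - 1) choose j) = (2 * j) choose j"
  proof -
    have "(2 * j - 1) choose (j - 1) = (2 * j - 1) choose j"
      using binomial_symmetric[of j "2 * j - 1"] assms by simp
    thus ?thesis using i by simp
  qed
  hence "2 * of_nat ((2 * j - 1) choose j) = (of_nat ((2 * j) choose j) :: complex)"
    by (metis of_nat_mult of_nat_numeral)
  also have "\<dots> = fact (2 * j) / (fact j * fact j)"
    by (subst binomial_fact) (simp_all add: mult_2)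
  finally have b1: "of_nat ((2 * j - 1) choose j) = (fact (2 * j) / (fact j * fact j) / 2 :: complex)"
    by (simp add: field_simps)
  have b2: "of_nat ((2 * j) choose (j + k)) = (fact (2 * j) / (fact (j + k) * fact (j - k)) :: complex)"
    using assms by (subst binomial_fact) (simp_all add: mult_2)
  have f: "falling (of_nat (2 * (j + k))) (2 * j - 1)
      = (fact (2 * j + 2 * k) / fact (2 * k + 1) :: complex)"
    using assms by (subst falling_of_nat) (simp_all add: algebra_simps Suc_diff_le)
  have s: "(-1) ^ (j + k) * (-1) ^ (2 * j - 1) = ((-1) ^ (j - 1) * (-1) ^ k :: complex)"
    unfolding i by (simp add: power_add)
  have "(-1) ^ (j + k) * of_nat ((2 * j) choose (j + k))
      * ((-1) ^ (2 * j - 1) * falling (of_nat (2 * (j + k))) (2 * j - 1))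
    = ((-1) ^ (j + k) * (-1) ^ (2 * j - 1)) * (of_nat ((2 * j) choose (j + k))
      * falling (of_nat (2 * (j + k))) (2 * j - 1) :: complex)"
    by (simp only: mult_ac)
  also have "\<dots> = fact (2 * j) * ((-1) ^ (j - 1) * of_nat ((2 * j - 1) choose j)) * (g_coeff k j * 2)"
    unfolding s b1 b2 f g_coeff_eq[OF assms(1)]
    by (simp add: power2_eq_square field_simps del: fact_Suc)
  finally show ?thesis .
qed

lemma alternating_sum_evaluation:
  fixes d e :: complex
  assumes "j > 0"
  shows "(\<Sum>r\<le>2*j-1. (-1) ^ r * of_nat ((2 * j - 1) choose r)
      * (\<Prod>i<2*j. e - d - of_nat r + of_nat i) * (\<Prod>i<2*j. e + d + of_nat r - of_nat i))
    = fact (2 * j) * ((-1) ^ (j - 1) * of_nat ((2 * j - 1) choose j) *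
    (\<Sum>k=0..j. g_coeff k j * (2 * d)
       * (\<Prod>r=1..k. d\<^sup>2 - (of_nat r - 1/2)\<^sup>2)
       * (\<Prod>r=k+1..j. e\<^sup>2 - (of_nat r - 1/2)\<^sup>2)))"
proof -
  define M where "M = 2 * j - 1"
  have M: "2 * j = Suc M" using assms by (simp add: M_def)
  have M': "of_nat M = (2 * of_nat j - 1 :: complex)"
    using arg_cong[OF M, of "of_nat :: nat \<Rightarrow> complex"] by simp
  \<comment> \<open>Chosen so that the paired factors become \<open>a + of_nat i - ?D\<close> and
    \<open>a + of_nat i + ?D\<close>, with \<open>r\<close> occurring in \<open>?D\<close>
    alone.\<close>
  define a where "a = e - of_nat j + 1/2"
  define W where "W n = (\<Prod>i<2*j-n. a + of_nat i) * (\<Prod>i=n..<2*j. a + of_nat i)" for n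
  define S where "S n = (-1) ^ n * of_nat ((2 * j) choose n) * W n
     * ((-1) ^ M * falling (of_nat (2 * n)) M * central_fact (2 * n - M) d)" for n
  have "(\<Prod>i<2*j. e - d - of_nat r + of_nat i) * (\<Prod>i<2*j. e + d + of_nat r - of_nat i)
      = (\<Sum>n\<le>2*j. (-1) ^ n * of_nat ((2 * j) choose n) * W n
          * central_fact (2 * n) (d + of_nat r - of_nat M / 2))" (is "?L = ?R") for r
  proof -
    let ?D = "d + of_nat r - of_nat M / 2"
    \<comment> \<open>Reversing this product pairs its factors with those of the other one.\<close>
    have "(\<Prod>i<2*j. e + d + of_nat r - of_nat i)
        = (\<Prod>i<2*j. e + d + of_nat r - of_nat (2 * j - Suc i))"
      by (rule prod.nat_diff_reindex[symmetric])
    also have "\<dots> = (\<Prod>i<2*j. a + of_nat i + ?D)"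
    proof (intro prod.cong refl)
      fix i assume "i \<in> {..<2*j}"
      hence eq: "of_nat (2 * j - Suc i) = (2 * of_nat j - of_nat i - 1 :: complex)"
        by (subst of_nat_diff) auto
      show "e + d + of_nat r - of_nat (2 * j - Suc i) = a + of_nat i + ?D"
        unfolding eq a_def M' by (simp add: field_simps)
    qed
    finally have 1: "(\<Prod>i<2*j. e + d + of_nat r - of_nat i) = (\<Prod>i<2*j. a + of_nat i + ?D)" .
    have 2: "(\<Prod>i<2*j. e - d - of_nat r + of_nat i) = (\<Prod>i<2*j. a + of_nat i - ?D)"
      by (intro prod.cong refl) (simp add: a_def M' field_simps)
    have "?L = (\<Prod>i<2*j. (a + of_nat i)\<^sup>2 - ?D\<^sup>2)"
      unfolding 1 2 prod.distrib[symmetric]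
      by (simp only: power2_eq_square square_diff_square_factored mult.commute)
    also have "\<dots> = (\<Sum>n\<le>2*j. of_nat ((2 * j) choose n) * (\<Prod>r<n. (of_nat r)\<^sup>2 - ?D\<^sup>2)
       * (\<Prod>i<2*j-n. a + of_nat i) * (\<Prod>i=n..<2*j. a + of_nat i))"
      by (rule pfaff_saalschuetz)
    also have "\<dots> = ?R"
    proof (rule sum.cong[OF refl])
      fix n
      have "(\<Prod>r<n. (of_nat r)\<^sup>2 - ?D\<^sup>2) = (\<Prod>r<n. (-1) * (?D\<^sup>2 - (of_nat r)\<^sup>2))"
        by (intro prod.cong refl) simp
      also have "\<dots> = (-1) ^ n * central_fact (2 * n) ?D"
        by (simp add: prod.distrib central_fact_even del: mult_minus_left mult_minus1)
      finally show "of_nat ((2 * j) choose n) * (\<Prod>r<n. (of_nat r)\<^sup>2 - ?D\<^sup>2)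
          * (\<Prod>i<2*j-n. a + of_nat i) * (\<Prod>i=n..<2*j. a + of_nat i)
        = (-1) ^ n * of_nat ((2 * j) choose n) * W n * central_fact (2 * n) ?D"
        by (simp only: W_def mult_ac)
    qed
    finally show ?thesis .
  qed
  hence "(\<Sum>r\<le>2*j-1. (-1) ^ r * of_nat ((2 * j - 1) choose r)
      * (\<Prod>i<2*j. e - d - of_nat r + of_nat i) * (\<Prod>i<2*j. e + d + of_nat r - of_nat i))
    = (\<Sum>r\<le>M. \<Sum>n\<le>2*j. (-1) ^ n * of_nat ((2 * j) choose n) * W n
        * ((-1) ^ r * of_nat (M choose r) * central_fact (2 * n) (d + of_nat r - of_nat M / 2)))"
    unfolding M_def[symmetric] mult.assoc by (simp only: sum_distrib_left mult_ac)
  also have "\<dots> = (\<Sum>n\<le>2*j. S n)"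
    by (subst sum.swap, rule sum.cong[OF refl]) (simp only: S_def sum_distrib_left[symmetric] central_fact_alternating_sum)
  \<comment> \<open>For \<open>n < j\<close> the degree \<open>2 * n\<close> is at most 2j-2, below
    the order \<open>M\<close> of the difference.\<close>
  also have "\<dots> = (\<Sum>n\<in>{j..2*j}. S n)"
  proof (rule sum.mono_neutral_right)
    show "\<forall>n\<in>{..2 * j} - {j..2 * j}. S n = 0"
    proof
      fix n assume "n \<in> {..2 * j} - {j..2 * j}"
      hence "2 * n < M" using M by auto
      thus "S n = 0" unfolding S_def by (simp only: falling_of_nat_eq_0 mult_zero_left mult_zero_right)
    qed
  qed auto
  also have "\<dots> = (\<Sum>k=0..j. S (j + k))"
    by (rule sum.reindex_bij_witness[where i = "\<lambda>k. j + k" and j = "\<lambda>n. n - j"]) auto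
  also have "\<dots> = (\<Sum>k=0..j. fact (2 * j) * ((-1) ^ (j - 1) * of_nat ((2 * j - 1) choose j))
      * (g_coeff k j * (2 * d) * (\<Prod>r=1..k. d\<^sup>2 - (of_nat r - 1/2)\<^sup>2)
       * (\<Prod>r=k+1..j. e\<^sup>2 - (of_nat r - 1/2)\<^sup>2)))"
  proof (rule sum.cong[OF refl])
    fix k assume "k \<in> {0..j}"
    hence k: "k \<le> j" by simp
    have "2 * (j + k) - M = Suc (2 * k)" using M by simp
    hence cf: "central_fact (2 * (j + k) - M) d = d * (\<Prod>r=1..k. d\<^sup>2 - (of_nat r - 1/2)\<^sup>2)"
      using central_fact_odd by simp
    have w1: "(\<Prod>i<2*j-(j+k). a + of_nat i) = (\<Prod>r=k+1..j. e - (of_nat r - 1/2))"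
      by (rule prod.reindex_bij_witness[where i = "\<lambda>r. j - r" and j = "\<lambda>i. j - i"])
        (use k in \<open>auto simp: a_def of_nat_diff\<close>)
    have w2: "(\<Prod>i=j+k..<2*j. a + of_nat i) = (\<Prod>r=k+1..j. e + (of_nat r - 1/2))"
      by (rule prod.reindex_bij_witness[where i = "\<lambda>r. r + j - 1" and j = "\<lambda>i. i + 1 - j"])
        (use k in \<open>auto simp: a_def of_nat_diff\<close>)
    \<comment> \<open>At n = j + k the two ranges of \<open>i\<close> lie symmetrically about the
      centre, so their factors combine to differences of squares.\<close>
    have w: "W (j + k) = (\<Prod>r=k+1..j. e\<^sup>2 - (of_nat r - 1/2)\<^sup>2)"
      unfolding W_def w1 w2 prod.distrib[symmetric]
      by (simp only: power2_eq_square square_diff_square_factored mult.commute)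
    have "S (j + k) = ((-1) ^ (j + k) * of_nat ((2 * j) choose (j + k))
      * ((-1) ^ (2 * j - 1) * falling (of_nat (2 * (j + k))) (2 * j - 1)))
      * (d * (\<Prod>r=1..k. d\<^sup>2 - (of_nat r - 1/2)\<^sup>2) * (\<Prod>r=k+1..j. e\<^sup>2 - (of_nat r - 1/2)\<^sup>2))"
      unfolding S_def w cf unfolding M_def by (simp only: mult_ac)
    thus "S (j + k) = fact (2 * j) * ((-1) ^ (j - 1) * of_nat ((2 * j - 1) choose j))
      * (g_coeff k j * (2 * d) * (\<Prod>r=1..k. d\<^sup>2 - (of_nat r - 1/2)\<^sup>2)
       * (\<Prod>r=k+1..j. e\<^sup>2 - (of_nat r - 1/2)\<^sup>2))"
      unfolding coefficient_match[OF k assms] by (simp only: mult_ac)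
  qed
  finally show ?thesis by (simp only: sum_distrib_left mult.assoc)
qed

section \<open>Characters of rectangles\<close>

lemma level_group_cong:
  assumes "\<And>m. m < n \<Longrightarrow> h m = h' m"
  shows "level_group n h = level_group n h'"
  using assms by (auto simp: level_group_def permutes_lessThan_less)

lemma tab_row_rect:
  assumes "m < p * q"
  shows "tab_row (replicate p q) m = m div q"
proof -
  have q: "q > 0" using assms by (cases q) auto
  have sum: "sum_list (take (Suc i) (replicate p q)) = min (Suc i) p * q" for i
    by (simp add: sum_list_replicate min_def)
  have mp: "m div q < p" using assms by (simp add: less_mult_imp_div_less)
  show ?thesis
    unfolding tab_row_def sum
  proof (rule Least_equality)
    have "m < Suc (m div q) * q" using dividend_less_div_times[OF q, of m] by simp
    thus "m < min (Suc (m div q)) p * q" using assms by (simp add: min_def)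
    fix i assume "m < min (Suc i) p * q"
    also have "\<dots> \<le> Suc i * q" by (intro mult_le_mono1) simp
    finally have "m < Suc i * q" .
    hence "m div q < Suc i" by (rule less_mult_imp_div_less)
    thus "m div q \<le> i" by simp
  qed
qed

lemma tab_col_rect:
  assumes "m < p * q"
  shows "tab_col (replicate p q) m = m mod q"
proof -
  have "m div q < p" using assms by (simp add: less_mult_imp_div_less)
  thus ?thesis
    unfolding tab_col_def tab_row_rect[OF assms]
    by (simp add: sum_list_replicate min_def minus_div_mult_eq_mod)
qed

lemma young_symmetrizer_rect:
  "young_symmetrizer (replicate p q) = symmetrizer (p * q) (\<lambda>m. m div q) (\<lambda>m. m mod q)"
proof -
  have "level_group (p * q) (tab_row (replicate p q)) = level_group (p * q) (\<lambda>m. m div q)"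
    "level_group (p * q) (tab_col (replicate p q)) = level_group (p * q) (\<lambda>m. m mod q)"
    by (simp_all add: tab_row_rect tab_col_rect cong: level_group_cong)
  thus ?thesis by (simp add: young_symmetrizer_eq symmetrizer_def sum_list_replicate)
qed

text \<open>All rows have full length \<open>q\<close>, so a cell can stay in its row and take over
  the column of its image under \<open>g\<close>; this is the row permutation required by
  \<open>factor\<close>.\<close>

lemma shape_rect:
  assumes q: "q > 0"
  shows "shape (p * q) (\<lambda>m. m div q) (\<lambda>m. m mod q)"
proof
  fix a b :: nat assume "a div q = b div q" "a mod q = b mod q"
  thus "a = b" by (metis div_mult_mod_eq)
next
  fix g assume g: "g permutes {..<p * q}"
    and sep: "\<And>a b. a < p * q \<Longrightarrow> b < p * q \<Longrightarrow> a \<noteq> b \<Longrightarrow> a div q = b div q \<Longrightarrow>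
      g a mod q \<noteq> g b mod q"
  define s where "s m = (if m < p * q then (m div q) * q + g m mod q else m)" for m
  have row: "s m div q = m div q" and col: "s m mod q = g m mod q" if "m < p * q" for m
    using that q by (simp_all add: s_def)
  have "s permutes {..<p * q}"
  proof (rule inj_imp_permutes)
    show "inj_on s {..<p * q}"
    proof (rule inj_onI)
      fix a b assume ab: "a \<in> {..<p * q}" "b \<in> {..<p * q}" "s a = s b"
      have "a div q = b div q" "g a mod q = g b mod q"
        using ab row[of a] row[of b] col[of a] col[of b] by simp_all
      thus "a = b" using sep[of a b] ab by auto
    qed
    show "s m \<in> {..<p * q}" if "m \<in> {..<p * q}" for m
    proof -
      have "s m div q < p" using row[of m] that by (simp add: less_mult_imp_div_less)
      thus ?thesis using q by (simp add: div_less_iff_less_mult)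
    qed
  qed (auto simp: s_def)
  hence "s \<in> level_group (p * q) (\<lambda>m. m div q)"
    using row by (simp add: level_group_def)
  moreover have "\<forall>m<p * q. g m mod q = s m mod q" using col by simp
  ultimately show "\<exists>s\<in>level_group (p * q) (\<lambda>m. m div q). \<forall>m<p * q. g m mod q = s m mod q"
    by blast
qed

text \<open>
  The contribution to a character value of the labelling \<open>f\<close> of \<open>{..<k}\<close> by cells: the signed number
  of factorizations \<open>g = s \<circ> t\<close> with \<open>s\<close> preserving the rows and \<open>t\<close> the columns of \<open>f\<close>.
\<close>

definition labelling_weight ::
    "nat \<Rightarrow> (nat \<Rightarrow> nat) \<Rightarrow> (nat \<Rightarrow> nat) \<Rightarrow> (nat \<Rightarrow> nat) \<Rightarrow> (nat \<Rightarrow> nat) \<Rightarrow> complex" where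
  "labelling_weight k row col g f = (\<Sum>s | s permutes {..<k}.
     if (\<forall>i<k. row (f (s i)) = row (f i)) \<and> (\<forall>i<k. col (f ((inv s \<circ> g) i)) = col (f i))
     then of_int (sign (inv s \<circ> g)) else 0)"

lemma labelling_weight_cong:
  assumes "g permutes {..<k}" "\<And>i. i < k \<Longrightarrow> f i = f' i"
  shows "labelling_weight k row col g f = labelling_weight k row col g f'"
  unfolding labelling_weight_def
proof (intro sum.cong refl)
  fix s assume "s \<in> {s. s permutes {..<k}}"
  hence s: "s permutes {..<k}" "inv s \<circ> g permutes {..<k}"
    using assms by (auto intro: permutes_compose permutes_inv)
  have "f (s i) = f' (s i)" "f ((inv s \<circ> g) i) = f' ((inv s \<circ> g) i)" if "i < k" for i
    using that assms(2) permutes_lessThan_less[OF s(1)] permutes_lessThan_less[OF s(2)] by auto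
  hence "((\<forall>i<k. row (f (s i)) = row (f i)) \<and> (\<forall>i<k. col (f ((inv s \<circ> g) i)) = col (f i)))
      = ((\<forall>i<k. row (f' (s i)) = row (f' i)) \<and> (\<forall>i<k. col (f' ((inv s \<circ> g) i)) = col (f' i)))"
    using assms(2) by simp
  thus "(if (\<forall>i<k. row (f (s i)) = row (f i)) \<and> (\<forall>i<k. col (f ((inv s \<circ> g) i)) = col (f i))
      then of_int (sign (inv s \<circ> g)) else 0)
    = (if (\<forall>i<k. row (f' (s i)) = row (f' i)) \<and> (\<forall>i<k. col (f' ((inv s \<circ> g) i)) = col (f' i))
      then of_int (sign (inv s \<circ> g)) else (0::complex))"
    by (simp only:)
qed

text \<open>\<open>f\<close> cannot tell \<open>a\<close> from \<open>b\<close>, so composing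
  \<open>s\<close> with their transposition keeps both conditions and reverses the sign.\<close>

lemma labelling_weight_not_inj:
  assumes g: "g permutes {..<k}" and ab: "a < k" "b < k" "a \<noteq> b" "f a = f b"
  shows "labelling_weight k row col g f = 0"
proof -
  let ?\<tau> = "transpose a b"
  define F :: "(nat \<Rightarrow> nat) \<Rightarrow> complex" where "F s =
    (if (\<forall>i<k. row (f (s i)) = row (f i)) \<and> (\<forall>i<k. col (f ((inv s \<circ> g) i)) = col (f i))
     then of_int (sign (inv s \<circ> g)) else 0)" for s
  have \<tau>: "?\<tau> permutes {..<k}" using ab by (simp add: permutes_swap_id)
  have f\<tau>: "f (?\<tau> i) = f i" for i using ab(4) by (auto simp: transpose_def)
  have neg: "F (s \<circ> ?\<tau>) = - F s" if s: "s permutes {..<k}" for s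
  proof -
    have isg: "inv s \<circ> g permutes {..<k}" using g s by (auto intro: permutes_compose permutes_inv)
    have inv: "inv (s \<circ> ?\<tau>) \<circ> g = ?\<tau> \<circ> (inv s \<circ> g)"
      by (simp add: permutes_inv_comp[OF s \<tau>] comp_assoc)
    have "sign (?\<tau> \<circ> (inv s \<circ> g)) = - sign (inv s \<circ> g)"
      using sign_permutes_comp[OF \<tau> isg] ab by (simp add: sign_swap_id)
    moreover have "(\<forall>i<k. row (f ((s \<circ> ?\<tau>) i)) = row (f i)) \<longleftrightarrow> (\<forall>i<k. row (f (s i)) = row (f i))"
    proof (intro iffI allI impI)
      fix i assume *: "\<forall>i<k. row (f ((s \<circ> ?\<tau>) i)) = row (f i)" and i: "i < k"
      have "?\<tau> i < k" using permutes_lessThan_less[OF \<tau>] i by simp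
      from *[rule_format, OF this] show "row (f (s i)) = row (f i)" by (simp add: f\<tau>)
    next
      fix i assume *: "\<forall>i<k. row (f (s i)) = row (f i)" and i: "i < k"
      have "?\<tau> i < k" using permutes_lessThan_less[OF \<tau>] i by simp
      from *[rule_format, OF this] show "row (f ((s \<circ> ?\<tau>) i)) = row (f i)" by (simp add: f\<tau>)
    qed
    moreover have "f ((?\<tau> \<circ> (inv s \<circ> g)) i) = f ((inv s \<circ> g) i)" for i
      by (simp add: f\<tau>)
    ultimately show ?thesis unfolding F_def inv by simp
  qed
  have "labelling_weight k row col g f = (\<Sum>s | s permutes {..<k}. F s)"
    by (simp add: labelling_weight_def F_def)
  also have "\<dots> = (\<Sum>s | s permutes {..<k}. F (s \<circ> ?\<tau>))"
    by (rule sum_permutations_compose_right[OF \<tau>])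
  also have "\<dots> = - (\<Sum>s | s permutes {..<k}. F s)"
    using neg by (simp add: sum_negf)
  finally show ?thesis by (simp add: labelling_weight_def F_def)
qed

text \<open>Factorizations of the conjugate by \<open>x\<close> are pulled back to factorizations of
  \<open>g\<close>. The point is that both factors then live on \<open>{..<k}\<close>, so only the
  first \<open>k\<close> cells matter.\<close>

lemma (in shape) Y_conj:
  assumes x: "x permutes {..<n}" and g: "g permutes {..<k}" and kn: "k \<le> n"
  shows "Y (x \<circ> g \<circ> inv x) = labelling_weight k row col g x"
proof -
  have ix: "inv x permutes {..<n}" using x by (rule permutes_inv)
  have sub: "s permutes {..<n}" if "s permutes {..<k}" for s
    using that kn by (auto intro: permutes_subset)
  note xi = permutes_inverses[OF x]
  have canc: "x \<circ> (inv x \<circ> u) = u" "inv x \<circ> (x \<circ> u) = u" for u :: "nat \<Rightarrow> nat"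
    by (rule permutes_comp_left_cancel[OF x])+
  define P where "P = {(s, t) \<in> level_group n row \<times> level_group n col. x \<circ> g \<circ> inv x = s \<circ> t}"
  define Q where "Q = {s. s permutes {..<k} \<and> (\<forall>i<k. row (x (s i)) = row (x i))
    \<and> (\<forall>i<k. col (x ((inv s \<circ> g) i)) = col (x i))}"
  have "Y (x \<circ> g \<circ> inv x) = (\<Sum>(s, t)\<in>level_group n row \<times> level_group n col.
      if x \<circ> g \<circ> inv x = s \<circ> t then of_int (sign t) else 0)"
    by (simp add: symmetrizer_def sum.cartesian_product)
  also have "\<dots> = (\<Sum>(s, t)\<in>P. of_int (sign t))"
    by (rule sum.mono_neutral_cong_right) (auto simp: P_def split: if_splits)
  also have "\<dots> = (\<Sum>s\<in>Q. of_int (sign (inv s \<circ> g)))"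
  proof (rule sum.reindex_bij_witness[where j = "\<lambda>(s, t). inv x \<circ> s \<circ> x"
        and i = "\<lambda>s. (x \<circ> s \<circ> inv x, x \<circ> (inv s \<circ> g) \<circ> inv x)"])
    fix a assume "a \<in> P"
    then obtain s t where a: "a = (s, t)" and s: "s \<in> level_group n row"
      and t: "t \<in> level_group n col" and st: "x \<circ> g \<circ> inv x = s \<circ> t"
      by (auto simp: P_def)
    have sp: "s permutes {..<n}" and tp: "t permutes {..<n}"
      using s t by (auto intro: level_group_permutes)
    define s' t' where "s' = inv x \<circ> s \<circ> x" and "t' = inv x \<circ> t \<circ> x"
    have s'p: "s' permutes {..<n}" and t'p: "t' permutes {..<n}"
      using sp tp x ix by (auto simp: s'_def t'_def intro: permutes_compose)
    have "s' \<circ> t' = inv x \<circ> (s \<circ> t) \<circ> x"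
      by (simp add: s'_def t'_def comp_assoc canc)
    also have "\<dots> = g"
      unfolding st[symmetric] by (simp add: comp_assoc canc permutes_inv_o[OF x])
    finally have s't': "s' \<circ> t' = g" .
    have it': "inv s' \<circ> g = t'"
      unfolding s't'[symmetric] by (rule permutes_comp_left_cancel[OF s'p])
    have row': "row (x (s' m)) = row (x m)" if "m < n" for m
      using that level_group_level[OF s, of "x m"] permutes_lessThan_less[OF x]
      by (simp add: s'_def xi)
    have col': "col (x (t' m)) = col (x m)" if "m < n" for m
      using that level_group_level[OF t, of "x m"] permutes_lessThan_less[OF x]
      by (simp add: t'_def xi)
    \<comment> \<open>Where \<open>g\<close> is trivial, \<open>s'\<close> must undo
      \<open>t'\<close>: the cells of \<open>m\<close> and \<open>t' m\<close> share a row as well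
      as a column.\<close>
    have fix_t: "t' m = m" if m: "k \<le> m" "m < n" for m
    proof -
      have "s' (t' m) = m"
        using fun_cong[OF s't', of m] permutes_not_in[OF g, of m] m by simp
      hence "row (x (t' m)) = row (x m)"
        using row'[of "t' m"] permutes_lessThan_less[OF t'p] m by simp
      hence "x (t' m) = x m"
        using cell_inj[of "x (t' m)" "x m"] col'[OF m(2)] permutes_lessThan_less[OF t'p]
          permutes_lessThan_less[OF x] m by simp
      thus ?thesis using permutes_inj[OF x] by (auto dest: injD)
    qed
    have fix_s: "s' m = m" if m: "k \<le> m" "m < n" for m
      using fun_cong[OF s't', of m] permutes_not_in[OF g, of m] fix_t[OF m] m by simp
    have s'k: "s' permutes {..<k}"
      by (rule permutes_superset[OF s'p]) (use fix_s in auto)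
    have "\<forall>i<k. col (x ((inv s' \<circ> g) i)) = col (x i)"
      unfolding it' using col' kn by simp
    thus "(case a of (s, t) \<Rightarrow> inv x \<circ> s \<circ> x) \<in> Q"
      unfolding a prod.case s'_def[symmetric] Q_def using s'k row' kn by simp
    have "x \<circ> s' \<circ> inv x = s" "x \<circ> t' \<circ> inv x = t"
      by (simp_all add: s'_def t'_def comp_assoc canc permutes_inv_o[OF x])
    thus "(\<lambda>s. (x \<circ> s \<circ> inv x, x \<circ> (inv s \<circ> g) \<circ> inv x)) (case a of (s, t) \<Rightarrow> inv x \<circ> s \<circ> x) = a"
      by (simp add: a it' flip: s'_def)
    have "sign t' = sign t"
      using sign_permutes_comp[OF permutes_compose[OF x tp] ix]
        sign_permutes_comp[OF ix permutes_compose[OF x tp]] sign_permutes_comp[OF tp x]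
        sign_permutes_inv[OF x]
      by (simp add: t'_def comp_assoc)
    thus "of_int (sign (inv (case a of (s, t) \<Rightarrow> inv x \<circ> s \<circ> x) \<circ> g))
        = (case a of (s, t) \<Rightarrow> (of_int (sign t) :: complex))"
      by (simp add: a it' flip: s'_def)
  next
    fix s assume "s \<in> Q"
    hence s: "s permutes {..<k}" and row': "\<And>i. i < k \<Longrightarrow> row (x (s i)) = row (x i)"
      and col': "\<And>i. i < k \<Longrightarrow> col (x ((inv s \<circ> g) i)) = col (x i)" by (auto simp: Q_def)
    show "(case (x \<circ> s \<circ> inv x, x \<circ> (inv s \<circ> g) \<circ> inv x) of (s, t) \<Rightarrow> inv x \<circ> s \<circ> x) = s"
      by (simp add: comp_assoc canc permutes_inv_o[OF x])
    have t: "inv s \<circ> g permutes {..<k}" using s g by (auto intro: permutes_compose permutes_inv)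
    have lev: "x \<circ> u \<circ> inv x \<in> level_group n h"
      if u: "u permutes {..<k}" and hu: "\<And>i. i < k \<Longrightarrow> h (x (u i)) = h (x i)" for u and h :: "nat \<Rightarrow> nat"
    proof -
      have "h (x (u (inv x m))) = h m" for m
        using hu[of "inv x m"] permutes_not_in[OF u, of "inv x m"] xi(1)[of m]
        by (cases "inv x m < k") auto
      thus ?thesis
        using sub[OF u] x ix by (simp add: level_group_def permutes_compose)
    qed
    have "x \<circ> s \<circ> inv x \<circ> (x \<circ> (inv s \<circ> g) \<circ> inv x) = x \<circ> g \<circ> inv x"
      by (simp add: comp_assoc canc permutes_comp_left_cancel[OF s])
    moreover have "x \<circ> (inv s \<circ> g) \<circ> inv x \<in> level_group n col"
      by (rule lev[OF t col'])
    ultimately show "(x \<circ> s \<circ> inv x, x \<circ> (inv s \<circ> g) \<circ> inv x) \<in> P"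
      using lev[OF s row'] by (simp add: P_def)
  qed
  also have "\<dots> = labelling_weight k row col g x"
    unfolding labelling_weight_def Q_def
    by (rule sum.mono_neutral_cong_left) auto
  finally show ?thesis .
qed

text \<open>One extension \<open>y\<close> exists, and the others form the coset of \<open>y\<close>
  by the permutations of \<open>{k..<n}\<close>.\<close>

lemma card_extensions:
  assumes kn: "k \<le> n" and f: "f \<in> {..<k} \<rightarrow>\<^sub>E {..<n::nat}" and inj: "inj_on f {..<k}"
  shows "card {x. x permutes {..<n} \<and> restrict x {..<k} = f} = fact (n - k)"
proof -
  have "f ` {..<k} \<subseteq> {..<n}" using f by auto
  from extend_injection[OF inj this] obtain y
    where y: "y permutes {..<n}" "\<And>i. i < k \<Longrightarrow> y i = f i" by blast
  have yf: "restrict y {..<k} = f"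
  proof
    fix i show "restrict y {..<k} i = f i"
      using y(2)[of i] PiE_arb[OF f, of i] by (cases "i < k") auto
  qed
  have "bij_betw (\<lambda>u. y \<circ> u) {u. u permutes {k..<n}}
      {x. x permutes {..<n} \<and> restrict x {..<k} = f}"
  proof (rule bij_betw_byWitness[where f' = "\<lambda>x. inv y \<circ> x"])
    show "\<forall>u\<in>{u. u permutes {k..<n}}. inv y \<circ> (y \<circ> u) = u"
      "\<forall>x\<in>{x. x permutes {..<n} \<and> restrict x {..<k} = f}. y \<circ> (inv y \<circ> x) = x"
      by (simp_all add: permutes_comp_left_cancel[OF y(1)])
    show "(\<lambda>u. y \<circ> u) ` {u. u permutes {k..<n}}
        \<subseteq> {x. x permutes {..<n} \<and> restrict x {..<k} = f}"
    proof (intro image_subsetI CollectI conjI)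
      fix u assume "u \<in> {u. u permutes {k..<n}}"
      hence u: "u permutes {k..<n}" by simp
      show "y \<circ> u permutes {..<n}"
        by (rule permutes_compose[OF permutes_subset[OF u] y(1)]) auto
      show "restrict (y \<circ> u) {..<k} = f"
        unfolding yf[symmetric] using permutes_not_in[OF u] by (auto simp: restrict_def fun_eq_iff)
    qed
    show "(\<lambda>x. inv y \<circ> x) ` {x. x permutes {..<n} \<and> restrict x {..<k} = f}
        \<subseteq> {u. u permutes {k..<n}}"
    proof (intro image_subsetI CollectI)
      fix x assume "x \<in> {x. x permutes {..<n} \<and> restrict x {..<k} = f}"
      hence x: "x permutes {..<n}" "restrict x {..<k} = f" by auto
      have "x i = y i" if "i < k" for i
        using fun_cong[OF x(2), of i] y(2)[OF that] that by simp
      hence "(inv y \<circ> x) i = i" if "i < k" for i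
        using that permutes_inverses(2)[OF y(1)] by simp
      thus "inv y \<circ> x permutes {k..<n}"
        by (intro permutes_superset[OF permutes_compose[OF x(1) permutes_inv[OF y(1)]]]) auto
    qed
  qed
  from bij_betw_same_card[OF this] show ?thesis
    using card_permutations[of "{k..<n}" "n - k"] by simp
qed

text \<open>Permutations are grouped by their restriction to \<open>{..<k}\<close>. Only injective
  labellings arise this way, but the others have weight 0; enlarging the sum to all labellings makes
  row and column coordinates independent later.\<close>

lemma (in shape) sum_Y_conj:
  assumes g: "g permutes {..<k}" and kn: "k \<le> n"
  shows "(\<Sum>x | x permutes {..<n}. Y (x \<circ> g \<circ> inv x))
    = fact (n - k) * (\<Sum>f\<in>{..<k} \<rightarrow>\<^sub>E {..<n}. labelling_weight k row col g f)"
proof -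
  let ?G = "{x. x permutes {..<n}}" and ?F = "{..<k} \<rightarrow>\<^sub>E {..<n}"
  let ?w = "labelling_weight k row col g"
  have "(\<Sum>x\<in>?G. Y (x \<circ> g \<circ> inv x)) = (\<Sum>x\<in>?G. ?w x)"
    by (intro sum.cong refl) (simp add: Y_conj[OF _ g kn])
  also have "\<dots> = (\<Sum>f\<in>?F. \<Sum>x | x \<in> ?G \<and> restrict x {..<k} = f. ?w x)"
  proof (rule sum.group[symmetric])
    show "(\<lambda>x. restrict x {..<k}) ` ?G \<subseteq> ?F"
      using kn by (simp add: image_subset_iff restrict_PiE_iff permutes_lessThan_less)
  qed (simp_all add: finite_PiE)
  also have "\<dots> = (\<Sum>f\<in>?F. fact (n - k) * ?w f)"
  proof (rule sum.cong[OF refl])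
    fix f assume f: "f \<in> ?F"
    have "?w x = ?w f" if "restrict x {..<k} = f" for x
      by (rule labelling_weight_cong[OF g]) (use that in auto)
    hence "(\<Sum>x | x \<in> ?G \<and> restrict x {..<k} = f. ?w x)
        = of_nat (card {x. x permutes {..<n} \<and> restrict x {..<k} = f}) * ?w f"
      by simp
    also have "\<dots> = fact (n - k) * ?w f"
    proof (cases "inj_on f {..<k}")
      case True
      thus ?thesis using card_extensions[OF kn f True] by simp
    next
      case False
      then obtain a b where "a < k" "b < k" "a \<noteq> b" "f a = f b" by (auto simp: inj_on_def)
      hence "?w f = 0" by (rule labelling_weight_not_inj[OF g])
      thus ?thesis by simp
    qed
    finally show "(\<Sum>x | x \<in> ?G \<and> restrict x {..<k} = f. ?w x) = fact (n - k) * ?w f" .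
  qed
  finally show ?thesis by (simp add: sum_distrib_left)
qed

text \<open>Rectangularity is essential here: every pair of a row and a column is a cell, so the two
  coordinates of a labelling may be chosen independently.\<close>

lemma card_rect_labellings:
  fixes k p q :: nat
  assumes q: "q > 0" and s: "s permutes {..<k}" and t: "t permutes {..<k}"
  shows "card {f \<in> {..<k} \<rightarrow>\<^sub>E {..<p * q}. (\<forall>i<k. f (s i) div q = f i div q)
      \<and> (\<forall>i<k. f (t i) mod q = f i mod q)} = inv_count p {..<k} s * inv_count q {..<k} t"
proof -
  let ?X = "{f \<in> {..<k} \<rightarrow>\<^sub>E {..<p * q}. (\<forall>i<k. f (s i) div q = f i div q)
      \<and> (\<forall>i<k. f (t i) mod q = f i mod q)}"
  note sk = permutes_lessThan_less[OF s] and tk = permutes_lessThan_less[OF t]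
  have "bij_betw (\<lambda>f. (\<lambda>i\<in>{..<k}. f i div q, \<lambda>i\<in>{..<k}. f i mod q)) ?X
      (inv_maps p {..<k} s \<times> inv_maps q {..<k} t)"
  proof (rule bij_betw_byWitness[where f' = "\<lambda>(a, b). \<lambda>i\<in>{..<k}. a i * q + b i"])
    show "\<forall>f\<in>?X. (\<lambda>(a, b). \<lambda>i\<in>{..<k}. a i * q + b i)
        (\<lambda>i\<in>{..<k}. f i div q, \<lambda>i\<in>{..<k}. f i mod q) = f"
    proof
      fix f assume "f \<in> ?X"
      hence f: "f \<in> {..<k} \<rightarrow>\<^sub>E {..<p * q}" by simp
      show "(\<lambda>(a, b). \<lambda>i\<in>{..<k}. a i * q + b i)
          (\<lambda>i\<in>{..<k}. f i div q, \<lambda>i\<in>{..<k}. f i mod q) = f"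
      proof
        fix i
        show "(\<lambda>(a, b). \<lambda>i\<in>{..<k}. a i * q + b i)
            (\<lambda>i\<in>{..<k}. f i div q, \<lambda>i\<in>{..<k}. f i mod q) i = f i"
          using PiE_arb[OF f, of i] by (cases "i < k") auto
      qed
    qed
    show "\<forall>ab\<in>inv_maps p {..<k} s \<times> inv_maps q {..<k} t.
        (\<lambda>i\<in>{..<k}. (\<lambda>(a, b). \<lambda>i\<in>{..<k}. a i * q + b i) ab i div q,
         \<lambda>i\<in>{..<k}. (\<lambda>(a, b). \<lambda>i\<in>{..<k}. a i * q + b i) ab i mod q) = ab"
    proof
      fix ab assume "ab \<in> inv_maps p {..<k} s \<times> inv_maps q {..<k} t"
      then obtain a b where ab: "ab = (a, b)" and a: "a \<in> {..<k} \<rightarrow>\<^sub>E {..<p}"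
        and b: "b \<in> {..<k} \<rightarrow>\<^sub>E {..<q}" by (auto simp: inv_maps_def)
      have "(\<lambda>i\<in>{..<k}. (\<lambda>i\<in>{..<k}. a i * q + b i) i div q) i = a i"
        "(\<lambda>i\<in>{..<k}. (\<lambda>i\<in>{..<k}. a i * q + b i) i mod q) i = b i" for i
        using PiE_arb[OF a, of i] PiE_arb[OF b, of i] PiE_mem[OF b, of i] q
        by (cases "i < k"; simp)+
      thus "(\<lambda>i\<in>{..<k}. (\<lambda>(a, b). \<lambda>i\<in>{..<k}. a i * q + b i) ab i div q,
         \<lambda>i\<in>{..<k}. (\<lambda>(a, b). \<lambda>i\<in>{..<k}. a i * q + b i) ab i mod q) = ab"
        unfolding ab prod.case by (intro arg_cong2[of _ _ _ _ Pair] ext)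
    qed
    show "(\<lambda>f. (\<lambda>i\<in>{..<k}. f i div q, \<lambda>i\<in>{..<k}. f i mod q)) ` ?X
        \<subseteq> inv_maps p {..<k} s \<times> inv_maps q {..<k} t"
    proof (rule image_subsetI)
      fix f assume f: "f \<in> ?X"
      have "f i div q < p" if "i < k" for i
        using f that by (intro less_mult_imp_div_less) auto
      thus "(\<lambda>i\<in>{..<k}. f i div q, \<lambda>i\<in>{..<k}. f i mod q)
          \<in> inv_maps p {..<k} s \<times> inv_maps q {..<k} t"
        using f q by (auto simp: inv_maps_def sk tk)
    qed
    show "(\<lambda>(a, b). \<lambda>i\<in>{..<k}. a i * q + b i) ` (inv_maps p {..<k} s \<times> inv_maps q {..<k} t) \<subseteq> ?X"
    proof (rule image_subsetI)
      fix ab assume "ab \<in> inv_maps p {..<k} s \<times> inv_maps q {..<k} t"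
      then obtain a b where ab: "ab = (a, b)" and a: "a \<in> {..<k} \<rightarrow>\<^sub>E {..<p}"
        and b: "b \<in> {..<k} \<rightarrow>\<^sub>E {..<q}" and inv: "\<And>i. i < k \<Longrightarrow> a (s i) = a i"
          "\<And>i. i < k \<Longrightarrow> b (t i) = b i" by (auto simp: inv_maps_def)
      have ai: "a i < p" and bi: "b i < q" if "i < k" for i
        using a b that by auto
      have "a i * q + b i < p * q" if "i < k" for i
      proof -
        have "a i * q + b i < Suc (a i) * q" using bi[OF that] by simp
        also have "\<dots> \<le> p * q" using ai[OF that] by (intro mult_le_mono1) simp
        finally show ?thesis .
      qed
      thus "(\<lambda>(a, b). \<lambda>i\<in>{..<k}. a i * q + b i) ab \<in> ?X"
        using inv bi q by (auto simp: ab sk tk)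
    qed
  qed
  from bij_betw_same_card[OF this] show ?thesis
    by (simp add: inv_count_def card_cartesian_product)
qed

text \<open>Stanley's formula in convolution form: rows contribute the untwisted power of
  \<open>p\<close> at \<open>s\<close>, columns the signed power of \<open>q\<close> at
  \<open>inv s \<circ> g\<close>.\<close>

lemma sum_labelling_weight_rect:
  assumes q: "q > 0" and g: "g permutes {..<k}"
  shows "(\<Sum>f\<in>{..<k} \<rightarrow>\<^sub>E {..<p * q}. labelling_weight k (\<lambda>m. m div q) (\<lambda>m. m mod q) g f)
    = galg_mult k (power_fun k 1 p) (power_fun k (-1) q) g"
proof -
  let ?F = "{..<k} \<rightarrow>\<^sub>E {..<p * q}"
  let ?c = "\<lambda>s f. (\<forall>i<k. f (s i) div q = f i div q) \<and> (\<forall>i<k. f ((inv s \<circ> g) i) mod q = f i mod q)"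
  have fin: "finite ?F" by (simp add: finite_PiE)
  have "(\<Sum>f\<in>?F. labelling_weight k (\<lambda>m. m div q) (\<lambda>m. m mod q) g f)
      = (\<Sum>s | s permutes {..<k}. \<Sum>f\<in>?F. if ?c s f then of_int (sign (inv s \<circ> g)) else 0)"
    unfolding labelling_weight_def by (rule sum.swap)
  also have "\<dots> = (\<Sum>s | s permutes {..<k}. power_fun k 1 p s * power_fun k (-1) q (inv s \<circ> g))"
  proof (rule sum.cong[OF refl])
    fix s assume "s \<in> {s. s permutes {..<k}}"
    hence s: "s permutes {..<k}" by simp
    have t: "inv s \<circ> g permutes {..<k}" using s g by (auto intro: permutes_compose permutes_inv)
    have "(\<Sum>f\<in>?F. if ?c s f then of_int (sign (inv s \<circ> g)) else 0)
        = (\<Sum>f\<in>{f \<in> ?F. ?c s f}. of_int (sign (inv s \<circ> g)) :: complex)"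
      by (rule sum.inter_filter[OF fin, symmetric])
    also have "\<dots> = of_nat (inv_count p {..<k} s * inv_count q {..<k} (inv s \<circ> g))
        * of_int (sign (inv s \<circ> g))"
      unfolding card_rect_labellings[OF q s t, symmetric] by simp
    finally show "(\<Sum>f\<in>?F. if ?c s f then of_int (sign (inv s \<circ> g)) else 0)
        = power_fun k 1 p s * power_fun k (-1) q (inv s \<circ> g)"
      using s t by (simp add: power_fun_def twist_sign)
  qed
  also have "\<dots> = galg_mult k (power_fun k 1 p) (power_fun k (-1) q) g"
    using g by (simp add: galg_mult_apply)
  finally show ?thesis .
qed

section \<open>Permutations with one prescribed cycle and fixed points\<close>

lemma cycle_type_single_cycle:
  assumes w: "w permutes {..<n}" and ct: "cycle_type n w = mset [k] + replicate_mset (n - k) 1"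
  obtains x where "x < n" "card (orbit w x) = k" "\<And>y. y < n \<Longrightarrow> y \<notin> orbit w x \<Longrightarrow> w y = y"
proof -
  have perm: "permutation w" using w by (auto intro: permutes_imp_permutation)
  have "image_mset card (mset_set (orbit w ` {..<n})) = add_mset k (replicate_mset (n - k) 1)"
    using ct by (simp add: cycle_type_def)
  from msed_map_invR[OF this] obtain N Z where
    N: "mset_set (orbit w ` {..<n}) = add_mset Z N" and Z: "card Z = k"
    and img: "image_mset card N = replicate_mset (n - k) 1" by auto
  have mem: "Q \<in># add_mset Z N \<longleftrightarrow> Q \<in> orbit w ` {..<n}" for Q
    unfolding N[symmetric] by simp
  from mem[of Z] obtain x where x: "x < n" "Z = orbit w x" by auto
  show ?thesis
  proof (rule that[OF x(1)])
    show "card (orbit w x) = k" using Z x(2) by simp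
    fix y assume y: "y < n" "y \<notin> orbit w x"
    have self: "y \<in> orbit w y" using perm by (rule permutation_self_in_orbit)
    have "orbit w y \<noteq> Z" using self y(2) x(2) by auto
    hence "orbit w y \<in># N" using mem[of "orbit w y"] y(1) by auto
    hence "card (orbit w y) \<in># image_mset card N" by simp
    hence "card (orbit w y) = 1" unfolding img by (simp split: if_splits)
    hence "orbit w y = {y}" using self by (auto simp: card_1_singleton_iff)
    thus "w y = y" by (simp add: orbit_eq_singleton_iff)
  qed
qed

text \<open>Provides a witness, so that the choice of a permutation in \<open>irr_char\<close>
  really has the intended cycle type.\<close>

lemma cycle_type_cyc:
  assumes k: "0 < k" "k \<le> n"
  shows "cycle_type n (cyc k) = mset [k] + replicate_mset (n - k) 1"
proof -
  have pow: "(cyc k ^^ i) 0 = i" if "i < k" for i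
    using that by (induction i) (auto simp: cyc_def)
  have perm: "permutation (cyc k)" using cyc_permutes[of k] by (auto intro: permutes_imp_permutation)
  have "i \<in> orbit (cyc k) 0" if "i < k" for i
    using funpow_in_orbit[OF permutation_self_in_orbit[OF perm, of 0], of i] pow[OF that] by simp
  hence "orbit (cyc k) 0 = {..<k}"
    using permutes_orbit_subset[OF cyc_permutes, of 0 k] k by auto
  hence "cyclic_on (cyc k) {..<k}"
    using cyclic_on_orbit'[OF perm, of 0] by simp
  hence small: "orbit (cyc k) i = {..<k}" if "i < k" for i
    using orbit_cyclic_eq3[of "cyc k" "{..<k}" i] that by simp
  have large: "orbit (cyc k) i = {i}" if "i \<ge> k" for i
    using that by (simp add: orbit_eq_singleton_iff cyc_def)
  have "orbit (cyc k) ` {..<n} = insert {..<k} ((\<lambda>i. {i}) ` {k..<n})"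
  proof (intro equalityI subsetI)
    fix Q assume "Q \<in> orbit (cyc k) ` {..<n}"
    then obtain i where "i < n" "Q = orbit (cyc k) i" by auto
    thus "Q \<in> insert {..<k} ((\<lambda>i. {i}) ` {k..<n})"
      using small[of i] large[of i] by (cases "i < k") auto
  next
    fix Q assume "Q \<in> insert {..<k} ((\<lambda>i. {i}) ` {k..<n})"
    thus "Q \<in> orbit (cyc k) ` {..<n}"
    proof
      assume "Q = {..<k}"
      thus ?thesis using small[of 0] k by (intro image_eqI[of _ _ 0]) auto
    next
      assume "Q \<in> (\<lambda>i. {i}) ` {k..<n}"
      then obtain i where "k \<le> i" "i < n" "Q = {i}" by auto
      thus ?thesis using large[of i] by (intro image_eqI[of _ _ i]) auto
    qed
  qed
  moreover have "{..<k} \<notin> (\<lambda>i. {i}) ` {k..<n}"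
  proof
    assume "{..<k} \<in> (\<lambda>i. {i}) ` {k..<n}"
    then obtain i where i: "k \<le> i" "{..<k} = {i}" by force
    have "0 \<in> {..<k}" using k by simp
    thus False using i k unfolding i(2) by simp
  qed
  ultimately have "cycle_type n (cyc k)
      = add_mset k (image_mset card (mset_set ((\<lambda>i. {i}) ` {k..<n})))"
    by (simp add: cycle_type_def)
  also have "mset_set ((\<lambda>i. {i}) ` {k..<n}) = image_mset (\<lambda>i. {i}) (mset_set {k..<n})"
    by (rule image_mset_mset_set[symmetric]) simp
  also have "image_mset card \<dots> = image_mset (\<lambda>_. 1) (mset_set {k..<n})"
    by (simp add: image_mset.compositionality o_def)
  also have "\<dots> = replicate_mset (n - k) 1"
    by (simp add: image_mset_const_eq)
  finally show ?thesis by simp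
qed

theorem Ch_rect_cycle:
  assumes k: "k > 0" and pq: "p > 0" "q > 0"
  shows "Ch [k] (replicate p q)
    = galg_mult k (power_fun k 1 p) (power_fun k (-1) q) (inv (cyc k))"
proof -
  let ?n = "p * q"
  let ?w = "labelling_weight k (\<lambda>m. m div q) (\<lambda>m. m mod q) (inv (cyc k))"
  interpret shape ?n "\<lambda>m. m div q" "\<lambda>m. m mod q" by (rule shape_rect[OF pq(2)])
  have g: "inv (cyc k) permutes {..<k}" by (rule permutes_inv[OF cyc_permutes])
  note sum = sum_labelling_weight_rect[OF pq(2) g, of p]
  show ?thesis
  proof (cases "k \<le> ?n")
    \<comment> \<open>Here \<open>Ch\<close> is 0 by definition, and the convolution agrees because
      there are too few cells for an injective labelling.\<close>
    case False
    have "?w f = 0" if f: "f \<in> {..<k} \<rightarrow>\<^sub>E {..<?n}" for f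
    proof -
      have "\<not> inj_on f {..<k}"
      proof
        assume "inj_on f {..<k}"
        hence "card {..<k} \<le> card {..<?n}" using f by (intro card_inj_on_le[of f]) auto
        thus False using False by simp
      qed
      then obtain a b where "a < k" "b < k" "a \<noteq> b" "f a = f b" by (auto simp: inj_on_def)
      thus ?thesis by (rule labelling_weight_not_inj[OF g])
    qed
    hence "(\<Sum>f\<in>{..<k} \<rightarrow>\<^sub>E {..<?n}. ?w f) = 0" by simp
    thus ?thesis using False sum by (simp add: Ch_def Let_def sum_list_replicate)
  next
    case True
    let ?V = "(\<lambda>f. galg_mult ?n f Y) ` group_algebra ?n"
    let ?mu = "mset [k] + replicate_mset (?n - k) 1"
    define w where "w = (SOME w. w permutes {..<?n} \<and> cycle_type ?n w = ?mu)"
    have "cyc k permutes {..<?n} \<and> cycle_type ?n (cyc k) = ?mu"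
      using cycle_type_cyc[OF k True] permutes_subset[OF cyc_permutes, of k "{..<?n}"] True by simp
    hence "\<exists>w. w permutes {..<?n} \<and> cycle_type ?n w = ?mu" by blast
    hence "w permutes {..<?n} \<and> cycle_type ?n w = ?mu"
      unfolding w_def by (rule someI_ex)
    hence w: "w permutes {..<?n}" and ct: "cycle_type ?n w = ?mu" by blast+
    obtain x where x: "x < ?n" "card (orbit w x) = k"
      "\<And>y. y < ?n \<Longrightarrow> y \<notin> orbit w x \<Longrightarrow> w y = y"
      by (rule cycle_type_single_cycle[OF w ct]) blast
    obtain y where y: "y permutes {..<?n}" "w = y \<circ> cyc k \<circ> inv y"
      by (rule single_cycle_conjugate[OF w x])
    have cycn: "cyc k permutes {..<?n}"
      using permutes_subset[OF cyc_permutes, of k "{..<?n}"] True by simp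
    have char: "irr_char (replicate p q) ?mu = galg_trace ?V (galg_mult ?n (galg_of w))"
      by (simp add: irr_char_def specht_char_def specht_module_def young_symmetrizer_rect
          sum_list_replicate w_def)
    have dim: "specht_dim (replicate p q) = galg.dim ?V"
      by (simp add: specht_dim_def specht_module_def young_symmetrizer_rect sum_list_replicate)
    have "irr_char (replicate p q) ?mu / of_nat (specht_dim (replicate p q))
        = (\<Sum>x | x permutes {..<?n}. Y (inv x \<circ> inv w \<circ> x)) / fact ?n"
      unfolding char dim by (rule character_ratio[OF w])
    \<comment> \<open>Translating by \<open>y\<close> replaces the unspecified \<open>w\<close> by
      the standard cycle.\<close>
    also have "(\<Sum>x | x permutes {..<?n}. Y (inv x \<circ> inv w \<circ> x))
        = (\<Sum>x | x permutes {..<?n}. Y (inv (y \<circ> x) \<circ> inv w \<circ> (y \<circ> x)))"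
      by (rule setum_permutations_compose_left[OF y(1)])
    also have "\<dots> = (\<Sum>x | x permutes {..<?n}. Y (inv x \<circ> inv (cyc k) \<circ> x))"
    proof (rule sum.cong[OF refl])
      fix x assume "x \<in> {x. x permutes {..<?n}}"
      hence x: "x permutes {..<?n}" by simp
      have "inv (y \<circ> x) \<circ> inv w \<circ> (y \<circ> x) = inv x \<circ> inv (cyc k) \<circ> x"
        unfolding y(2) inv_conj[OF y(1) cycn] permutes_inv_comp[OF y(1) x]
        by (simp add: comp_assoc permutes_comp_left_cancel[OF y(1)])
      thus "Y (inv (y \<circ> x) \<circ> inv w \<circ> (y \<circ> x)) = Y (inv x \<circ> inv (cyc k) \<circ> x)" by simp
    qed
    also have "\<dots> = (\<Sum>x | x permutes {..<?n}. Y (inv (inv x) \<circ> inv (cyc k) \<circ> inv x))"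
      by (rule sum_permutations_inverse)
    also have "\<dots> = (\<Sum>x | x permutes {..<?n}. Y (x \<circ> inv (cyc k) \<circ> inv x))"
      by (intro sum.cong refl) (simp add: permutes_inv_inv[of _ "{..<?n}"])
    also have "\<dots> = fact (?n - k) * galg_mult k (power_fun k 1 p) (power_fun k (-1) q) (inv (cyc k))"
      unfolding sum_Y_conj[OF g True] sum ..
    finally have ratio: "irr_char (replicate p q) ?mu / of_nat (specht_dim (replicate p q))
        = fact (?n - k) * galg_mult k (power_fun k 1 p) (power_fun k (-1) q) (inv (cyc k))
          / fact ?n" .
    have "Ch [k] (replicate p q) = falling (of_nat ?n) k
        * (irr_char (replicate p q) ?mu / of_nat (specht_dim (replicate p q)))"
      using True by (simp add: Ch_def Let_def sum_list_replicate)
    thus ?thesis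
      unfolding ratio falling_of_nat[OF True] by simp
  qed
qed

section \<open>The interpolating polynomial\<close>

lemma poly_map_poly_add:
  assumes "\<phi> 0 = 0" "\<And>a b. \<phi> (a + b) = \<phi> a + \<phi> b"
  shows "poly (map_poly \<phi> (P + Q)) x = poly (map_poly \<phi> P) x + poly (map_poly \<phi> Q) x"
proof -
  have "map_poly \<phi> (P + Q) = map_poly \<phi> P + map_poly \<phi> Q"
    by (rule poly_eqI) (simp add: coeff_map_poly assms)
  thus ?thesis by simp
qed

lemma poly_map_poly_mult:
  fixes \<phi> :: "'a::comm_ring_1 \<Rightarrow> 'b::comm_ring_1"
  assumes "\<phi> 0 = 0" "\<And>a b. \<phi> (a + b) = \<phi> a + \<phi> b" "\<And>a b. \<phi> (a * b) = \<phi> a * \<phi> b"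
  shows "poly (map_poly \<phi> (P * Q)) x = poly (map_poly \<phi> P) x * poly (map_poly \<phi> Q) x"
proof (induction P)
  case (pCons a P)
  have smult: "map_poly \<phi> (smult a Q) = smult (\<phi> a) (map_poly \<phi> Q)"
    by (rule poly_eqI) (simp add: coeff_map_poly assms)
  show ?case
    using pCons.IH
    by (simp add: poly_map_poly_add assms smult map_poly_pCons algebra_simps)
qed simp

lemma eval_rat_add: "poly (map_poly of_rat (a + b)) p
    = poly (map_poly of_rat a) p + (poly (map_poly of_rat b) p :: complex)"
  and eval_rat_mult: "poly (map_poly of_rat (a * b)) p
    = poly (map_poly of_rat a) p * (poly (map_poly of_rat b) p :: complex)"
  by (simp_all add: poly_map_poly_add poly_map_poly_mult of_rat_add of_rat_mult)

lemma eval_pq_add: "eval_pq (P + Q) p q = eval_pq P p q + eval_pq Q p q"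
  unfolding eval_pq_def by (rule poly_map_poly_add) (simp_all add: eval_rat_add)

lemma eval_pq_mult: "eval_pq (P * Q) p q = eval_pq P p q * eval_pq Q p q"
  unfolding eval_pq_def by (rule poly_map_poly_mult) (simp_all add: eval_rat_add eval_rat_mult)

lemma eval_pq_const: "eval_pq [:[:c:]:] p q = of_rat c"
  by (cases "c = 0") (simp_all add: eval_pq_def map_poly_pCons)

lemma eval_pq_0 [simp]: "eval_pq 0 p q = 0"
  by (simp add: eval_pq_def)

lemma eval_pq_1 [simp]: "eval_pq 1 p q = 1"
  using eval_pq_const[of 1 p q] by (simp add: one_pCons)

lemma eval_pq_diff: "eval_pq (P - Q) p q = eval_pq P p q - eval_pq Q p q"
  using eval_pq_add[of "P - Q" Q p q] by simp

lemma eval_pq_of_nat: "eval_pq (of_nat n) p q = of_nat n"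
  by (induction n) (simp_all add: eval_pq_add)

lemma eval_pq_power: "eval_pq (P ^ n) p q = eval_pq P p q ^ n"
  by (induction n) (simp_all add: eval_pq_mult)

lemma eval_pq_sum: "eval_pq (\<Sum>i\<in>I. F i) p q = (\<Sum>i\<in>I. eval_pq (F i) p q)"
  by (induction I rule: infinite_finite_induct) (simp_all add: eval_pq_add)

lemma eval_pq_prod: "eval_pq (\<Prod>i\<in>I. F i) p q = (\<Prod>i\<in>I. eval_pq (F i) p q)"
  by (induction I rule: infinite_finite_induct) (simp_all add: eval_pq_mult)

section \<open>Uniqueness of the interpolating polynomial\<close>

lemma poly_eq_on_positive_nats:
  fixes P Q :: "complex poly"
  assumes "\<And>n. n > 0 \<Longrightarrow> poly P (of_nat n) = poly Q (of_nat n)"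
  shows "P = Q"
proof (rule ccontr)
  assume "P \<noteq> Q"
  hence "finite {x. poly (P - Q) x = 0}" by (intro poly_roots_finite) simp
  moreover have "of_nat ` {0<..} \<subseteq> {x. poly (P - Q) x = 0}" using assms by auto
  ultimately have "finite (of_nat ` {0::nat<..} :: complex set)" by (rule finite_subset[rotated])
  hence "finite {0::nat<..}" by (rule finite_imageD) (simp add: inj_on_def)
  thus False using infinite_Ioi by blast
qed

text \<open>One variable at a time: for fixed \<open>p\<close> the coefficients in \<open>q\<close>
  agree, and each of these is a polynomial in \<open>p\<close> with infinitely many agreements.
  Injectivity of \<open>of_rat\<close> returns to rational coefficients.\<close>

lemma eval_pq_inject:
  assumes "\<And>p q. p > 0 \<Longrightarrow> q > 0 \<Longrightarrow>
    eval_pq P (of_nat p) (of_nat q) = eval_pq Q (of_nat p) (of_nat q)"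
  shows "P = Q"
proof (rule poly_eqI)
  fix i
  have "poly (map_poly of_rat (coeff P i)) (of_nat p)
      = (poly (map_poly of_rat (coeff Q i)) (of_nat p) :: complex)" if "p > 0" for p
  proof -
    have "map_poly (\<lambda>a. poly (map_poly of_rat a) (of_nat p :: complex)) P
        = map_poly (\<lambda>a. poly (map_poly of_rat a) (of_nat p)) Q"
      by (rule poly_eq_on_positive_nats) (use assms[OF that] in \<open>simp add: eval_pq_def\<close>)
    from arg_cong[OF this, of "\<lambda>R. coeff R i"] show ?thesis by (simp add: coeff_map_poly)
  qed
  hence "map_poly of_rat (coeff P i) = (map_poly of_rat (coeff Q i) :: complex poly)"
    by (rule poly_eq_on_positive_nats)
  hence "coeff (map_poly of_rat (coeff P i)) n = (coeff (map_poly of_rat (coeff Q i)) n :: complex)"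
    for n by simp
  thus "coeff P i = coeff Q i" by (intro poly_eqI) (simp add: coeff_map_poly)
qed

theorem Ch_rect_single_cycle:
  assumes k: "k > 0"
  shows "fact k * Ch_rect [k] p q = (\<Sum>r\<le>k-1. (-1) ^ r * of_nat ((k - 1) choose r)
      * (\<Prod>i<k. p - of_nat r + of_nat i) * (\<Prod>i<k. q + of_nat r - of_nat i))"
proof -
  \<comment> \<open>The closed form with \<open>p\<close> and \<open>q\<close> as indeterminates;
    \<open>0 - 1\<close> stands for -1 so that evaluation passes through the rule for
    differences.\<close>
  define P :: "rat poly poly" where "P = [:[:inverse (fact k):]:] * (\<Sum>r\<le>k-1.
    (0 - 1) ^ r * of_nat ((k - 1) choose r)
      * (\<Prod>i<k. [:[:0, 1:]:] - of_nat r + of_nat i) * (\<Prod>i<k. [:0, 1:] + of_nat r - of_nat i))"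
  have X: "eval_pq [:[:0, 1:]:] p q = p" and Y: "eval_pq [:0, 1:] p q = q" for p q
    by (simp_all add: eval_pq_def map_poly_pCons)
  have fk: "of_rat (fact k) = (fact k :: complex)"
    using of_rat_of_nat_eq[of "fact k"] by simp
  have P: "fact k * eval_pq P p q = (\<Sum>r\<le>k-1. (-1) ^ r * of_nat ((k - 1) choose r)
      * (\<Prod>i<k. p - of_nat r + of_nat i) * (\<Prod>i<k. q + of_nat r - of_nat i))" for p q
    unfolding P_def eval_pq_mult eval_pq_add eval_pq_diff eval_pq_const eval_pq_of_nat
      eval_pq_power eval_pq_sum eval_pq_prod X Y eval_pq_0 eval_pq_1 of_rat_inverse
    by (simp add: fk)
  have agree: "\<forall>p>0. \<forall>q>0. eval_pq P (of_nat p) (of_nat q) = Ch [k] (replicate p q)"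
  proof (intro allI impI)
    fix p q :: nat assume pq: "p > 0" "q > 0"
    have "fact k * eval_pq P (of_nat p) (of_nat q) = fact k * Ch [k] (replicate p q)"
      unfolding P Ch_rect_cycle[OF k pq] full_cycle_convolution[OF k] ..
    thus "eval_pq P (of_nat p) (of_nat q) = Ch [k] (replicate p q)" by simp
  qed
  have "Ch_rect_poly [k] = P"
    unfolding Ch_rect_poly_def
  proof (rule the_equality[where P = "\<lambda>P. \<forall>p>0. \<forall>q>0.
      eval_pq P (of_nat p) (of_nat q) = Ch [k] (replicate p q)", OF agree])
    fix Q assume "\<forall>p>0. \<forall>q>0. eval_pq Q (of_nat p) (of_nat q) = Ch [k] (replicate p q)"
    thus "Q = P" using agree by (intro eval_pq_inject) simp
  qed
  thus ?thesis unfolding Ch_rect_def by (simp add: P)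
qed

theorem theorem1p10:
  fixes j :: nat and d e :: complex
  assumes "j > 0"
  shows "Ch_rect [2 * j] (e - d) (e + d) =
    (-1) ^ (j - 1) * of_nat ((2 * j - 1) choose j) *
    (\<Sum>k=0..j. g_coeff k j * (2 * d)
       * (\<Prod>r=1..k. d\<^sup>2 - (of_nat r - 1/2)\<^sup>2)
       * (\<Prod>r=k+1..j. e\<^sup>2 - (of_nat r - 1/2)\<^sup>2))"
proof -
  have "fact (2 * j) * Ch_rect [2 * j] (e - d) (e + d) = fact (2 * j) *
    ((-1) ^ (j - 1) * of_nat ((2 * j - 1) choose j) *
    (\<Sum>k=0..j. g_coeff k j * (2 * d)
       * (\<Prod>r=1..k. d\<^sup>2 - (of_nat r - 1/2)\<^sup>2)
       * (\<Prod>r=k+1..j. e\<^sup>2 - (of_nat r - 1/2)\<^sup>2)))"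
    unfolding alternating_sum_evaluation[OF assms, symmetric]
    by (rule Ch_rect_single_cycle) (use assms in simp)
  thus ?thesis by simp
qed

end
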